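(* Let $S=(W,\mathcal W,m,\mathbb D,\Gamma)$ be an error structure admitting a D-gradient $D:\mathbb D\to L^2(m,H)$ with $H$ a separable Hilbert space, and let $\nu$ be an $H$-valued white noise measure on $(W,\mathcal W)$ with associated positive measure $m$. Let $X\in\mathbb D^d$, let $S_X=(\mathbb R^d,\mathcal B(\mathbb R^d),X_*m,\mathbb D_X,\Gamma_X)$ be the image of $S$ by $X$, and for $F\in\mathbb D_X$ let $d_GF=X_*(d_G(F\circ X))$. Then: a) For all $F\in\mathbb D_X$, the positive measure $\mathbb E_{\mathbb P}(d_GF)^2$ associated with $d_GF$ is absolutely continuous with respect to $X_*m$ and $$\frac{\mathbb E_{\mathbb P}(d_GF)^2}{dX_*m}=\Gamma_X[F].$$ b) For all $F:\mathbb R^d\to\mathbb R$ of class $C^1$ and Lipschitz, $$d_GF=\nabla F^t\cdot d_GI,$$ where $\nabla F$ is the usual gradient of $F$ and $I$ is the identity map from $\mathbb R^d$ onto $\mathbb R^d$, which belongs to $(\mathbb D_X)^d$. The $\mathbb R^d$-valued white noise measure $d_GI=X_*d_GX$ has as associated positive matrix of measures $(\Gamma_X[I_i,I_j]\cdot X_*m)_{ij}$.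
   Context: **Error structure.** $(W,\mathcal W,m,\mathbb D,\Gamma)$ is an error structure if $(W,\mathcal W,m)$ is a probability space and: (1) $\mathbb D$ is a dense vector subspace of $L^2(W,\mathcal W,m)$; (2) $\Gamma$ is a symmetric positive bilinear operator from $\mathbb D\times\mathbb D$ into $L^1(m)$ such that for $u\in\mathbb D^k$, $v\in\mathbb D^n$ and $F:\mathbb R^k\to\mathbb R$, $G:\mathbb R^n\to\mathbb R$ Lipschitz and $C^1$, one has $F(u)\in\mathbb D$, $G(v)\in\mathbb D$ and $\Gamma[F(u),G(v)]=\sum_{i,j}F_i'(u)G_j'(v)\Gamma[u_i,v_j]$ $m$-a.e.; (3) the form $\mathcal E[u,v]=\frac12\int\Gamma[u,v]\,dm$ is closed, i.e. $\mathbb D$ is complete for the norm $\|u\|_{\mathbb D}=(\|u\|_{L^2(m)}^2+\mathcal E[u,u])^{1/2}$. One writes $\Gamma[u]=\Gamma[u,u]$. **Image structure.** For $X\in\mathbb D^d$, $S_X=(\mathbb R^d,\mathcal B(\mathbb R^d),X_*m,\mathbb D_X,\Gamma_X)$, where $X_*m$ is the image measure of $m$ by $X$, $\mathbb D_X$ is the closure of the space of $C^1$ Lipschitz functions $u:\mathbb R^d\to\mathbb R$ for the norm $\|u\|_{\mathbb D_X}=\|u\circ X\|_{\mathbb D}$, and $\Gamma_X[u](x)=\mathbb E[\Gamma[u\circ X]\mid X=x]$ (conditional expectation under $m$; $\Gamma_X[u,v]$ by polarization). $S_X$ is again an error structure. **D-gradient.** A D-gradient for the error structure, with auxiliary separable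 Hilbert space $H$, is a linear map $D:\mathbb D\to L^2(m,H)$ with $\|D[U]\|_H^2=\Gamma[U]$ for all $U\in\mathbb D$. **Scalar white noise measures.** Let $\mu$ be a bounded positive measure on a measurable space $(E,\mathcal F)$. A (Gaussian) white noise measure on $(E,\mathcal F)$ defined on a probability space $(\Omega,\mathcal A,\mathbb P)$ with associated positive measure $\mu$ is a map $\lambda:\mathcal F\to L^2(\Omega,\mathcal A,\mathbb P)$ such that: $\lambda(A)$ is a centered Gaussian variable with variance $\mu(A)$ for all $A\in\mathcal F$; $A\mapsto\lambda(A)$ is $\sigma$-additive in $L^2(\Omega,\mathcal A,\mathbb P)$; and $\lambda(A_1),\dots,\lambda(A_k)$ are independent whenever $A_1,\dots,A_k\in\mathcal F$ are pairwise disjoint. It extends uniquely to $L^2(E,\mathcal F,\mu)$, and one writes $\lambda(f)=\int f\,d\lambda$. For a function $\varphi\in L^2(E,\mathcal F,\mu)$, $\varphi\lambda$ is the map $A\mapsto\int 1_A\varphi\,d\lambda$. The associated positive measure $\mu$ is also denoted $\mathbb E_{\mathbb P}(d\lambda)^2$. **$H$-valued white noise measures.** Given a bounded positive measure $\mu$ on $(E,\mathcal F)$ and a separable Hilbert space $H$, an $H$-valued white noise measure with associated positive measure $\mu$, defined thanks to an auxiliary probability space $(\Omega,\mathcal A,\mathbb P)$, is a map $\nu$ from $\mathcal F$ into $L^2((\Omega,\mathcal A,\mathbb P);H)$ such that: (α) for all $A\in\mathcal F$ and $h\in H$, $\langle\nu(A),h\rangle_H$ is a centered Gaussian variable with variance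 $\mu(A)\|h\|_H^2$; (β) $A\mapsto\nu(A)$ is $\sigma$-additive in $L^2((\Omega,\mathcal A,\mathbb P);H)$; (γ) if $A_1,\dots,A_k\in\mathcal F$ are pairwise disjoint, then for all $h\in H$ the variables $\langle\nu(A_1),h\rangle,\dots,\langle\nu(A_k),h\rangle$ are independent. **The scalar white noise measure $(\psi,\nu)$.** For $x\in H$, $(x,\nu)$ is the scalar white noise measure $A\mapsto\langle x,\nu(A)\rangle_H$, with associated positive measure $\|x\|_H^2\mu$. For $\psi\in L^2((E,\mathcal F,\mu);H)$, the scalar white noise measure $(\psi,\nu)$, with associated positive measure $\|\psi\|_H^2\cdot\mu$, is defined as follows: if $\psi$ is decomposable, $\psi=\sum_{i=1}^k\psi_i(w)h_i$ with scalar functions $\psi_i$ and $h_i\in H$, then $(\psi,\nu)=\sum_{i=1}^k\psi_i\cdot(h_i,\nu)$; in general, take decomposable $\psi_n\to\psi$ in $L^2((E,\mathcal F,\mu);H)$ and put $(\psi,\nu)(A)=\lim_n(\psi_n,\nu)(A)$ in $L^2(\Omega,\mathcal A,\mathbb P)$. **Measure-valued gradient.** With $(E,\mathcal F,\mu)=(W,\mathcal W,m)$ and $Y\in\mathbb D$, the measure-valued gradient of $Y$ is the scalar white noise measure $d_GY=(DY,\nu)$; for $Y\in\mathbb D^d$, $d_GY$ is the column vector of the measure-valued gradients of its components, an $\mathbb R^d$-valued white noise measure. **Images.** For a white noise measure $\lambda$ on $(W,\mathcal W)$, $X_*\lambda$ is defined by $(X_*\lambda)(A)=\lambda(X^{-1}(A))$,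 $A\in\mathcal B(\mathbb R^d)$ (componentwise for vector-valued $\lambda$). For $F\in\mathbb D_X$, $d_GF=X_*(d_G(F\circ X))$; for $\Phi=(\Phi_1,\dots,\Phi_k)\in(\mathbb D_X)^k$, $d_G\Phi$ is the column vector $(d_G\Phi_i)$. For an $\mathbb R^d$-valued white noise measure $\lambda=(\lambda_1,\dots,\lambda_d)^t$ and an $\mathbb R^d$-valued function $\varphi$, $\varphi^t\cdot\lambda$ is the map $A\mapsto\sum_i\int_A\varphi_i\,d\lambda_i$. The matrix of measures associated with $\lambda$ has entries $A\mapsto\mathbb E_{\mathbb P}[\lambda_i(A)\lambda_j(A)]$.
   Formalization: Condition (γ) is strengthened: for pairwise disjoint A_1,…,A_k the H-valued variables ν(A_1),…,ν(A_k) are independent, not only ⟨ν(A_i),h⟩ for one common h; with the literal (γ), (ψ,ν) need not have associated measure ‖ψ‖²μ and a) can fail. *)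

theory Defs
  imports "HOL-Probability.Probability"
begin

text \<open>
  Elements of $L^2$ are represented by measurable functions. Accordingly, domains are sets of
  functions closed under almost sure equality, operators respect almost sure equality, and
  equations between their values hold almost surely.
\<close>

definition L2_space :: "'a measure \<Rightarrow> ('a \<Rightarrow> 'b::real_normed_vector) set" where
  "L2_space M = {f \<in> borel_measurable M. integrable M (\<lambda>x. (norm (f x))\<^sup>2)}"

text \<open>Membership is required explicitly because the integral of a non-integrable function is 0.\<close>

definition L2_tendsto ::
    "'a measure \<Rightarrow> (nat \<Rightarrow> 'a \<Rightarrow> 'b::real_normed_vector) \<Rightarrow> ('a \<Rightarrow> 'b) \<Rightarrow> bool" where
  "L2_tendsto M f g \<longleftrightarrow> (\<forall>n. f n \<in> L2_space M) \<and> g \<in> L2_space M \<and>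
     (\<lambda>n. \<integral>x. (norm (f n x - g x))\<^sup>2 \<partial>M) \<longlonglongrightarrow> 0"

text \<open>
  The functional calculus of an error structure quantifies over all dimensions $k$, so here a
  function on $R^k$ is a function of real sequences. The Lipschitz condition, for the Euclidean
  distance of the first $k$ coordinates, forces it to depend on these coordinates only. For such
  functions continuity in the product topology is continuity on $R^k$, and $C^1$ means that the
  partial derivatives exist and are continuous.
\<close>

definition partial_deriv :: "((nat \<Rightarrow> real) \<Rightarrow> real) \<Rightarrow> nat \<Rightarrow> (nat \<Rightarrow> real) \<Rightarrow> real" where
  "partial_deriv F i x = deriv (\<lambda>t. F (x(i := t))) (x i)"

definition C1_Lipschitz_coords :: "nat \<Rightarrow> ((nat \<Rightarrow> real) \<Rightarrow> real) \<Rightarrow> bool" where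
  "C1_Lipschitz_coords k F \<longleftrightarrow>
     (\<exists>C. \<forall>x y. \<bar>F x - F y\<bar> \<le> C * L2_set (\<lambda>i. x i - y i) {..<k}) \<and>
     (\<forall>i<k. (\<forall>x. (\<lambda>t. F (x(i := t))) differentiable at (x i)) \<and>
            continuous_on UNIV (partial_deriv F i))"

definition energy_form ::
    "'w measure \<Rightarrow> (('w \<Rightarrow> real) \<Rightarrow> ('w \<Rightarrow> real) \<Rightarrow> 'w \<Rightarrow> real) \<Rightarrow>
     ('w \<Rightarrow> real) \<Rightarrow> ('w \<Rightarrow> real) \<Rightarrow> real" where
  "energy_form M \<Gamma> u v = 1 / 2 * (\<integral>w. \<Gamma> u v w \<partial>M)"

definition energy_norm ::
    "'w measure \<Rightarrow> (('w \<Rightarrow> real) \<Rightarrow> ('w \<Rightarrow> real) \<Rightarrow> 'w \<Rightarrow> real) \<Rightarrow> ('w \<Rightarrow> real) \<Rightarrow> real" where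
  "energy_norm M \<Gamma> u = sqrt ((\<integral>w. (u w)\<^sup>2 \<partial>M) + energy_form M \<Gamma> u u)"

locale error_structure = prob_space M for M :: "'w measure" +
  fixes \<D> :: "('w \<Rightarrow> real) set"
    and \<Gamma> :: "('w \<Rightarrow> real) \<Rightarrow> ('w \<Rightarrow> real) \<Rightarrow> 'w \<Rightarrow> real"
  assumes dom_L2: "\<D> \<subseteq> L2_space M"
    and dom_AE: "u \<in> \<D> \<Longrightarrow> v \<in> borel_measurable M \<Longrightarrow> AE w in M. u w = v w \<Longrightarrow> v \<in> \<D>"
    and dom_zero: "(\<lambda>_. 0) \<in> \<D>"
    and dom_add: "u \<in> \<D> \<Longrightarrow> v \<in> \<D> \<Longrightarrow> (\<lambda>w. u w + v w) \<in> \<D>"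
    and dom_scale: "u \<in> \<D> \<Longrightarrow> (\<lambda>w. c * u w) \<in> \<D>"
    and dom_dense: "f \<in> L2_space M \<Longrightarrow> \<exists>u. (\<forall>n. u n \<in> \<D>) \<and> L2_tendsto M u f"
    and gamma_integrable: "u \<in> \<D> \<Longrightarrow> v \<in> \<D> \<Longrightarrow> integrable M (\<Gamma> u v)"
    and gamma_AE: "u \<in> \<D> \<Longrightarrow> u' \<in> \<D> \<Longrightarrow> v \<in> \<D> \<Longrightarrow> v' \<in> \<D> \<Longrightarrow>
      AE w in M. u w = u' w \<Longrightarrow> AE w in M. v w = v' w \<Longrightarrow> AE w in M. \<Gamma> u v w = \<Gamma> u' v' w"
    and gamma_sym: "u \<in> \<D> \<Longrightarrow> v \<in> \<D> \<Longrightarrow> AE w in M. \<Gamma> u v w = \<Gamma> v u w"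
    and gamma_add: "u \<in> \<D> \<Longrightarrow> u' \<in> \<D> \<Longrightarrow> v \<in> \<D> \<Longrightarrow>
      AE w in M. \<Gamma> (\<lambda>w. u w + u' w) v w = \<Gamma> u v w + \<Gamma> u' v w"
    and gamma_scale: "u \<in> \<D> \<Longrightarrow> v \<in> \<D> \<Longrightarrow> AE w in M. \<Gamma> (\<lambda>w. c * u w) v w = c * \<Gamma> u v w"
    and gamma_pos: "u \<in> \<D> \<Longrightarrow> AE w in M. 0 \<le> \<Gamma> u u w"
    and calculus_dom: "(\<And>i. i < k \<Longrightarrow> U i \<in> \<D>) \<Longrightarrow> C1_Lipschitz_coords k F \<Longrightarrow>
      (\<lambda>w. F (\<lambda>i. U i w)) \<in> \<D>"
    and calculus_gamma:
      "(\<And>i. i < k \<Longrightarrow> U i \<in> \<D>) \<Longrightarrow> (\<And>j. j < n \<Longrightarrow> V j \<in> \<D>) \<Longrightarrow>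
       C1_Lipschitz_coords k F \<Longrightarrow> C1_Lipschitz_coords n G \<Longrightarrow>
       AE w in M. \<Gamma> (\<lambda>w. F (\<lambda>i. U i w)) (\<lambda>w. G (\<lambda>j. V j w)) w =
         (\<Sum>i<k. \<Sum>j<n. partial_deriv F i (\<lambda>i. U i w) * partial_deriv G j (\<lambda>j. V j w)
            * \<Gamma> (U i) (V j) w)"
    and closed: "(\<And>n. s n \<in> \<D>) \<Longrightarrow>
      (\<And>e. e > 0 \<Longrightarrow> \<exists>N. \<forall>m\<ge>N. \<forall>n\<ge>N. energy_norm M \<Gamma> (\<lambda>w. s m w - s n w) < e) \<Longrightarrow>
      \<exists>v\<in>\<D>. (\<lambda>n. energy_norm M \<Gamma> (\<lambda>w. s n w - v w)) \<longlonglongrightarrow> 0"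

definition D_gradient ::
    "'w measure \<Rightarrow> ('w \<Rightarrow> real) set \<Rightarrow> (('w \<Rightarrow> real) \<Rightarrow> ('w \<Rightarrow> real) \<Rightarrow> 'w \<Rightarrow> real) \<Rightarrow>
     (('w \<Rightarrow> real) \<Rightarrow> 'w \<Rightarrow> 'h::{real_inner, banach, second_countable_topology}) \<Rightarrow> bool" where
  "D_gradient M \<D> \<Gamma> D \<longleftrightarrow>
     (\<forall>u\<in>\<D>. D u \<in> L2_space M) \<and>
     (\<forall>u\<in>\<D>. \<forall>v\<in>\<D>. (AE w in M. u w = v w) \<longrightarrow> (AE w in M. D u w = D v w)) \<and>
     (\<forall>u\<in>\<D>. \<forall>v\<in>\<D>. AE w in M. D (\<lambda>w. u w + v w) w = D u w + D v w) \<and>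
     (\<forall>u\<in>\<D>. \<forall>c. AE w in M. D (\<lambda>w. c * u w) w = c *\<^sub>R D u w) \<and>
     (\<forall>u\<in>\<D>. AE w in M. (norm (D u w))\<^sup>2 = \<Gamma> u u w)"

definition gradient :: "(real^'d \<Rightarrow> real) \<Rightarrow> real^'d \<Rightarrow> real^'d" where
  "gradient F x = (\<chi> i. frechet_derivative F (at x) (axis i 1))"

definition C1_Lipschitz :: "(real^'d \<Rightarrow> real) \<Rightarrow> bool" where
  "C1_Lipschitz F \<longleftrightarrow> (\<exists>C. C-lipschitz_on UNIV F) \<and>
     (\<forall>x. F differentiable at x) \<and> continuous_on UNIV (gradient F)"

definition image_domain ::
    "'w measure \<Rightarrow> ('w \<Rightarrow> real) set \<Rightarrow> (('w \<Rightarrow> real) \<Rightarrow> ('w \<Rightarrow> real) \<Rightarrow> 'w \<Rightarrow> real) \<Rightarrow>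
     ('w \<Rightarrow> real^'d) \<Rightarrow> (real^'d \<Rightarrow> real) set" where
  "image_domain M \<D> \<Gamma> X = {u \<in> borel_measurable borel. u \<circ> X \<in> \<D> \<and>
     (\<forall>e>0. \<exists>g. C1_Lipschitz g \<and> energy_norm M \<Gamma> (\<lambda>w. u (X w) - g (X w)) < e)}"

text \<open>A version of $x \mapsto E[Y \mid X = x]$: a Borel $g$ with $g(X) = E[Y \mid \sigma(X)]$.\<close>

definition cond_exp_given ::
    "'w measure \<Rightarrow> ('w \<Rightarrow> real^'d) \<Rightarrow> ('w \<Rightarrow> real) \<Rightarrow> real^'d \<Rightarrow> real" where
  "cond_exp_given M X Y = (SOME g. g \<in> borel_measurable borel \<and>
     (AE w in M. g (X w) = real_cond_exp M (vimage_algebra (space M) X borel) Y w))"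

definition image_gamma ::
    "'w measure \<Rightarrow> (('w \<Rightarrow> real) \<Rightarrow> ('w \<Rightarrow> real) \<Rightarrow> 'w \<Rightarrow> real) \<Rightarrow> ('w \<Rightarrow> real^'d) \<Rightarrow>
     (real^'d \<Rightarrow> real) \<Rightarrow> real^'d \<Rightarrow> real" where
  "image_gamma M \<Gamma> X u = cond_exp_given M X (\<Gamma> (u \<circ> X) (u \<circ> X))"

definition image_gamma_bilin ::
    "'w measure \<Rightarrow> (('w \<Rightarrow> real) \<Rightarrow> ('w \<Rightarrow> real) \<Rightarrow> 'w \<Rightarrow> real) \<Rightarrow> ('w \<Rightarrow> real^'d) \<Rightarrow>
     (real^'d \<Rightarrow> real) \<Rightarrow> (real^'d \<Rightarrow> real) \<Rightarrow> real^'d \<Rightarrow> real" where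
  "image_gamma_bilin M \<Gamma> X u v x =
     (image_gamma M \<Gamma> X (\<lambda>x. u x + v x) x - image_gamma M \<Gamma> X (\<lambda>x. u x - v x) x) / 4"

text \<open>
  Where the measure on the index space is called \<open>E\<close> rather than \<open>\<mu>\<close>, only its \<open>space\<close> and
  \<open>sets\<close> are used. The Gaussian law with variance 0 is the point mass at 0.
\<close>

definition centered_gaussian :: "'o measure \<Rightarrow> ('o \<Rightarrow> real) \<Rightarrow> real \<Rightarrow> bool" where
  "centered_gaussian P Y v \<longleftrightarrow> 0 \<le> v \<and> Y \<in> borel_measurable P \<and>
     (if v = 0 then (AE \<omega> in P. Y \<omega> = 0)
      else distributed P lborel Y (\<lambda>x. ennreal (normal_density 0 (sqrt v) x)))"

definition sigma_additive_L2 ::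
    "'o measure \<Rightarrow> 'e measure \<Rightarrow> ('e set \<Rightarrow> 'o \<Rightarrow> 'b::real_normed_vector) \<Rightarrow> bool" where
  "sigma_additive_L2 P E N \<longleftrightarrow>
     (\<forall>A :: nat \<Rightarrow> 'e set. range A \<subseteq> sets E \<longrightarrow> disjoint_family A \<longrightarrow>
        L2_tendsto P (\<lambda>n \<omega>. \<Sum>i<n. N (A i) \<omega>) (N (\<Union>i. A i)))"

definition indep_on_disjoint ::
    "'o measure \<Rightarrow> 'e measure \<Rightarrow> ('e set \<Rightarrow> 'o \<Rightarrow> 'b::real_normed_vector) \<Rightarrow> bool" where
  "indep_on_disjoint P E N \<longleftrightarrow>
     (\<forall>(k::nat) A. A ` {..<k} \<subseteq> sets E \<longrightarrow> disjoint_family_on A {..<k} \<longrightarrow>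
        prob_space.indep_vars P (\<lambda>_. borel) (\<lambda>i. N (A i)) {..<k})"

definition white_noise :: "'o measure \<Rightarrow> 'e measure \<Rightarrow> ('e set \<Rightarrow> 'o \<Rightarrow> real) \<Rightarrow> bool" where
  "white_noise P \<mu> \<eta> \<longleftrightarrow> prob_space P \<and> finite_measure \<mu> \<and>
     (\<forall>A\<in>sets \<mu>. \<eta> A \<in> L2_space P \<and> centered_gaussian P (\<eta> A) (measure \<mu> A)) \<and>
     sigma_additive_L2 P \<mu> \<eta> \<and> indep_on_disjoint P \<mu> \<eta>"

text \<open>
  On disjoint sets \<open>A\<^sub>1, \<dots>, A\<^sub>k\<close> the \<open>H\<close>-valued variables \<open>\<nu> A\<^sub>i\<close> are independent, that is, the
  variables \<open>\<nu> A\<^sub>i \<bullet> h\<^sub>i\<close> are independent for all \<open>h\<^sub>1, \<dots>, h\<^sub>k\<close>. Asking this for a single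
  \<open>h = h\<^sub>1 = \<dots> = h\<^sub>k\<close> does not suffice: it leaves room for covariances between \<open>\<nu> A \<bullet> h\<close> and
  \<open>\<nu> B \<bullet> h'\<close> that are antisymmetric in \<open>(h, h')\<close>, and then \<open>(\<psi>, \<nu>)\<close> need not have associated
  measure \<open>\<parallel>\<psi>\<parallel>\<^sup>2 \<mu>\<close>. Since the mean of \<open>\<parallel>\<nu> A\<parallel>\<^sup>2\<close> is finite and equals \<open>\<mu> A\<close> times the dimension
  of \<open>H\<close>, such a \<open>\<nu>\<close> with \<open>\<mu> \<noteq> 0\<close> exists only for finite-dimensional \<open>H\<close>.
\<close>

definition hilbert_white_noise ::
    "'o measure \<Rightarrow> 'e measure \<Rightarrow>
     ('e set \<Rightarrow> 'o \<Rightarrow> 'h::{real_inner, banach, second_countable_topology}) \<Rightarrow> bool" where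
  "hilbert_white_noise P \<mu> \<nu> \<longleftrightarrow> prob_space P \<and> finite_measure \<mu> \<and>
     (\<forall>A\<in>sets \<mu>. \<nu> A \<in> L2_space P \<and>
        (\<forall>h. centered_gaussian P (\<lambda>\<omega>. \<nu> A \<omega> \<bullet> h) (measure \<mu> A * (norm h)\<^sup>2))) \<and>
     sigma_additive_L2 P \<mu> \<nu> \<and> indep_on_disjoint P \<mu> \<nu>"

definition vector_white_noise ::
    "'o measure \<Rightarrow> 'e measure \<Rightarrow> ('e set \<Rightarrow> real^'d^'d) \<Rightarrow> ('e set \<Rightarrow> 'o \<Rightarrow> real^'d) \<Rightarrow> bool" where
  "vector_white_noise P E Q \<Lambda> \<longleftrightarrow> prob_space P \<and>
     (\<forall>A\<in>sets E. \<Lambda> A \<in> L2_space P \<and>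
        (\<forall>c. centered_gaussian P (\<lambda>\<omega>. \<Lambda> A \<omega> \<bullet> c) (c \<bullet> (Q A *v c)))) \<and>
     sigma_additive_L2 P E \<Lambda> \<and> indep_on_disjoint P E \<Lambda>"

definition wn_matrix :: "'o measure \<Rightarrow> ('e set \<Rightarrow> 'o \<Rightarrow> real^'d) \<Rightarrow> 'e set \<Rightarrow> real^'d^'d" where
  "wn_matrix P \<Lambda> A = (\<chi> i j. \<integral>\<omega>. \<Lambda> A \<omega> $ i * \<Lambda> A \<omega> $ j \<partial>P)"

text \<open>The associated positive measure, $A \mapsto E_P[\eta(A)^2]$.\<close>

definition wn_measure :: "'o measure \<Rightarrow> 'e measure \<Rightarrow> ('e set \<Rightarrow> 'o \<Rightarrow> real) \<Rightarrow> 'e measure" where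
  "wn_measure P E \<eta> = measure_of (space E) (sets E) (\<lambda>A. ennreal (\<integral>\<omega>. (\<eta> A \<omega>)\<^sup>2 \<partial>P))"

definition wn_simple_integral ::
    "'e measure \<Rightarrow> ('e set \<Rightarrow> 'o \<Rightarrow> real) \<Rightarrow> ('e \<Rightarrow> real) \<Rightarrow> 'o \<Rightarrow> real" where
  "wn_simple_integral \<mu> \<eta> s \<omega> = (\<Sum>y\<in>s ` space \<mu>. y * \<eta> (s -` {y} \<inter> space \<mu>) \<omega>)"

text \<open>
  For a white noise measure with associated measure \<open>\<mu>\<close> and \<open>f\<close> in $L^2(\mu)$, the limit exists
  and is almost surely unique by the isometry property. The same applies to \<open>wn_pair\<close>.
\<close>

definition wn_integral ::
    "'e measure \<Rightarrow> 'o measure \<Rightarrow> ('e set \<Rightarrow> 'o \<Rightarrow> real) \<Rightarrow> ('e \<Rightarrow> real) \<Rightarrow> 'o \<Rightarrow> real" where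
  "wn_integral \<mu> P \<eta> f = (SOME Y. \<exists>s. (\<forall>n. simple_function \<mu> (s n)) \<and> L2_tendsto \<mu> s f \<and>
     L2_tendsto P (\<lambda>n. wn_simple_integral \<mu> \<eta> (s n)) Y)"

definition wn_times ::
    "'e measure \<Rightarrow> 'o measure \<Rightarrow> ('e \<Rightarrow> real) \<Rightarrow> ('e set \<Rightarrow> 'o \<Rightarrow> real) \<Rightarrow> 'e set \<Rightarrow> 'o \<Rightarrow> real" where
  "wn_times \<mu> P \<phi> \<eta> A = wn_integral \<mu> P \<eta> (\<lambda>x. indicator A x * \<phi> x)"

definition wn_inner :: "'h::real_inner \<Rightarrow> ('e set \<Rightarrow> 'o \<Rightarrow> 'h) \<Rightarrow> 'e set \<Rightarrow> 'o \<Rightarrow> real" where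
  "wn_inner h \<nu> A \<omega> = h \<bullet> \<nu> A \<omega>"

text \<open>
  \<open>wn_pair_decomp \<mu> P \<nu> k \<phi> h\<close> is \<open>(\<psi>, \<nu>)\<close> for the decomposable \<open>\<psi> = (\<Sum>i<k. \<phi> i *\<^sub>R h i)\<close>;
  the density is the associated measure \<open>\<parallel>h i\<parallel>\<^sup>2 \<mu>\<close> of \<open>wn_inner (h i) \<nu>\<close>.
\<close>

definition wn_pair_decomp ::
    "'e measure \<Rightarrow> 'o measure \<Rightarrow> ('e set \<Rightarrow> 'o \<Rightarrow> 'h::real_inner) \<Rightarrow>
     nat \<Rightarrow> (nat \<Rightarrow> 'e \<Rightarrow> real) \<Rightarrow> (nat \<Rightarrow> 'h) \<Rightarrow> 'e set \<Rightarrow> 'o \<Rightarrow> real" where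
  "wn_pair_decomp \<mu> P \<nu> k \<phi> h A \<omega> =
     (\<Sum>i<k. wn_times (density \<mu> (\<lambda>_. ennreal ((norm (h i))\<^sup>2))) P (\<phi> i) (wn_inner (h i) \<nu>) A \<omega>)"

definition wn_pair ::
    "'e measure \<Rightarrow> 'o measure \<Rightarrow> ('e \<Rightarrow> 'h::{real_inner, banach, second_countable_topology}) \<Rightarrow>
     ('e set \<Rightarrow> 'o \<Rightarrow> 'h) \<Rightarrow> 'e set \<Rightarrow> 'o \<Rightarrow> real" where
  "wn_pair \<mu> P \<psi> \<nu> A = (SOME Y. \<exists>k \<phi> h. (\<forall>n. \<forall>i<k n. \<phi> n i \<in> L2_space \<mu>) \<and>
     L2_tendsto \<mu> (\<lambda>n x. \<Sum>i<k n. \<phi> n i x *\<^sub>R h n i) \<psi> \<and>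
     L2_tendsto P (\<lambda>n. wn_pair_decomp \<mu> P \<nu> (k n) (\<phi> n) (h n) A) Y)"

definition wn_dot ::
    "'e measure \<Rightarrow> 'o measure \<Rightarrow> ('e \<Rightarrow> real^'d) \<Rightarrow> ('e set \<Rightarrow> 'o \<Rightarrow> real^'d) \<Rightarrow>
     'e set \<Rightarrow> 'o \<Rightarrow> real" where
  "wn_dot E P \<phi> \<Lambda> A \<omega> = (\<Sum>i\<in>UNIV.
     wn_times (wn_measure P E (\<lambda>B \<omega>. \<Lambda> B \<omega> $ i)) P (\<lambda>x. \<phi> x $ i) (\<lambda>B \<omega>. \<Lambda> B \<omega> $ i) A \<omega>)"

definition wn_image :: "'w measure \<Rightarrow> ('w \<Rightarrow> 'e) \<Rightarrow> ('w set \<Rightarrow> 'o \<Rightarrow> 'b) \<Rightarrow> 'e set \<Rightarrow> 'o \<Rightarrow> 'b" where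
  "wn_image M X N A = N (X -` A \<inter> space M)"

definition mv_gradient ::
    "'w measure \<Rightarrow> 'o measure \<Rightarrow>
     (('w \<Rightarrow> real) \<Rightarrow> 'w \<Rightarrow> 'h::{real_inner, banach, second_countable_topology}) \<Rightarrow>
     ('w set \<Rightarrow> 'o \<Rightarrow> 'h) \<Rightarrow> ('w \<Rightarrow> real) \<Rightarrow> 'w set \<Rightarrow> 'o \<Rightarrow> real" where
  "mv_gradient M P D \<nu> Y = wn_pair M P (D Y) \<nu>"

definition mv_gradient_vec ::
    "'w measure \<Rightarrow> 'o measure \<Rightarrow>
     (('w \<Rightarrow> real) \<Rightarrow> 'w \<Rightarrow> 'h::{real_inner, banach, second_countable_topology}) \<Rightarrow>
     ('w set \<Rightarrow> 'o \<Rightarrow> 'h) \<Rightarrow> ('w \<Rightarrow> real^'d) \<Rightarrow> 'w set \<Rightarrow> 'o \<Rightarrow> real^'d" where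
  "mv_gradient_vec M P D \<nu> Y A \<omega> = (\<chi> i. mv_gradient M P D \<nu> (\<lambda>w. Y w $ i) A \<omega>)"

definition image_gradient ::
    "'w measure \<Rightarrow> 'o measure \<Rightarrow>
     (('w \<Rightarrow> real) \<Rightarrow> 'w \<Rightarrow> 'h::{real_inner, banach, second_countable_topology}) \<Rightarrow>
     ('w set \<Rightarrow> 'o \<Rightarrow> 'h) \<Rightarrow> ('w \<Rightarrow> real^'d) \<Rightarrow> (real^'d \<Rightarrow> real) \<Rightarrow>
     (real^'d) set \<Rightarrow> 'o \<Rightarrow> real" where
  "image_gradient M P D \<nu> X F = wn_image M X (mv_gradient M P D \<nu> (F \<circ> X))"

definition image_gradient_vec ::
    "'w measure \<Rightarrow> 'o measure \<Rightarrow>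
     (('w \<Rightarrow> real) \<Rightarrow> 'w \<Rightarrow> 'h::{real_inner, banach, second_countable_topology}) \<Rightarrow>
     ('w set \<Rightarrow> 'o \<Rightarrow> 'h) \<Rightarrow> ('w \<Rightarrow> real^'d) \<Rightarrow> (real^'d \<Rightarrow> real^'k) \<Rightarrow>
     (real^'d) set \<Rightarrow> 'o \<Rightarrow> real^'k" where
  "image_gradient_vec M P D \<nu> X \<Phi> A \<omega> = (\<chi> i. image_gradient M P D \<nu> X (\<lambda>x. \<Phi> x $ i) A \<omega>)"

end

theory Submission
  imports Defs
begin

text \<open>
  The idea is to realise every noise in the statement by one linear isometry. An \<open>H\<close>-valued white
  noise \<open>\<nu>\<close> over \<open>(W, m)\<close> has a Wiener integral \<open>\<psi> \<mapsto> \<integral> \<langle>\<psi>, d\<nu>\<rangle>\<close>, called \<open>pairing\<close> below, from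
  \<open>L\<^sup>2(m; H)\<close> to the centered Gaussian variables in \<open>L\<^sup>2(P)\<close>. On a function with finitely many
  values \<open>h\<close> it is \<open>\<Sum> \<langle>h, \<nu>(\<psi> = h)\<rangle>\<close>. The summands are independent Gaussian variables with
  variances \<open>m(\<psi> = h) \<parallel>h\<parallel>\<^sup>2\<close>, so the sum is Gaussian with variance \<open>\<integral> \<parallel>\<psi>\<parallel>\<^sup>2 dm\<close>. Finite additivity
  of \<open>\<nu>\<close> makes the map linear, hence isometric, and it extends to \<open>L\<^sup>2(m; H)\<close> by completeness of
  \<open>L\<^sup>2(P)\<close>. Gaussianity survives the limit by Levy's uniqueness theorem for characteristic functions,
  and independence over disjoint sets survives because it is expressed by products of expectations of
  bounded continuous functions.

  The noise \<open>(\<psi>, \<nu>)\<close> is \<open>A \<mapsto> pairing (1\<^sub>A \<psi>)\<close> (\<open>wn_pair_eq_pairing\<close>), and its image by \<open>X\<close> is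
  \<open>A \<mapsto> pairing (1\<^sub>A(X) \<psi>)\<close>. A noise of this form is said to be represented by \<open>\<psi>\<close> and \<open>X\<close>. Its
  associated measure is the image by \<open>X\<close> of \<open>\<parallel>\<psi>\<parallel>\<^sup>2 m\<close> (\<open>wn_measure_represents\<close>), and integrating a
  function \<open>f\<close> against it gives \<open>pairing (f(X) \<psi>)\<close> (\<open>wn_integral_eq_pairing\<close>).

  Part a) follows: \<open>d\<^sub>GF\<close> is represented by \<open>D(F \<circ> X)\<close>, so its associated measure is the image by
  \<open>X\<close> of \<open>\<Gamma>[F \<circ> X] m\<close>. By the definition of conditional expectation this is the measure with density
  \<open>\<Gamma>\<^sub>X[F]\<close> with respect to the law of \<open>X\<close>. The matrix of \<open>d\<^sub>GI\<close> is obtained in the same way from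
  \<open>\<langle>DX\<^sub>i, DX\<^sub>j\<rangle> = \<Gamma>[X\<^sub>i, X\<^sub>j]\<close>.

  For part b), the functional calculus for \<open>\<Gamma>\<close> forces the chain rule
  \<open>D(F \<circ> X) = \<Sum>\<^sub>i \<partial>\<^sub>iF(X) DX\<^sub>i\<close> (\<open>D_gradient_chain_rule\<close>), since the difference of the two sides has
  norm 0. Applying the linear map \<open>pairing\<close> after multiplication by \<open>1\<^sub>A(X)\<close> turns the left side into
  \<open>d\<^sub>GF(A)\<close> and the \<open>i\<close>-th summand on the right into the integral of \<open>1\<^sub>A \<partial>\<^sub>iF\<close> against the \<open>i\<close>-th
  component of \<open>d\<^sub>GI\<close>.
\<close>

section \<open>Square integrable functions\<close>

lemma L2_spaceI:
  "f \<in> borel_measurable M \<Longrightarrow> integrable M (\<lambda>x. (norm (f x))\<^sup>2) \<Longrightarrow> f \<in> L2_space M"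
  by (simp add: L2_space_def)

lemma L2_space_measurable[measurable_dest]: "f \<in> L2_space M \<Longrightarrow> f \<in> borel_measurable M"
  by (simp add: L2_space_def)

lemma L2_space_integrable: "f \<in> L2_space M \<Longrightarrow> integrable M (\<lambda>x. (norm (f x))\<^sup>2)"
  by (simp add: L2_space_def)

lemma L2_space_bound:
  fixes f :: "'a \<Rightarrow> 'b::real_normed_vector" and g :: "'a \<Rightarrow> 'c::real_normed_vector"
  assumes "f \<in> L2_space M" "g \<in> borel_measurable M" "AE x in M. norm (g x) \<le> norm (f x)"
  shows "g \<in> L2_space M"
proof (rule L2_spaceI)
  show "integrable M (\<lambda>x. (norm (g x))\<^sup>2)"
    using assms(3)
    by (intro Bochner_Integration.integrable_bound[OF L2_space_integrable[OF assms(1)]])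
      (use assms(2) in \<open>auto intro: power_mono\<close>)
qed fact

lemma L2_space_cong_AE:
  assumes "f \<in> L2_space M" "g \<in> borel_measurable M" "AE x in M. f x = g x"
  shows "g \<in> L2_space M"
  using assms(3) by (intro L2_space_bound[OF assms(1,2)]) auto

lemma L2_space_zero: "(\<lambda>_. 0) \<in> L2_space M"
  by (auto intro!: L2_spaceI)

lemma L2_space_scaleR:
  fixes f :: "'a \<Rightarrow> 'b::{real_normed_vector, second_countable_topology}"
  assumes "f \<in> L2_space M"
  shows "(\<lambda>x. c *\<^sub>R f x) \<in> L2_space M"
  using assms by (auto simp: L2_space_def power_mult_distrib)

lemma norm_add_sq_le: "(norm (a + b))\<^sup>2 \<le> 2 * (norm a)\<^sup>2 + 2 * (norm (b::'b::real_normed_vector))\<^sup>2"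
proof -
  have "(norm (a + b))\<^sup>2 \<le> (norm a + norm b)\<^sup>2"
    by (intro power_mono norm_triangle_ineq) auto
  also have "\<dots> \<le> 2 * (norm a)\<^sup>2 + 2 * (norm b)\<^sup>2"
    using sum_squares_bound[of "norm a" "norm b"] by (simp add: power2_sum)
  finally show ?thesis .
qed

lemma L2_space_add:
  fixes f g :: "'a \<Rightarrow> 'b::{real_normed_vector, second_countable_topology}"
  assumes [measurable]: "f \<in> L2_space M" "g \<in> L2_space M"
  shows "(\<lambda>x. f x + g x) \<in> L2_space M"
proof (rule L2_spaceI)
  show "integrable M (\<lambda>x. (norm (f x + g x))\<^sup>2)"
    by (rule Bochner_Integration.integrable_bound
        [where f = "\<lambda>x. 2 * (norm (f x))\<^sup>2 + 2 * (norm (g x))\<^sup>2"])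
      (auto simp: norm_add_sq_le assms L2_space_integrable)
qed measurable

lemma L2_space_diff:
  fixes f g :: "'a \<Rightarrow> 'b::{real_normed_vector, second_countable_topology}"
  assumes "f \<in> L2_space M" "g \<in> L2_space M"
  shows "(\<lambda>x. f x - g x) \<in> L2_space M"
  using L2_space_add[OF assms(1) L2_space_scaleR[OF assms(2), of "-1"]] by simp

lemma L2_space_sum:
  fixes f :: "'i \<Rightarrow> 'a \<Rightarrow> 'b::{real_normed_vector, second_countable_topology}"
  assumes "\<And>i. i \<in> I \<Longrightarrow> f i \<in> L2_space M"
  shows "(\<lambda>x. \<Sum>i\<in>I. f i x) \<in> L2_space M"
  using assms by (induction I rule: infinite_finite_induct) (auto intro: L2_space_zero L2_space_add)

lemma L2_space_indicator:
  fixes f :: "'a \<Rightarrow> 'b::{real_normed_vector, second_countable_topology}"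
  assumes [measurable]: "f \<in> L2_space M" "A \<in> sets M"
  shows "(\<lambda>x. indicator A x *\<^sub>R f x) \<in> L2_space M"
  by (rule L2_space_bound[OF assms(1)]) (auto simp: indicator_def)

lemma L2_space_inner:
  fixes f g :: "'a \<Rightarrow> 'b::{real_inner, second_countable_topology}"
  assumes [measurable]: "f \<in> L2_space M" "g \<in> L2_space M"
  shows "integrable M (\<lambda>x. f x \<bullet> g x)"
proof (rule Bochner_Integration.integrable_bound[where f = "\<lambda>x. (norm (f x))\<^sup>2 + (norm (g x))\<^sup>2"])
  have "\<bar>f x \<bullet> g x\<bar> \<le> (norm (f x))\<^sup>2 + (norm (g x))\<^sup>2" for x
  proof -
    have "\<bar>f x \<bullet> g x\<bar> \<le> norm (f x) * norm (g x)" by (rule Cauchy_Schwarz_ineq2)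
    moreover have "0 \<le> norm (f x) * norm (g x)" by simp
    ultimately show ?thesis using sum_squares_bound[of "norm (f x)" "norm (g x)"] by linarith
  qed
  then show "AE x in M. norm (f x \<bullet> g x) \<le> norm ((norm (f x))\<^sup>2 + (norm (g x))\<^sup>2)"
    by auto
qed (auto simp: assms L2_space_integrable)

lemma (in finite_measure) L2_space_const:
  "(\<lambda>_. c :: 'b::{real_normed_vector, second_countable_topology}) \<in> L2_space M"
  by (rule L2_spaceI) auto

lemma (in finite_measure) simple_function_L2:
  fixes s :: "'a \<Rightarrow> 'b::{real_normed_vector, second_countable_topology}"
  assumes "simple_function M s"
  shows "s \<in> L2_space M"
proof (rule L2_spaceI)
  show meas[measurable]: "s \<in> borel_measurable M"
    by (rule borel_measurable_simple_function[OF assms])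
  have fin: "finite (s ` space M)" using assms by (rule simple_functionD)
  show "integrable M (\<lambda>x. (norm (s x))\<^sup>2)"
    by (rule integrable_const_bound[where B = "Max ((\<lambda>y. (norm y)\<^sup>2) ` s ` space M)"])
      (auto intro!: AE_I2 Max_ge simp: fin)
qed

lemma L2_tendstoD:
  assumes "L2_tendsto M f g"
  shows "f n \<in> L2_space M" "g \<in> L2_space M"
    "(\<lambda>n. \<integral>x. (norm (f n x - g x))\<^sup>2 \<partial>M) \<longlonglongrightarrow> 0"
  using assms by (auto simp: L2_tendsto_def)

lemma L2_tendsto_cong_AE:
  fixes f :: "nat \<Rightarrow> 'a \<Rightarrow> 'b::{real_normed_vector, second_countable_topology}"
  assumes "L2_tendsto M f g" "\<And>n. f' n \<in> borel_measurable M" "g' \<in> borel_measurable M"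
    "\<And>n. AE x in M. f n x = f' n x" "AE x in M. g x = g' x"
  shows "L2_tendsto M f' g'"
proof -
  note [measurable] = L2_tendstoD(1,2)[OF assms(1)] assms(2,3)
  have "(\<integral>x. (norm (f n x - g x))\<^sup>2 \<partial>M) = (\<integral>x. (norm (f' n x - g' x))\<^sup>2 \<partial>M)" for n
    using assms(4)[of n] assms(5) by (intro integral_cong_AE) auto
  moreover have "f' n \<in> L2_space M" for n
    by (rule L2_space_cong_AE[OF L2_tendstoD(1)[OF assms(1)] assms(2,4)])
  moreover have "g' \<in> L2_space M"
    by (rule L2_space_cong_AE[OF L2_tendstoD(2)[OF assms(1)] assms(3,5)])
  ultimately show ?thesis
    using L2_tendstoD(3)[OF assms(1)] by (simp add: L2_tendsto_def)
qed

lemma L2_tendsto_bound: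
  fixes f :: "nat \<Rightarrow> 'a \<Rightarrow> 'b::{real_normed_vector, second_countable_topology}"
  assumes "\<And>n. f n \<in> L2_space M" "g \<in> L2_space M" "b \<longlonglongrightarrow> 0"
    "\<And>n. (\<integral>x. (norm (f n x - g x))\<^sup>2 \<partial>M) \<le> b n"
  shows "L2_tendsto M f g"
  unfolding L2_tendsto_def
  using assms by (auto intro!: real_tendsto_sandwich[OF _ _ tendsto_const assms(3)])

lemma L2_tendsto_const: "g \<in> L2_space M \<Longrightarrow> L2_tendsto M (\<lambda>_. g) g"
  by (simp add: L2_tendsto_def)

lemma L2_tendsto_scaleR:
  fixes f :: "nat \<Rightarrow> 'a \<Rightarrow> 'b::{real_normed_vector, second_countable_topology}"
  assumes "L2_tendsto M f g"
  shows "L2_tendsto M (\<lambda>n x. c *\<^sub>R f n x) (\<lambda>x. c *\<^sub>R g x)"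
proof -
  have "(\<integral>x. (norm (c *\<^sub>R f n x - c *\<^sub>R g x))\<^sup>2 \<partial>M) = c\<^sup>2 * (\<integral>x. (norm (f n x - g x))\<^sup>2 \<partial>M)" for n
    by (simp flip: scaleR_diff_right add: power_mult_distrib)
  then show ?thesis
    using L2_tendstoD[OF assms] unfolding L2_tendsto_def
    by (auto intro!: L2_space_scaleR tendsto_mult_right_zero)
qed

lemma L2_tendsto_add:
  fixes f f' :: "nat \<Rightarrow> 'a \<Rightarrow> 'b::{real_normed_vector, second_countable_topology}"
  assumes "L2_tendsto M f g" "L2_tendsto M f' g'"
  shows "L2_tendsto M (\<lambda>n x. f n x + f' n x) (\<lambda>x. g x + g' x)"
proof (rule L2_tendsto_bound)
  note L2 = L2_tendstoD(1,2)[OF assms(1)] L2_tendstoD(1,2)[OF assms(2)]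
  note [measurable] = L2
  show "(\<lambda>x. f n x + f' n x) \<in> L2_space M" "(\<lambda>x. g x + g' x) \<in> L2_space M" for n
    by (intro L2_space_add L2)+
  show "(\<lambda>n. 2 * (\<integral>x. (norm (f n x - g x))\<^sup>2 \<partial>M) + 2 * (\<integral>x. (norm (f' n x - g' x))\<^sup>2 \<partial>M)) \<longlonglongrightarrow> 0"
    using tendsto_add[OF tendsto_mult_right_zero tendsto_mult_right_zero,
        OF L2_tendstoD(3)[OF assms(1)] L2_tendstoD(3)[OF assms(2)]] by simp
  show "(\<integral>x. (norm (f n x + f' n x - (g x + g' x)))\<^sup>2 \<partial>M)
    \<le> 2 * (\<integral>x. (norm (f n x - g x))\<^sup>2 \<partial>M) + 2 * (\<integral>x. (norm (f' n x - g' x))\<^sup>2 \<partial>M)" for n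
  proof -
    have i: "integrable M (\<lambda>x. (norm (f n x - g x))\<^sup>2)" "integrable M (\<lambda>x. (norm (f' n x - g' x))\<^sup>2)"
      by (intro L2_space_integrable L2_space_diff L2)+
    have "(\<integral>x. (norm (f n x + f' n x - (g x + g' x)))\<^sup>2 \<partial>M)
      \<le> (\<integral>x. 2 * (norm (f n x - g x))\<^sup>2 + 2 * (norm (f' n x - g' x))\<^sup>2 \<partial>M)"
    proof (rule integral_mono)
      show "integrable M (\<lambda>x. (norm (f n x + f' n x - (g x + g' x)))\<^sup>2)"
        by (intro L2_space_integrable L2_space_diff L2_space_add L2)
      show "(norm (f n x + f' n x - (g x + g' x)))\<^sup>2
        \<le> 2 * (norm (f n x - g x))\<^sup>2 + 2 * (norm (f' n x - g' x))\<^sup>2" for x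
        using norm_add_sq_le[of "f n x - g x" "f' n x - g' x"] by (simp add: algebra_simps)
    qed (use i in auto)
    then show ?thesis using i by simp
  qed
qed

lemma L2_tendsto_indicator:
  fixes f :: "nat \<Rightarrow> 'a \<Rightarrow> 'b::{real_normed_vector, second_countable_topology}"
  assumes "L2_tendsto M f g" and A: "A \<in> sets M"
  shows "L2_tendsto M (\<lambda>n w. indicator A w *\<^sub>R f n w) (\<lambda>w. indicator A w *\<^sub>R g w)"
proof (rule L2_tendsto_bound[OF _ _ L2_tendstoD(3)[OF assms(1)]])
  note L = L2_tendstoD(1,2)[OF assms(1)]
  show "(\<lambda>w. indicator A w *\<^sub>R f n w) \<in> L2_space M" "(\<lambda>w. indicator A w *\<^sub>R g w) \<in> L2_space M" for n
    by (intro L2_space_indicator L A)+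
  show "(\<integral>w. (norm (indicator A w *\<^sub>R f n w - indicator A w *\<^sub>R g w))\<^sup>2 \<partial>M)
    \<le> (\<integral>w. (norm (f n w - g w))\<^sup>2 \<partial>M)" for n
    by (intro integral_mono L2_space_integrable L2_space_diff L2_space_indicator L A)
      (auto simp: indicator_def)
qed

lemma L2_tendsto_diff:
  fixes f f' :: "nat \<Rightarrow> 'a \<Rightarrow> 'b::{real_normed_vector, second_countable_topology}"
  assumes "L2_tendsto M f g" "L2_tendsto M f' g'"
  shows "L2_tendsto M (\<lambda>n x. f n x - f' n x) (\<lambda>x. g x - g' x)"
  using L2_tendsto_add[OF assms(1) L2_tendsto_scaleR[OF assms(2), of "-1"]] by simp

lemma L2_tendsto_unique:
  fixes f :: "nat \<Rightarrow> 'a \<Rightarrow> 'b::{real_normed_vector, second_countable_topology}"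
  assumes "L2_tendsto M f g" "L2_tendsto M f g'"
  shows "AE x in M. g x = g' x"
proof -
  note L = L2_tendsto_diff[OF assms]
  have g: "(\<lambda>x. g x - g' x) \<in> L2_space M" using L2_tendstoD(2)[OF L] .
  have "(\<integral>x. (norm (g x - g' x))\<^sup>2 \<partial>M) = 0"
    using L2_tendstoD(3)[OF L] by (simp add: LIMSEQ_const_iff norm_minus_commute)
  then have "AE x in M. (norm (g x - g' x))\<^sup>2 = 0"
    by (subst integral_nonneg_eq_0_iff_AE[symmetric]) (auto intro: L2_space_integrable[OF g])
  then show ?thesis by auto
qed

lemma L2_tendsto_subseq:
  assumes "L2_tendsto M f g" "strict_mono (r :: nat \<Rightarrow> nat)"
  shows "L2_tendsto M (\<lambda>n. f (r n)) g"
  using L2_tendstoD[OF assms(1)] LIMSEQ_subseq_LIMSEQ[OF L2_tendstoD(3)[OF assms(1)] assms(2)]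
  by (simp add: L2_tendsto_def o_def)

lemma L2_tendsto_AE_subseq:
  fixes f :: "nat \<Rightarrow> 'a \<Rightarrow> 'b::{real_normed_vector, second_countable_topology}"
  assumes "L2_tendsto M f g"
  obtains r :: "nat \<Rightarrow> nat" where "strict_mono r" "AE x in M. (\<lambda>n. f (r n) x) \<longlonglongrightarrow> g x"
proof -
  have i: "\<And>n. integrable M (\<lambda>x. (norm (f n x - g x))\<^sup>2)"
    by (intro L2_space_integrable L2_space_diff L2_tendstoD[OF assms])
  have "(\<lambda>n. \<integral>x. norm ((norm (f n x - g x))\<^sup>2) \<partial>M) \<longlonglongrightarrow> 0"
    using L2_tendstoD(3)[OF assms] by simp
  from tendsto_L1_AE_subseq[where u = "\<lambda>n x. (norm (f n x - g x))\<^sup>2", OF i this]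
  obtain r :: "nat \<Rightarrow> nat" where r: "strict_mono r"
    "AE x in M. (\<lambda>n. (norm (f (r n) x - g x))\<^sup>2) \<longlonglongrightarrow> 0"
    by blast
  have "AE x in M. (\<lambda>n. f (r n) x) \<longlonglongrightarrow> g x"
    using r(2)
  proof eventually_elim
    case (elim x)
    from tendsto_real_sqrt[OF elim] show ?case
      by (simp add: tendsto_norm_zero_iff LIM_zero_iff)
  qed
  with r(1) show thesis by (rule that)
qed

lemma L2_tendsto_dominated:
  fixes f :: "nat \<Rightarrow> 'a \<Rightarrow> 'b::{real_normed_vector, second_countable_topology}"
    and w :: "'a \<Rightarrow> 'c::real_normed_vector"
  assumes [measurable]: "\<And>n. f n \<in> borel_measurable M" "g \<in> borel_measurable M"
    and w: "w \<in> L2_space M" "\<And>n x. x \<in> space M \<Longrightarrow> norm (f n x) \<le> C * norm (w x)"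
    and lim: "\<And>x. x \<in> space M \<Longrightarrow> (\<lambda>n. f n x) \<longlonglongrightarrow> g x"
  shows "L2_tendsto M f g"
proof -
  have wm[measurable]: "w \<in> borel_measurable M" using w(1) by (rule L2_space_measurable)
  have wi: "integrable M (\<lambda>x. (C * norm (w x))\<^sup>2)"
    using L2_space_integrable[OF w(1)] by (simp add: power_mult_distrib)
  have W: "(\<lambda>x. C * norm (w x)) \<in> L2_space M"
    using wi by (intro L2_spaceI) (auto simp: power_mult_distrib)
  have gb: "norm (g x) \<le> C * norm (w x)" if "x \<in> space M" for x
    by (intro LIMSEQ_le_const2[OF tendsto_norm[OF lim[OF that]]]) (auto simp: w(2)[OF that])
  have f: "f n \<in> L2_space M" for n
    by (rule L2_space_bound[OF W]) (auto intro!: AE_I2 order_trans[OF w(2)])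
  have g: "g \<in> L2_space M"
    by (rule L2_space_bound[OF W]) (auto intro!: AE_I2 order_trans[OF gb])
  have "(\<lambda>n. \<integral>x. (norm (f n x - g x))\<^sup>2 \<partial>M) \<longlonglongrightarrow> (\<integral>x. 0 \<partial>M)"
  proof (rule integral_dominated_convergence[where w = "\<lambda>x. 4 * (C * norm (w x))\<^sup>2"])
    show "AE x in M. (\<lambda>n. (norm (f n x - g x))\<^sup>2) \<longlonglongrightarrow> 0"
    proof (rule AE_I2)
      fix x assume "x \<in> space M"
      from lim[OF this] have "(\<lambda>n. norm (f n x - g x)) \<longlonglongrightarrow> 0"
        by (simp add: LIM_zero tendsto_norm_zero)
      from tendsto_power[OF this, of 2] show "(\<lambda>n. (norm (f n x - g x))\<^sup>2) \<longlonglongrightarrow> 0" by simp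
    qed
    show "AE x in M. norm ((norm (f n x - g x))\<^sup>2) \<le> 4 * (C * norm (w x))\<^sup>2" for n
    proof (rule AE_I2)
      fix x assume x: "x \<in> space M"
      have "norm (f n x - g x) \<le> 2 * (C * norm (w x))"
        using norm_triangle_ineq4[of "f n x" "g x"] w(2)[OF x, of n] gb[OF x] by simp
      from power_mono[OF this, of 2]
      show "norm ((norm (f n x - g x))\<^sup>2) \<le> 4 * (C * norm (w x))\<^sup>2" by (simp add: power_mult_distrib)
    qed
  qed (use wi in auto)
  then show ?thesis using f g by (simp add: L2_tendsto_def)
qed

text \<open>
  The approximating functions can be chosen to satisfy \<open>\<parallel>s n x\<parallel> \<le> 2 \<parallel>f x\<parallel>\<close> pointwise, so pointwise
  convergence improves to convergence in mean square.
\<close>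
lemma L2_space_simple_approx:
  fixes f :: "'a \<Rightarrow> 'b::{real_normed_vector, second_countable_topology}"
  assumes "f \<in> L2_space M"
  obtains s where "\<And>n. simple_function M (s n)" "L2_tendsto M s f"
proof -
  have m[measurable]: "f \<in> borel_measurable M" using assms by (rule L2_space_measurable)
  from borel_measurable_implies_sequence_metric[OF this, of 0]
  obtain s where "\<forall>i. simple_function M (s i)" "\<forall>x\<in>space M. (\<lambda>i. s i x) \<longlonglongrightarrow> f x"
    "\<forall>i. \<forall>x\<in>space M. dist (s i x) 0 \<le> 2 * dist (f x) 0"
    by blast
  then have s: "\<And>i. simple_function M (s i)" "\<And>x. x \<in> space M \<Longrightarrow> (\<lambda>i. s i x) \<longlonglongrightarrow> f x"
    "\<And>i x. x \<in> space M \<Longrightarrow> norm (s i x) \<le> 2 * norm (f x)"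
    by simp_all
  have "L2_tendsto M s f"
    by (rule L2_tendsto_dominated[OF _ m assms s(3) s(2)])
      (auto intro: borel_measurable_simple_function s(1))
  with s(1) show thesis by (rule that)
qed

lemma L2_tendsto_integral_norm_sq:
  fixes f :: "nat \<Rightarrow> 'a \<Rightarrow> 'b::{real_normed_vector, second_countable_topology}"
  assumes "L2_tendsto M f g"
  shows "(\<lambda>n. \<integral>x. (norm (f n x))\<^sup>2 \<partial>M) \<longlonglongrightarrow> (\<integral>x. (norm (g x))\<^sup>2 \<partial>M)"
proof (rule LIMSEQ_I)
  fix e :: real assume e: "0 < e"
  define G where "G = (\<integral>x. (norm (g x))\<^sup>2 \<partial>M)"
  define d where "d n = (\<integral>x. (norm (f n x - g x))\<^sup>2 \<partial>M)" for n
  have G0: "0 \<le> G" by (simp add: G_def)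
  define a where "a = e / (2 * (G + 1))"
  have a: "0 < a" using e G0 by (simp add: a_def)
  have fg: "f n \<in> L2_space M" "g \<in> L2_space M" for n using L2_tendstoD[OF assms] by auto
  note int = L2_space_integrable[OF fg(1)] L2_space_integrable[OF fg(2)]
    L2_space_integrable[OF L2_space_diff[OF fg]]
  \<comment> \<open>With \<open>u = \<parallel>y - z\<parallel>\<close> and \<open>v = \<parallel>z\<parallel>\<close> the difference of the squares is at most \<open>u\<^sup>2 + 2uv\<close>, and
    \<open>2uv \<le> u\<^sup>2 / a + a v\<^sup>2\<close>; a small \<open>a\<close> makes the part that does not tend to 0 negligible.\<close>
  have pt: "\<bar>(norm y)\<^sup>2 - (norm z)\<^sup>2\<bar> \<le> (1 + 1 / a) * (norm (y - z))\<^sup>2 + a * (norm z)\<^sup>2" for y z :: 'b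
  proof -
    let ?u = "norm (y - z)" let ?v = "norm z"
    have "\<bar>norm y - ?v\<bar> \<le> ?u" by (rule norm_triangle_ineq3)
    moreover have "norm y + ?v \<le> ?u + 2 * ?v" using norm_triangle_ineq[of "y - z" z] by simp
    moreover have "\<bar>(norm y)\<^sup>2 - ?v\<^sup>2\<bar> = \<bar>norm y - ?v\<bar> * (norm y + ?v)"
      by (simp add: power2_eq_square square_diff_square_factored abs_mult)
    ultimately have "\<bar>(norm y)\<^sup>2 - ?v\<^sup>2\<bar> \<le> ?u * (?u + 2 * ?v)"
      by (simp add: mult_mono)
    also have "\<dots> \<le> (1 + 1 / a) * ?u\<^sup>2 + a * ?v\<^sup>2"
    proof -
      have "0 \<le> (?u - a * ?v)\<^sup>2 / a" using a by simp
      also have "\<dots> = (1 / a) * ?u\<^sup>2 - 2 * ?u * ?v + a * ?v\<^sup>2"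
        using a by (simp add: power2_eq_square field_simps)
      finally show ?thesis by (simp add: algebra_simps power2_eq_square)
    qed
    finally show ?thesis .
  qed
  have bd: "\<bar>(\<integral>x. (norm (f n x))\<^sup>2 \<partial>M) - G\<bar> \<le> (1 + 1 / a) * d n + a * G" for n
  proof -
    have "\<bar>(\<integral>x. (norm (f n x))\<^sup>2 \<partial>M) - G\<bar> = \<bar>\<integral>x. (norm (f n x))\<^sup>2 - (norm (g x))\<^sup>2 \<partial>M\<bar>"
      using int by (simp add: G_def)
    also have "\<dots> \<le> (\<integral>x. \<bar>(norm (f n x))\<^sup>2 - (norm (g x))\<^sup>2\<bar> \<partial>M)"
      by (rule integral_abs_bound)
    also have "\<dots> \<le> (\<integral>x. (1 + 1 / a) * (norm (f n x - g x))\<^sup>2 + a * (norm (g x))\<^sup>2 \<partial>M)"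
      using int pt by (intro integral_mono) auto
    also have "\<dots> = (1 + 1 / a) * d n + a * G"
      using int by (simp add: d_def G_def)
    finally show ?thesis .
  qed
  have aG: "a * G < e / 2"
  proof -
    have "a * G < a * (G + 1)" using a by simp
    also have "\<dots> = e / 2" using G0 by (simp add: a_def field_simps)
    finally show ?thesis .
  qed
  have "(\<lambda>n. (1 + 1 / a) * d n) \<longlonglongrightarrow> 0"
    using L2_tendstoD(3)[OF assms] by (auto simp: d_def intro: tendsto_mult_right_zero)
  from LIMSEQ_D[OF this, of "e/2"] e obtain N where "\<And>n. n \<ge> N \<Longrightarrow> \<bar>(1 + 1 / a) * d n\<bar> < e / 2"
    by auto
  then show "\<exists>N. \<forall>n\<ge>N. norm ((\<integral>x. (norm (f n x))\<^sup>2 \<partial>M) - (\<integral>x. (norm (g x))\<^sup>2 \<partial>M)) < e"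
    using bd aG unfolding G_def[symmetric] real_norm_def
    by (intro exI[of _ N]) (smt (verit) field_sum_of_halves)
qed

text \<open>
  A subsequence \<open>g\<close> with \<open>\<integral> \<parallel>g (n + 1) - g n\<parallel>\<^sup>2 \<le> 4\<^sup>-\<^sup>n\<close> converges almost everywhere, and Fatou's lemma
  identifies its limit as the limit in mean square. The inequality
  \<open>u \<le> 2\<^sup>-\<^sup>n + 2\<^sup>n u\<^sup>2\<close> reduces the almost everywhere summability of the increments to that of their
  integrated squares.
\<close>
lemma L2_space_complete:
  fixes f :: "nat \<Rightarrow> 'a \<Rightarrow> 'b::{banach, second_countable_topology}"
  assumes f: "\<And>n. f n \<in> L2_space M"
    and Cauchy: "\<And>e. 0 < e \<Longrightarrow> \<exists>N. \<forall>m\<ge>N. \<forall>n\<ge>N. (\<integral>x. (norm (f m x - f n x))\<^sup>2 \<partial>M) < e"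
  shows "\<exists>g. L2_tendsto M f g"
proof -
  note [measurable] = f
  have int: "integrable M (\<lambda>x. (norm (f m x - f n x))\<^sup>2)" for m n
    by (intro L2_space_integrable L2_space_diff f)
  obtain N where N: "\<And>k m n. m \<ge> N k \<Longrightarrow> n \<ge> N k \<Longrightarrow> (\<integral>x. (norm (f m x - f n x))\<^sup>2 \<partial>M) < (1 / 4) ^ k"
  proof -
    have "\<forall>k. \<exists>N. \<forall>m\<ge>N. \<forall>n\<ge>N. (\<integral>x. (norm (f m x - f n x))\<^sup>2 \<partial>M) < (1 / 4) ^ k"
      by (intro allI Cauchy) simp
    from choice[OF this] that show thesis by blast
  qed
  \<comment> \<open>A strictly increasing sequence with \<open>N k \<le> r k\<close>.\<close>
  define r where "r = rec_nat (N 0) (\<lambda>k rk. Suc (max rk (N (Suc k))))"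
  have rs: "r (Suc k) = Suc (max (r k) (N (Suc k)))" for k by (simp add: r_def)
  have rN: "N k \<le> r k" for k by (cases k) (auto simp: rs, simp add: r_def)
  have r: "strict_mono r" by (auto simp: strict_mono_Suc_iff rs)
  define g where "g n = f (r n)" for n
  have [measurable]: "g n \<in> borel_measurable M" for n by (simp add: g_def)
  have step: "(\<integral>x. (norm (g (Suc n) x - g n x))\<^sup>2 \<partial>M) \<le> (1 / 4) ^ n" for n
  proof -
    have "N n \<le> r (Suc n)" using rN[of n] strict_monoD[OF r, of n "Suc n"] by linarith
    from N[OF this rN[of n]] show ?thesis by (simp add: g_def)
  qed
  have "(\<integral>\<^sup>+x. (\<Sum>n. ennreal (2 ^ n * (norm (g (Suc n) x - g n x))\<^sup>2)) \<partial>M)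
    = (\<Sum>n. \<integral>\<^sup>+x. ennreal (2 ^ n * (norm (g (Suc n) x - g n x))\<^sup>2) \<partial>M)"
    by (rule nn_integral_suminf) simp
  also have "\<dots> \<le> (\<Sum>n. ennreal ((1 / 2) ^ n))"
  proof (rule suminf_le)
    fix n
    have "(\<integral>\<^sup>+x. ennreal (2 ^ n * (norm (g (Suc n) x - g n x))\<^sup>2) \<partial>M)
      = ennreal (\<integral>x. 2 ^ n * (norm (g (Suc n) x - g n x))\<^sup>2 \<partial>M)"
      using int by (intro nn_integral_eq_integral) (auto simp: g_def)
    also have "\<dots> \<le> ennreal (2 ^ n * (1 / 4) ^ n)"
      using step[of n] by (auto intro!: ennreal_leI)
    also have "\<dots> = ennreal ((1 / 2) ^ n)" by (simp flip: power_mult_distrib)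
    finally show "(\<integral>\<^sup>+x. ennreal (2 ^ n * (norm (g (Suc n) x - g n x))\<^sup>2) \<partial>M) \<le> ennreal ((1 / 2) ^ n)" .
  qed auto
  also have "\<dots> = ennreal (\<Sum>n. (1 / 2) ^ n)"
    by (intro suminf_ennreal2 summable_geometric) auto
  also have "\<dots> < \<infinity>" by simp
  finally have "(\<integral>\<^sup>+x. (\<Sum>n. ennreal (2 ^ n * (norm (g (Suc n) x - g n x))\<^sup>2)) \<partial>M) \<noteq> \<infinity>"
    by (rule less_imp_neq)
  then have "AE x in M. (\<Sum>n. ennreal (2 ^ n * (norm (g (Suc n) x - g n x))\<^sup>2)) \<noteq> \<infinity>"
    by (intro nn_integral_PInf_AE) auto
  then have conv: "AE x in M. convergent (\<lambda>n. g n x)"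
  proof eventually_elim
    case (elim x)
    then have s: "summable (\<lambda>n. 2 ^ n * (norm (g (Suc n) x - g n x))\<^sup>2)"
      by (intro summable_suminf_not_top) auto
    have le: "norm (g (Suc n) x - g n x) \<le> (1 / 2) ^ n + 2 ^ n * (norm (g (Suc n) x - g n x))\<^sup>2" for n
    proof -
      let ?u = "norm (g (Suc n) x - g n x)"
      have "0 \<le> 2 ^ n * (?u - (1 / 2) ^ n)\<^sup>2" by simp
      also have "\<dots> = 2 ^ n * ?u\<^sup>2 - 2 * (2 ^ n * (1/2)^n) * ?u + (2 ^ n * (1 / 2) ^ n) * (1 / 2) ^ n"
        by (simp add: power2_eq_square algebra_simps)
      also have "2 ^ n * (1 / 2 :: real) ^ n = 1" by (simp flip: power_mult_distrib)
      finally have "2 * ?u \<le> (1 / 2) ^ n + 2 ^ n * ?u\<^sup>2" by simp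
      then show ?thesis using norm_ge_zero[of "g (Suc n) x - g n x"] by linarith
    qed
    have "summable (\<lambda>n. (1 / 2) ^ n + 2 ^ n * (norm (g (Suc n) x - g n x))\<^sup>2)"
      by (intro summable_add s summable_geometric) auto
    then have "summable (\<lambda>n. norm (g (Suc n) x - g n x))"
      by (rule summable_comparison_test[rotated]) (use le in auto)
    then have "summable (\<lambda>n. g (Suc n) x - g n x)" by (rule summable_norm_cancel)
    then have "convergent (\<lambda>n. \<Sum>i<n. g (Suc i) x - g i x)"
      by (simp add: summable_iff_convergent)
    then have "convergent (\<lambda>n. g n x - g 0 x)" unfolding sum_lessThan_telescope[of "\<lambda>n. g n x" for x] .
    then obtain l where "(\<lambda>n. g n x - g 0 x) \<longlonglongrightarrow> l" by (auto simp: convergent_def)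
    from tendsto_add[OF this tendsto_const[of "g 0 x"]] show ?case by (auto simp: convergent_def)
  qed
  define G where "G x = lim (\<lambda>n. g n x)" for x
  have [measurable]: "G \<in> borel_measurable M"
    unfolding G_def by (rule borel_measurable_lim_metric) simp
  have lim: "AE x in M. (\<lambda>n. g n x) \<longlonglongrightarrow> G x"
    using conv unfolding G_def by (auto simp: convergent_LIMSEQ_iff)
  have Fatou: "(\<integral>\<^sup>+x. ennreal ((norm (f m x - G x))\<^sup>2) \<partial>M) \<le> ennreal ((1 / 4) ^ k)" if m: "m \<ge> N k" for m k
  proof -
    have "(\<integral>\<^sup>+x. ennreal ((norm (f m x - G x))\<^sup>2) \<partial>M)
      = (\<integral>\<^sup>+x. liminf (\<lambda>n. ennreal ((norm (f m x - g n x))\<^sup>2)) \<partial>M)"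
    proof (rule nn_integral_cong_AE)
      show "AE x in M. ennreal ((norm (f m x - G x))\<^sup>2) = liminf (\<lambda>n. ennreal ((norm (f m x - g n x))\<^sup>2))"
        using lim
      proof eventually_elim
        case (elim x)
        then have "(\<lambda>n. ennreal ((norm (f m x - g n x))\<^sup>2)) \<longlonglongrightarrow> ennreal ((norm (f m x - G x))\<^sup>2)"
          by (intro tendsto_ennrealI tendsto_intros)
        then show ?case by (intro lim_imp_Liminf[symmetric]) auto
      qed
    qed
    also have "\<dots> \<le> liminf (\<lambda>n. \<integral>\<^sup>+x. ennreal ((norm (f m x - g n x))\<^sup>2) \<partial>M)"
      by (rule nn_integral_liminf) simp
    also have "\<dots> \<le> ennreal ((1 / 4) ^ k)"
    proof (rule Liminf_le)
      have "(\<integral>\<^sup>+x. ennreal ((norm (f m x - g n x))\<^sup>2) \<partial>M) \<le> ennreal ((1 / 4) ^ k)" if "n \<ge> k" for n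
      proof -
        have "N k \<le> r n" using rN[of k] strict_mono_leD[OF r that] by simp
        from N[OF m this] show ?thesis
          unfolding g_def by (subst nn_integral_eq_integral[OF int]) (auto intro!: ennreal_leI)
      qed
      then show "\<forall>\<^sub>F n in sequentially. (\<integral>\<^sup>+x. ennreal ((norm (f m x - g n x))\<^sup>2) \<partial>M) \<le> ennreal ((1 / 4) ^ k)"
        by (auto simp: eventually_sequentially)
    qed simp
    finally show ?thesis .
  qed
  have dG: "(\<lambda>x. f m x - G x) \<in> L2_space M" if "m \<ge> N 0" for m
    using Fatou[OF that] by (intro L2_spaceI integrableI_nonneg) (auto intro: le_less_trans)
  have G: "G \<in> L2_space M"
    using L2_space_diff[OF f[of "N 0"] dG[OF order_refl]] by simp
  have "(\<integral>x. (norm (f m x - G x))\<^sup>2 \<partial>M) \<le> (1 / 4) ^ k" if "m \<ge> N k" for m k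
    using Fatou[OF that] by (subst (asm) nn_integral_eq_integral)
      (auto intro!: L2_space_integrable L2_space_diff f G)
  then have le: "\<bar>\<integral>x. (norm (f m x - G x))\<^sup>2 \<partial>M\<bar> \<le> (1 / 4) ^ k" if "m \<ge> N k" for m k
    using that by (simp add: integral_nonneg)
  have "(\<lambda>n. \<integral>x. (norm (f n x - G x))\<^sup>2 \<partial>M) \<longlonglongrightarrow> 0"
  proof (rule LIMSEQ_I)
    fix e :: real assume "0 < e"
    then obtain k where "(1 / 4) ^ k < e" using real_arch_pow_inv[of e "1/4"] by auto
    then show "\<exists>N. \<forall>n\<ge>N. norm ((\<integral>x. (norm (f n x - G x))\<^sup>2 \<partial>M) - 0) < e"
      using le[of k] by (intro exI[of _ "N k"]) force
  qed
  then show ?thesis using f G by (auto simp: L2_tendsto_def)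
qed

lemma L2_tendsto_inner_left:
  fixes f :: "nat \<Rightarrow> 'a \<Rightarrow> 'b::{real_inner, second_countable_topology}"
  assumes "L2_tendsto M f g"
  shows "L2_tendsto M (\<lambda>n x. h \<bullet> f n x) (\<lambda>x. h \<bullet> g x)"
proof (rule L2_tendsto_bound)
  note [measurable] = L2_tendstoD(1,2)[OF assms(1)]
  have L2: "(\<lambda>x. h \<bullet> u x) \<in> L2_space M" if [measurable]: "u \<in> L2_space M" for u
    by (rule L2_space_bound[OF L2_space_scaleR[OF that, of "norm h"]]) (auto simp: Cauchy_Schwarz_ineq2)
  show "(\<lambda>x. h \<bullet> f n x) \<in> L2_space M" "(\<lambda>x. h \<bullet> g x) \<in> L2_space M" for n
    by (intro L2 L2_tendstoD[OF assms])+
  show "(\<lambda>n. (norm h)\<^sup>2 * (\<integral>x. (norm (f n x - g x))\<^sup>2 \<partial>M)) \<longlonglongrightarrow> 0"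
    by (intro tendsto_mult_right_zero L2_tendstoD[OF assms])
  fix n
  have d: "(\<lambda>x. f n x - g x) \<in> L2_space M" by (intro L2_space_diff L2_tendstoD[OF assms])
  have "(norm (h \<bullet> f n x - h \<bullet> g x))\<^sup>2 \<le> (norm h)\<^sup>2 * (norm (f n x - g x))\<^sup>2" for x
    using power_mono[OF Cauchy_Schwarz_ineq2[of h "f n x - g x"], of 2]
    by (simp add: inner_diff_right power_mult_distrib)
  then have "(\<integral>x. (norm (h \<bullet> f n x - h \<bullet> g x))\<^sup>2 \<partial>M) \<le> (\<integral>x. (norm h)\<^sup>2 * (norm (f n x - g x))\<^sup>2 \<partial>M)"
    by (intro integral_mono L2_space_integrable L2_space_diff L2 L2_tendstoD[OF assms]
        integrable_mult_right L2_space_integrable[OF d])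
  then show "(\<integral>x. (norm (h \<bullet> f n x - h \<bullet> g x))\<^sup>2 \<partial>M) \<le> (norm h)\<^sup>2 * (\<integral>x. (norm (f n x - g x))\<^sup>2 \<partial>M)"
    by simp
qed

lemma borel_measurable_vecI:
  fixes f :: "'a \<Rightarrow> real^'d"
  assumes "\<And>i. (\<lambda>x. f x $ i) \<in> borel_measurable M"
  shows "f \<in> borel_measurable M"
proof (subst borel_measurable_euclidean_space, intro ballI)
  fix b :: "real^'d" assume "b \<in> Basis"
  then obtain i where "b = axis i 1" by (auto simp: Basis_vec_def)
  then show "(\<lambda>x. f x \<bullet> b) \<in> borel_measurable M" using assms[of i] by (simp add: inner_axis)
qed

lemma norm_vec_sq: "(norm x)\<^sup>2 = (\<Sum>i\<in>UNIV. (x $ i)\<^sup>2)" for x :: "real^'d"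
  unfolding power2_norm_eq_inner inner_vec_def by (simp add: power2_eq_square)

lemma L2_space_vec:
  fixes f :: "'a \<Rightarrow> real^'d"
  assumes "\<And>i. (\<lambda>x. f x $ i) \<in> L2_space M"
  shows "f \<in> L2_space M"
  using assms by (intro L2_spaceI borel_measurable_vecI)
    (auto simp: norm_vec_sq L2_space_def)

lemma L2_tendsto_vec:
  fixes f :: "nat \<Rightarrow> 'a \<Rightarrow> real^'d"
  assumes "\<And>i. L2_tendsto M (\<lambda>n x. f n x $ i) (\<lambda>x. g x $ i)"
  shows "L2_tendsto M f g"
proof -
  have "(\<integral>x. (norm (f n x - g x))\<^sup>2 \<partial>M) = (\<Sum>i\<in>UNIV. \<integral>x. (norm (f n x $ i - g x $ i))\<^sup>2 \<partial>M)" for n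
    unfolding norm_vec_sq
    using L2_space_integrable[OF L2_space_diff[OF L2_tendstoD(1,2)[OF assms]]]
    by (subst Bochner_Integration.integral_sum) auto
  moreover have "(\<lambda>n. \<Sum>i\<in>UNIV. \<integral>x. (norm (f n x $ i - g x $ i))\<^sup>2 \<partial>M) \<longlonglongrightarrow> 0"
    using tendsto_sum[of UNIV "\<lambda>i n. \<integral>x. (norm (f n x $ i - g x $ i))\<^sup>2 \<partial>M" "\<lambda>_. 0"]
      L2_tendstoD(3)[OF assms] by simp
  ultimately show ?thesis
    using L2_tendstoD(1,2)[OF assms] by (auto simp: L2_tendsto_def intro: L2_space_vec)
qed

section \<open>Centered Gaussian variables and limits of independent variables\<close>

lemma centered_gaussian_measurable: "centered_gaussian P Y v \<Longrightarrow> Y \<in> borel_measurable P"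
  by (simp add: centered_gaussian_def)

lemma centered_gaussian_nonneg: "centered_gaussian P Y v \<Longrightarrow> 0 \<le> v"
  by (simp add: centered_gaussian_def)

lemma distr_std_normal_scale:
  assumes "0 < \<sigma>"
  shows "distr std_normal_distribution borel (\<lambda>x. \<sigma> * x) = density lborel (normal_density 0 \<sigma>)"
proof -
  interpret N: real_distribution std_normal_distribution by (rule real_dist_normal_dist)
  have "distributed std_normal_distribution lborel (\<lambda>x. x) std_normal_density"
    by (simp add: distributed_def distr_id2)
  from N.normal_density_affine[OF this, of \<sigma> 0] assms
  have "distr std_normal_distribution lborel (\<lambda>x. \<sigma> * x) = density lborel (normal_density 0 \<sigma>)"
    by (simp add: distributed_def)
  then show ?thesis by (simp cong: distr_cong)
qed

text \<open>The law that \<open>centered_gaussian\<close> prescribes, as one measure for the degenerate and the regular case.\<close>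
definition gaussian_law :: "real \<Rightarrow> real measure" where
  "gaussian_law v = (if v = 0 then return borel 0 else density lborel (normal_density 0 (sqrt v)))"

lemma real_distribution_gaussian_law:
  assumes "0 \<le> v"
  shows "real_distribution (gaussian_law v)"
  using assms
  by (auto simp: gaussian_law_def real_distribution_def real_distribution_axioms_def
      intro!: prob_space_return prob_space_normal_density)

lemma char_gaussian_law:
  assumes "0 \<le> v"
  shows "char (gaussian_law v) t = exp (- (v * t\<^sup>2) / 2)"
proof (cases "v = 0")
  case True
  then show ?thesis by (simp add: gaussian_law_def char_def integral_return)
next
  case False
  then have v: "0 < sqrt v" using assms by simp
  have "char (gaussian_law v) t = char (distr std_normal_distribution borel (\<lambda>x. sqrt v * x)) t"
    using False distr_std_normal_scale[OF v] by (simp add: gaussian_law_def)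
  also have "\<dots> = char std_normal_distribution (t * sqrt v)"
    unfolding char_def by (subst integral_distr) (auto simp: mult.assoc)
  also have "\<dots> = exp (- (v * t\<^sup>2) / 2)"
    using assms by (simp add: char_std_normal_distribution power_mult_distrib mult.commute)
  finally show ?thesis .
qed

context prob_space
begin

lemma centered_gaussian_iff_law:
  assumes [measurable]: "Y \<in> borel_measurable M" and v: "0 \<le> v"
  shows "centered_gaussian M Y v \<longleftrightarrow> distr M borel Y = gaussian_law v"
proof (cases "v = 0")
  case True
  have "(AE \<omega> in M. Y \<omega> = 0) \<longleftrightarrow> distr M borel Y = return borel 0"
  proof
    assume "AE \<omega> in M. Y \<omega> = 0"
    then have "distr M borel Y = distr M borel (\<lambda>_. 0)"
      by (intro distr_cong_AE) auto
    then show "distr M borel Y = return borel 0" by simp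
  next
    assume "distr M borel Y = return borel 0"
    moreover have "AE y in return borel (0::real). y = 0" by (subst AE_return) auto
    ultimately have "AE y in distr M borel Y. y = 0" by (simp only:)
    then show "AE \<omega> in M. Y \<omega> = 0" by (subst (asm) AE_distr_iff) auto
  qed
  with True show ?thesis by (simp add: centered_gaussian_def gaussian_law_def)
next
  case False
  have "distr M lborel Y = distr M borel Y" by (rule distr_cong) auto
  then show ?thesis
    using False v by (simp add: centered_gaussian_def gaussian_law_def distributed_def)
qed

text \<open>
  Characteristic functions treat the variance 0 and positive variances alike, which makes them
  convenient for sums of independent variables and for limits.
\<close>
lemma centered_gaussian_iff_char:
  assumes Y: "Y \<in> borel_measurable M" and v: "0 \<le> v"
  shows "centered_gaussian M Y v \<longleftrightarrow> (\<forall>t. char (distr M borel Y) t = exp (- (v * t\<^sup>2) / 2))"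
proof -
  have "real_distribution (distr M borel Y)"
    using Y by (simp add: real_distribution_def real_distribution_axioms_def prob_space_distr)
  then have "distr M borel Y = gaussian_law v \<longleftrightarrow> char (distr M borel Y) = char (gaussian_law v)"
    using Levy_uniqueness real_distribution_gaussian_law[OF v] by auto
  then show ?thesis
    unfolding centered_gaussian_iff_law[OF assms] by (auto simp: char_gaussian_law[OF v])
qed

text \<open>
  A subsequence converges almost surely, so the characteristic functions converge by bounded
  convergence. Their limit is again Gaussian, including the degenerate case \<open>c = 0\<close>.
\<close>
lemma centered_gaussian_L2_limit:
  assumes lim: "L2_tendsto M Y Z" and Y: "\<And>n. centered_gaussian M (Y n) (v n)" and v: "v \<longlonglongrightarrow> c"
  shows "centered_gaussian M Z c"
proof -
  have [measurable]: "Y n \<in> borel_measurable M" "Z \<in> borel_measurable M" for n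
    using L2_tendstoD[OF lim] by (auto simp: L2_space_measurable)
  have v0: "0 \<le> v n" for n by (rule centered_gaussian_nonneg[OF Y])
  then have c: "0 \<le> c" using v by (intro LIMSEQ_le_const[OF v]) auto
  obtain r :: "nat \<Rightarrow> nat" where r: "strict_mono r" "AE \<omega> in M. (\<lambda>n. Y (r n) \<omega>) \<longlonglongrightarrow> Z \<omega>"
    using L2_tendsto_AE_subseq[OF lim] .
  have "char (distr M borel Z) t = exp (- (c * t\<^sup>2) / 2)" for t
  proof (rule LIMSEQ_unique)
    have "(\<lambda>n. CLINT \<omega>|M. iexp (t * Y (r n) \<omega>)) \<longlonglongrightarrow> (CLINT \<omega>|M. iexp (t * Z \<omega>))"
    proof (rule integral_dominated_convergence[where w = "\<lambda>_. 1"])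
      show "AE \<omega> in M. (\<lambda>n. iexp (t * Y (r n) \<omega>)) \<longlonglongrightarrow> iexp (t * Z \<omega>)"
        using r(2) by eventually_elim (intro tendsto_intros)
    qed auto
    then show "(\<lambda>n. char (distr M borel (Y (r n))) t) \<longlonglongrightarrow> char (distr M borel Z) t"
      by (simp add: char_def integral_distr)
    have "char (distr M borel (Y n)) t = exp (- (v n * t\<^sup>2) / 2)" for n
      using Y[of n] centered_gaussian_iff_char[of "Y n" "v n"] v0 by auto
    moreover have "(\<lambda>n. complex_of_real (exp (- (v (r n) * t\<^sup>2) / 2))) \<longlonglongrightarrow> exp (- (c * t\<^sup>2) / 2)"
      using LIMSEQ_subseq_LIMSEQ[OF v r(1)]
      by (intro tendsto_of_real tendsto_intros) (auto simp: o_def)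
    ultimately show "(\<lambda>n. char (distr M borel (Y (r n))) t) \<longlonglongrightarrow> exp (- (c * t\<^sup>2) / 2)"
      by simp
  qed
  then show ?thesis using centered_gaussian_iff_char[of Z c] c by auto
qed

lemma centered_gaussian_cong_AE:
  assumes "centered_gaussian M Y v" "Z \<in> borel_measurable M" "AE \<omega> in M. Y \<omega> = Z \<omega>"
  shows "centered_gaussian M Z v"
proof -
  note [measurable] = assms(2) centered_gaussian_measurable[OF assms(1)]
  have "distr M borel Y = distr M borel Z" using assms(3) by (intro distr_cong_AE) auto
  then show ?thesis
    using assms centered_gaussian_nonneg[OF assms(1)] centered_gaussian_measurable[OF assms(1)]
    by (simp add: centered_gaussian_iff_law)
qed

lemma centered_gaussian_sum:
  assumes indep: "indep_vars (\<lambda>_. borel) Y I" and Y: "\<And>i. i \<in> I \<Longrightarrow> centered_gaussian M (Y i) (v i)"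
  shows "centered_gaussian M (\<lambda>\<omega>. \<Sum>i\<in>I. Y i \<omega>) (\<Sum>i\<in>I. v i)"
proof -
  have v: "0 \<le> v i" if "i \<in> I" for i by (rule centered_gaussian_nonneg[OF Y[OF that]])
  have meas: "Y i \<in> borel_measurable M" if "i \<in> I" for i
    by (rule centered_gaussian_measurable[OF Y[OF that]])
  have "char (distr M borel (\<lambda>\<omega>. \<Sum>i\<in>I. Y i \<omega>)) t = exp (- ((\<Sum>i\<in>I. v i) * t\<^sup>2) / 2)" for t
  proof -
    have "char (distr M borel (\<lambda>\<omega>. \<Sum>i\<in>I. Y i \<omega>)) t = (\<Prod>i\<in>I. char (distr M borel (Y i)) t)"
      by (rule char_distr_sum[OF indep])
    also have "\<dots> = (\<Prod>i\<in>I. exp (complex_of_real (- (v i * t\<^sup>2) / 2)))"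
    proof (rule prod.cong[OF refl])
      fix i assume i: "i \<in> I"
      show "char (distr M borel (Y i)) t = exp (complex_of_real (- (v i * t\<^sup>2) / 2))"
        unfolding exp_of_real using Y[OF i] centered_gaussian_iff_char[OF meas v, OF i i] by blast
    qed
    also have "\<dots> = exp (complex_of_real (- ((\<Sum>i\<in>I. v i) * t\<^sup>2) / 2))"
    proof (cases "finite I")
      case True
      then show ?thesis
        by (simp add: exp_sum[symmetric] sum_distrib_right sum_divide_distrib sum_negf)
    qed simp
    finally show ?thesis unfolding exp_of_real .
  qed
  then show ?thesis
    using v meas by (subst centered_gaussian_iff_char) (auto intro!: sum_nonneg borel_measurable_sum)
qed

lemma centered_gaussian_second_moment:
  assumes Y: "centered_gaussian M Y v"
  shows "(\<integral>\<omega>. (Y \<omega>)\<^sup>2 \<partial>M) = v"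
proof (cases "v = 0")
  case True
  then have "AE \<omega> in M. Y \<omega> = 0" using Y by (simp add: centered_gaussian_def)
  moreover have "Y \<in> borel_measurable M" by (rule centered_gaussian_measurable[OF Y])
  ultimately have "(\<integral>\<omega>. (Y \<omega>)\<^sup>2 \<partial>M) = (\<integral>\<omega>. 0 \<partial>M)" by (intro integral_cong_AE) auto
  with True show ?thesis by simp
next
  case False
  then have "distributed M lborel Y (normal_density 0 (sqrt v))" "0 < sqrt v" "0 \<le> v"
    using Y by (auto simp: centered_gaussian_def)
  with normal_distributed_expectation[of "sqrt v" Y 0] normal_distributed_variance[of "sqrt v" Y 0]
  show ?thesis by simp
qed

text \<open>
  Closed sets form an intersection-stable generator, so it suffices to show that the probability of
  \<open>\<Inter>i. {Y i \<in> A i}\<close> is a product when all \<open>A i\<close> are closed. The indicator of a closed set is a pointwise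
  limit of continuous functions with values in \<open>[0, 1]\<close>, and for these the product formula passes from
  \<open>Z n\<close> to \<open>Y\<close> by bounded convergence.
\<close>
lemma indep_vars_AE_limit:
  fixes Y :: "'i \<Rightarrow> 'a \<Rightarrow> 'b::metric_space"
  assumes fin: "finite I" and indep: "\<And>n. indep_vars (\<lambda>_. borel) (Z n) I"
    and meas: "\<And>i. i \<in> I \<Longrightarrow> Y i \<in> borel_measurable M"
    and lim: "\<And>i. i \<in> I \<Longrightarrow> AE \<omega> in M. (\<lambda>n. Z n i \<omega>) \<longlonglongrightarrow> Y i \<omega>"
  shows "indep_vars (\<lambda>_. borel) Y I"
proof (cases "I = {}")
  case True
  then show ?thesis by (simp add: indep_vars_def2 indep_sets_def)
next
  case False
  \<comment> \<open>The empty set is special because \<open>infdist x {} = 0\<close>.\<close>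
  define \<phi> :: "'b set \<Rightarrow> nat \<Rightarrow> 'b \<Rightarrow> real"
    where "\<phi> C m x = (if C = {} then 0 else max 0 (1 - real m * infdist x C))" for C m x
  have cont: "continuous_on UNIV (\<phi> C m)" for C m
    unfolding \<phi>_def by (cases "C = {}") (auto intro!: continuous_intros)
  then have [measurable]: "\<phi> C m \<in> borel_measurable borel" for C m
    by (rule borel_measurable_continuous_onI)
  have bounds: "0 \<le> \<phi> C m x" "\<phi> C m x \<le> 1" for C m x
    by (auto simp: \<phi>_def infdist_nonneg)
  have \<phi>_lim: "(\<lambda>m. \<phi> C m x) \<longlonglongrightarrow> indicator C x" if C: "closed C" for C x
  proof (cases "C = {} \<or> x \<in> C")
    case True
    then have "\<phi> C m x = indicator C x" for m
      by (auto simp: \<phi>_def)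
    then show ?thesis by simp
  next
    case False
    then have d: "0 < infdist x C" using C infdist_pos_not_in_closed by blast
    obtain k where k: "1 < real k * infdist x C" using reals_Archimedean3[OF d] by blast
    have "\<phi> C m x = 0" if "m \<ge> k" for m
    proof -
      have "real k * infdist x C \<le> real m * infdist x C"
        using that d by (intro mult_right_mono) auto
      with k show ?thesis by (simp add: \<phi>_def)
    qed
    then have "eventually (\<lambda>m. \<phi> C m x = 0) sequentially" by (auto simp: eventually_sequentially)
    then have "(\<lambda>m. \<phi> C m x) \<longlonglongrightarrow> 0" by (rule tendsto_eventually)
    with False show ?thesis by simp
  qed
  have measZ[measurable]: "Z n i \<in> borel_measurable M" if "i \<in> I" for n i
    using indep[of n] that by (simp add: indep_vars_def)
  note meas[measurable]
  have prod_bound: "norm (\<Prod>i\<in>I. \<phi> (A i) m (X i)) \<le> 1" for A m and X :: "'i \<Rightarrow> 'b"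
    using bounds by (auto simp: abs_prod intro!: prod_le_1)
  have lim_all: "AE \<omega> in M. \<forall>i\<in>I. (\<lambda>n. Z n i \<omega>) \<longlonglongrightarrow> Y i \<omega>"
    using lim fin by (simp add: AE_finite_all)
  have eq_m: "(\<integral>\<omega>. (\<Prod>i\<in>I. \<phi> (A i) m (Y i \<omega>)) \<partial>M) = (\<Prod>i\<in>I. \<integral>\<omega>. \<phi> (A i) m (Y i \<omega>) \<partial>M)" for A m
  proof (rule LIMSEQ_unique)
    have tend: "(\<lambda>n. \<phi> C m (z n)) \<longlonglongrightarrow> \<phi> C m y" if "z \<longlonglongrightarrow> y" for C y and z :: "nat \<Rightarrow> 'b"
      using continuous_on_tendsto_compose[OF cont that] by simp
    show "(\<lambda>n. \<integral>\<omega>. (\<Prod>i\<in>I. \<phi> (A i) m (Z n i \<omega>)) \<partial>M) \<longlonglongrightarrow> (\<integral>\<omega>. (\<Prod>i\<in>I. \<phi> (A i) m (Y i \<omega>)) \<partial>M)"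
    proof (rule integral_dominated_convergence[where w = "\<lambda>_. 1"])
      show "AE \<omega> in M. (\<lambda>n. \<Prod>i\<in>I. \<phi> (A i) m (Z n i \<omega>)) \<longlonglongrightarrow> (\<Prod>i\<in>I. \<phi> (A i) m (Y i \<omega>))"
        using lim_all by eventually_elim (intro tendsto_prod tend, auto)
    qed (auto simp: prod_bound[unfolded real_norm_def])
    have "(\<lambda>n. \<Prod>i\<in>I. \<integral>\<omega>. \<phi> (A i) m (Z n i \<omega>) \<partial>M) \<longlonglongrightarrow> (\<Prod>i\<in>I. \<integral>\<omega>. \<phi> (A i) m (Y i \<omega>) \<partial>M)"
    proof (intro tendsto_prod)
      fix i assume i: "i \<in> I"
      show "(\<lambda>n. \<integral>\<omega>. \<phi> (A i) m (Z n i \<omega>) \<partial>M) \<longlonglongrightarrow> (\<integral>\<omega>. \<phi> (A i) m (Y i \<omega>) \<partial>M)"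
      proof (rule integral_dominated_convergence[where w = "\<lambda>_. 1"])
        show "AE \<omega> in M. (\<lambda>n. \<phi> (A i) m (Z n i \<omega>)) \<longlonglongrightarrow> \<phi> (A i) m (Y i \<omega>)"
          using lim[OF i] by eventually_elim (rule tend)
      qed (use bounds i in auto)
    qed
    moreover have "(\<Prod>i\<in>I. \<integral>\<omega>. \<phi> (A i) m (Z n i \<omega>) \<partial>M) = (\<integral>\<omega>. (\<Prod>i\<in>I. \<phi> (A i) m (Z n i \<omega>)) \<partial>M)" for n
      by (intro indep_vars_lebesgue_integral[symmetric] fin
          indep_vars_compose2[OF indep[of n], where N = "\<lambda>_. borel"] integrable_const_bound[where B = 1])
        (use bounds in auto)
    ultimately show "(\<lambda>n. \<integral>\<omega>. (\<Prod>i\<in>I. \<phi> (A i) m (Z n i \<omega>)) \<partial>M)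
      \<longlonglongrightarrow> (\<Prod>i\<in>I. \<integral>\<omega>. \<phi> (A i) m (Y i \<omega>) \<partial>M)" by simp
  qed
  have "prob (\<Inter>i\<in>I. Y i -` A i \<inter> space M) = (\<Prod>i\<in>I. prob (Y i -` A i \<inter> space M))"
    if A: "A \<in> (\<Pi> i\<in>I. Collect closed)" for A
  proof -
    have cl: "closed (A i)" if "i \<in> I" for i using A that by auto
    then have [measurable]: "A i \<in> sets borel" if "i \<in> I" for i using that by auto
    have "(\<integral>\<omega>. (\<Prod>i\<in>I. indicator (A i) (Y i \<omega>) :: real) \<partial>M) = (\<Prod>i\<in>I. \<integral>\<omega>. indicator (A i) (Y i \<omega>) \<partial>M)"
    proof (rule LIMSEQ_unique)
      show "(\<lambda>m. \<integral>\<omega>. (\<Prod>i\<in>I. \<phi> (A i) m (Y i \<omega>)) \<partial>M) \<longlonglongrightarrow> (\<integral>\<omega>. (\<Prod>i\<in>I. indicator (A i) (Y i \<omega>)) \<partial>M)"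
        by (rule integral_dominated_convergence[where w = "\<lambda>_. 1"])
          (auto simp: prod_bound[unfolded real_norm_def] intro!: tendsto_prod \<phi>_lim cl)
      show "(\<lambda>m. \<integral>\<omega>. (\<Prod>i\<in>I. \<phi> (A i) m (Y i \<omega>)) \<partial>M) \<longlonglongrightarrow> (\<Prod>i\<in>I. \<integral>\<omega>. indicator (A i) (Y i \<omega>) \<partial>M)"
        unfolding eq_m
      proof (intro tendsto_prod)
        fix i assume i: "i \<in> I"
        show "(\<lambda>m. \<integral>\<omega>. \<phi> (A i) m (Y i \<omega>) \<partial>M) \<longlonglongrightarrow> (\<integral>\<omega>. indicator (A i) (Y i \<omega>) \<partial>M)"
          using i by (intro integral_dominated_convergence[where w = "\<lambda>_. 1"])
            (use bounds in \<open>auto intro!: \<phi>_lim cl\<close>)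
      qed
    qed
    moreover have "(\<integral>\<omega>. indicator (A i) (Y i \<omega>) \<partial>M) = prob (Y i -` A i \<inter> space M)" if "i \<in> I" for i
    proof -
      have "(\<integral>\<omega>. indicator (A i) (Y i \<omega>) \<partial>M) = (\<integral>\<omega>. indicat_real (Y i -` A i \<inter> space M) \<omega> \<partial>M)"
        by (intro Bochner_Integration.integral_cong) (auto simp: indicator_def)
      then show ?thesis using that by simp
    qed
    moreover have "(\<integral>\<omega>. (\<Prod>i\<in>I. indicator (A i) (Y i \<omega>) :: real) \<partial>M) = prob (\<Inter>i\<in>I. Y i -` A i \<inter> space M)"
    proof -
      have "(\<Prod>i\<in>I. indicator (A i) (Y i \<omega>)) = (indicator (\<Inter>i\<in>I. Y i -` A i \<inter> space M) \<omega> :: real)"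
        if "\<omega> \<in> space M" for \<omega>
        using that fin False by (auto simp: indicator_def prod_eq_1_iff)
      then have "(\<integral>\<omega>. (\<Prod>i\<in>I. indicator (A i) (Y i \<omega>)) \<partial>M)
        = (\<integral>\<omega>. indicat_real (\<Inter>i\<in>I. Y i -` A i \<inter> space M) \<omega> \<partial>M)"
        by (intro Bochner_Integration.integral_cong) auto
      then show ?thesis
        using fin False by (simp add: sets.finite_INT)
    qed
    ultimately show ?thesis by simp
  qed
  moreover have "sets borel = sigma_sets (space borel) (Collect closed :: 'b set set)"
    by (subst borel_eq_closed) simp
  ultimately show ?thesis
    by (subst indep_vars_finite[OF False fin, where E = "\<lambda>_. Collect closed"])
      (auto simp: meas Int_stable_def)
qed

lemma indep_vars_L2_limit:
  fixes Y :: "'i \<Rightarrow> 'a \<Rightarrow> 'b::{real_normed_vector, second_countable_topology}"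
  assumes fin: "finite I" and indep: "\<And>n. indep_vars (\<lambda>_. borel) (Z n) I"
    and lim: "\<And>i. i \<in> I \<Longrightarrow> L2_tendsto M (\<lambda>n. Z n i) (Y i)"
  shows "indep_vars (\<lambda>_. borel) Y I"
proof -
  have "\<exists>r::nat \<Rightarrow> nat. strict_mono r \<and> (\<forall>i\<in>J. AE \<omega> in M. (\<lambda>n. Z (r n) i \<omega>) \<longlonglongrightarrow> Y i \<omega>)"
    if "finite J" "J \<subseteq> I" for J
    using that
  proof (induction J)
    case empty
    then show ?case by (auto intro!: exI[of _ id] simp: strict_mono_def)
  next
    case (insert j J)
    then obtain r :: "nat \<Rightarrow> nat" where r: "strict_mono r"
      "\<And>i. i \<in> J \<Longrightarrow> AE \<omega> in M. (\<lambda>n. Z (r n) i \<omega>) \<longlonglongrightarrow> Y i \<omega>"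
      by auto
    have "L2_tendsto M (\<lambda>n. Z (r n) j) (Y j)"
      using L2_tendsto_subseq[OF lim r(1)] insert.prems by simp
    then obtain q :: "nat \<Rightarrow> nat" where q: "strict_mono q" "AE \<omega> in M. (\<lambda>n. Z (r (q n)) j \<omega>) \<longlonglongrightarrow> Y j \<omega>"
      by (rule L2_tendsto_AE_subseq)
    have "AE \<omega> in M. (\<lambda>n. Z (r (q n)) i \<omega>) \<longlonglongrightarrow> Y i \<omega>" if "i \<in> J" for i
      using r(2)[OF that] by eventually_elim (drule LIMSEQ_subseq_LIMSEQ[OF _ q(1)], simp add: o_def)
    with q strict_mono_o[OF r(1) q(1)] show ?case
      by (intro exI[of _ "r \<circ> q"]) (auto simp: o_def)
  qed
  from this[OF fin order_refl] obtain r :: "nat \<Rightarrow> nat" where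
    r: "\<And>i. i \<in> I \<Longrightarrow> AE \<omega> in M. (\<lambda>n. Z (r n) i \<omega>) \<longlonglongrightarrow> Y i \<omega>" by auto
  show ?thesis
    by (rule indep_vars_AE_limit[OF fin, where Z = "\<lambda>n. Z (r n)"])
      (rule indep L2_space_measurable L2_tendstoD(2)[OF lim] r | assumption)+
qed

lemma indep_vars_cong_AE:
  fixes Y Z :: "'i \<Rightarrow> 'a \<Rightarrow> 'b::metric_space"
  assumes "finite I" "indep_vars (\<lambda>_. borel) Z I" "\<And>i. i \<in> I \<Longrightarrow> Y i \<in> borel_measurable M"
    "\<And>i. i \<in> I \<Longrightarrow> AE \<omega> in M. Z i \<omega> = Y i \<omega>"
  shows "indep_vars (\<lambda>_. borel) Y I"
proof (rule indep_vars_AE_limit[OF assms(1), where Z = "\<lambda>_. Z", OF assms(2,3)])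
  show "AE \<omega> in M. (\<lambda>n. Z i \<omega>) \<longlonglongrightarrow> Y i \<omega>" if "i \<in> I" for i
    using assms(4)[OF that] by eventually_elim simp
qed

end

section \<open>The Wiener integral of a Hilbert space valued white noise\<close>

text \<open>
  The index measure is \<open>M\<close>; probabilities, expectations and independence refer to \<open>P\<close>.
\<close>
locale hilbert_noise = P: prob_space P + finite_measure M
  for P :: "'o measure" and M :: "'w measure" +
  fixes \<nu> :: "'w set \<Rightarrow> 'o \<Rightarrow> 'h::{real_inner, banach, second_countable_topology}"
  assumes noise: "hilbert_white_noise P M \<nu>"
begin

lemma noise_L2: "A \<in> sets M \<Longrightarrow> \<nu> A \<in> L2_space P"
  using noise by (auto simp: hilbert_white_noise_def)

lemma inner_noise_gaussian:
  "A \<in> sets M \<Longrightarrow> centered_gaussian P (\<lambda>\<omega>. h \<bullet> \<nu> A \<omega>) (measure M A * (norm h)\<^sup>2)"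
  using noise by (auto simp: hilbert_white_noise_def inner_commute)

lemma inner_noise_measurable: "A \<in> sets M \<Longrightarrow> (\<lambda>\<omega>. h \<bullet> \<nu> A \<omega>) \<in> borel_measurable P"
  by (rule centered_gaussian_measurable[OF inner_noise_gaussian])

lemma inner_noise_L2: "A \<in> sets M \<Longrightarrow> (\<lambda>\<omega>. h \<bullet> \<nu> A \<omega>) \<in> L2_space P"
  using L2_tendstoD(2)[OF L2_tendsto_inner_left[OF L2_tendsto_const[OF noise_L2]]] .

lemma inner_noise_empty: "AE \<omega> in P. h \<bullet> \<nu> {} \<omega> = 0"
  using inner_noise_gaussian[of "{}" h] by (simp add: centered_gaussian_def)

text \<open>
  Sigma-additivity is stated for sequences only, so the two sets are completed by empty sets.
  For a fixed \<open>h\<close>, the scalar product with \<open>\<nu> {}\<close> vanishes because it is Gaussian with variance 0.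
\<close>
lemma inner_noise_Un:
  assumes A: "A \<in> sets M" and B: "B \<in> sets M" and AB: "A \<inter> B = {}"
  shows "AE \<omega> in P. h \<bullet> \<nu> (A \<union> B) \<omega> = h \<bullet> \<nu> A \<omega> + h \<bullet> \<nu> B \<omega>"
proof -
  define S where "S i = (if i = 0 then A else if i = 1 then B else {})" for i :: nat
  have "range S \<subseteq> sets M" "disjoint_family S"
    using A B AB by (auto simp: S_def disjoint_family_on_def)
  then have "L2_tendsto P (\<lambda>n \<omega>. \<Sum>i<n. \<nu> (S i) \<omega>) (\<nu> (\<Union>i. S i))"
    using noise by (auto simp: hilbert_white_noise_def sigma_additive_L2_def)
  from L2_tendsto_inner_left[OF this, of h]
  have lim: "L2_tendsto P (\<lambda>n \<omega>. \<Sum>i<n. h \<bullet> \<nu> (S i) \<omega>) (\<lambda>\<omega>. h \<bullet> \<nu> (\<Union>i. S i) \<omega>)"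
    by (simp add: inner_sum_right)
  have U: "(\<Union>i. S i) = A \<union> B" by (auto simp: S_def split: if_splits)
  have "L2_tendsto P (\<lambda>n \<omega>. \<Sum>i<n + 2. h \<bullet> \<nu> (S i) \<omega>) (\<lambda>\<omega>. h \<bullet> \<nu> (A \<union> B) \<omega>)"
    using L2_tendsto_subseq[OF lim, of "\<lambda>n. n + 2"] unfolding U by (simp add: strict_mono_def)
  then have "L2_tendsto P (\<lambda>n \<omega>. h \<bullet> \<nu> A \<omega> + h \<bullet> \<nu> B \<omega>) (\<lambda>\<omega>. h \<bullet> \<nu> (A \<union> B) \<omega>)"
  proof (rule L2_tendsto_cong_AE)
    show "AE \<omega> in P. (\<Sum>i<n + 2. h \<bullet> \<nu> (S i) \<omega>) = h \<bullet> \<nu> A \<omega> + h \<bullet> \<nu> B \<omega>" for n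
      using inner_noise_empty[of h]
    proof eventually_elim
      case (elim \<omega>)
      have "(\<Sum>i<n + 2. h \<bullet> \<nu> (S i) \<omega>) = (\<Sum>i\<in>{0, 1}. h \<bullet> \<nu> (S i) \<omega>)"
        using elim by (intro sum.mono_neutral_right) (auto simp: S_def)
      then show ?case by (simp add: S_def)
    qed
  qed (auto intro!: borel_measurable_add inner_noise_measurable A B)
  from L2_tendsto_unique[OF this L2_tendsto_const] show ?thesis
    using L2_space_add[OF inner_noise_L2[OF A] inner_noise_L2[OF B], of h h] by auto
qed

lemma inner_noise_UN:
  assumes "finite K" "disjoint_family_on A K" "\<And>k. k \<in> K \<Longrightarrow> A k \<in> sets M"
  shows "AE \<omega> in P. h \<bullet> \<nu> (\<Union>k\<in>K. A k) \<omega> = (\<Sum>k\<in>K. h \<bullet> \<nu> (A k) \<omega>)"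
  using assms
proof (induction K)
  case empty
  then show ?case using inner_noise_empty[of h] by simp
next
  case (insert k K)
  have "A k \<inter> (\<Union>k\<in>K. A k) = {}"
    using insert.prems(1) insert.hyps(2) by (auto simp: disjoint_family_on_def)
  moreover have "(\<Union>k\<in>K. A k) \<in> sets M" using insert by auto
  ultimately have "AE \<omega> in P. h \<bullet> \<nu> (A k \<union> (\<Union>k\<in>K. A k)) \<omega> = h \<bullet> \<nu> (A k) \<omega> + h \<bullet> \<nu> (\<Union>k\<in>K. A k) \<omega>"
    using insert.prems by (intro inner_noise_Un) auto
  moreover have "AE \<omega> in P. h \<bullet> \<nu> (\<Union>k\<in>K. A k) \<omega> = (\<Sum>k\<in>K. h \<bullet> \<nu> (A k) \<omega>)"
    using insert.prems by (intro insert.IH) (auto simp: disjoint_family_on_def)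
  ultimately show ?case
    by eventually_elim (use insert.hyps in simp)
qed

text \<open>
  The definition indexes disjoint sets by initial segments of the natural numbers; an enumeration of \<open>I\<close>
  transports independence to other index sets, such as products.
\<close>
lemma noise_indep:
  assumes fin: "finite I" and disj: "disjoint_family_on A I" and A: "\<And>i. i \<in> I \<Longrightarrow> A i \<in> sets M"
  shows "P.indep_vars (\<lambda>_. borel) (\<lambda>i. \<nu> (A i)) I"
proof (cases "I = {}")
  case True
  then show ?thesis by (simp add: P.indep_vars_def2 P.indep_sets_def)
next
  case False
  obtain f where f: "bij_betw f {..<card I} I"
    using ex_bij_betw_nat_finite[OF fin] by (auto simp: atLeast0LessThan)
  have "(A \<circ> f) ` {..<card I} \<subseteq> sets M" using f A by (auto simp: bij_betw_def)
  moreover have "disjoint_family_on (A \<circ> f) {..<card I}"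
    unfolding disjoint_family_on_def
  proof (intro ballI impI)
    fix m n assume "m \<in> {..<card I}" "n \<in> {..<card I}" "m \<noteq> n"
    then have "f m \<in> I" "f n \<in> I" "f m \<noteq> f n"
      using f by (auto simp: bij_betw_def inj_on_def)
    with disj show "(A \<circ> f) m \<inter> (A \<circ> f) n = {}" by (simp add: disjoint_family_on_def)
  qed
  ultimately have ind: "P.indep_vars (\<lambda>_. borel) (\<lambda>i. \<nu> (A (f i))) {..<card I}"
    using noise unfolding hilbert_white_noise_def indep_on_disjoint_def o_def by blast
  have "P.prob (\<Inter>i\<in>I. \<nu> (A i) -` B i \<inter> space P) = (\<Prod>i\<in>I. P.prob (\<nu> (A i) -` B i \<inter> space P))"
    if B: "B \<in> (\<Pi> i\<in>I. sets borel)" for B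
  proof -
    have "(\<Inter>i\<in>f ` {..<card I}. \<nu> (A i) -` B i \<inter> space P)
      = (\<Inter>k<card I. \<nu> (A (f k)) -` B (f k) \<inter> space P)"
      by (simp only: image_image)
    then have "(\<Inter>i\<in>I. \<nu> (A i) -` B i \<inter> space P) = (\<Inter>k<card I. \<nu> (A (f k)) -` B (f k) \<inter> space P)"
      by (simp only: bij_betw_imp_surj_on[OF f])
    also have "P.prob \<dots> = (\<Prod>k<card I. P.prob (\<nu> (A (f k)) -` B (f k) \<inter> space P))"
      using False fin f B by (intro P.indep_varsD_finite[OF ind]) (auto simp: bij_betw_def)
    also have "\<dots> = (\<Prod>i\<in>I. P.prob (\<nu> (A i) -` B i \<inter> space P))"
      by (rule prod.reindex_bij_betw[OF f])
    finally show ?thesis .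
  qed
  then show ?thesis
    by (subst P.indep_vars_finite[OF False fin, where E = "\<lambda>_. sets borel"])
      (auto simp: Int_stable_def sets.sigma_sets_eq[of borel, simplified] intro!: L2_space_measurable noise_L2 A)
qed

text \<open>The Wiener integral of a simple function.\<close>
definition elementary :: "('w \<Rightarrow> 'h) \<Rightarrow> 'o \<Rightarrow> real" where
  "elementary s \<omega> = (\<Sum>h\<in>s ` space M. h \<bullet> \<nu> (s -` {h} \<inter> space M) \<omega>)"

lemma elementary_L2: "simple_function M s \<Longrightarrow> elementary s \<in> L2_space P"
  unfolding elementary_def[abs_def]
  by (intro L2_space_sum inner_noise_L2) (auto dest: simple_functionD)

text \<open>
  The elementary integral can be computed on any finite partition, given by a simple function \<open>\<sigma>\<close>, on
  whose cells \<open>s\<close> is constant. Two simple functions have the common partition \<open>w \<mapsto> (s w, t w)\<close>, whence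
  linearity.
\<close>
lemma elementary_partition:
  assumes \<sigma>: "simple_function M \<sigma>" and s: "\<And>w. w \<in> space M \<Longrightarrow> s w = g (\<sigma> w)"
  shows "AE \<omega> in P. elementary s \<omega> = (\<Sum>t\<in>\<sigma> ` space M. g t \<bullet> \<nu> (\<sigma> -` {t} \<inter> space M) \<omega>)"
proof -
  let ?T = "\<sigma> ` space M"
  have fin: "finite ?T" using \<sigma> by (rule simple_functionD)
  have sT: "s ` space M = g ` ?T" using s by force
  have "AE \<omega> in P. \<forall>h\<in>g ` ?T. h \<bullet> \<nu> (s -` {h} \<inter> space M) \<omega>
    = (\<Sum>t\<in>{t\<in>?T. g t = h}. h \<bullet> \<nu> (\<sigma> -` {t} \<inter> space M) \<omega>)"
  proof (rule AE_finite_allI)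
    fix h
    have eq: "s -` {h} \<inter> space M = (\<Union>t\<in>{t\<in>?T. g t = h}. \<sigma> -` {t} \<inter> space M)"
      using s by auto
    show "AE \<omega> in P. h \<bullet> \<nu> (s -` {h} \<inter> space M) \<omega>
      = (\<Sum>t\<in>{t\<in>?T. g t = h}. h \<bullet> \<nu> (\<sigma> -` {t} \<inter> space M) \<omega>)"
      unfolding eq using fin simple_functionD(2)[OF \<sigma>]
      by (intro inner_noise_UN) (auto simp: disjoint_family_on_def)
  qed (use fin in simp)
  then show ?thesis
  proof eventually_elim
    case (elim \<omega>)
    have "elementary s \<omega> = (\<Sum>h\<in>g ` ?T. \<Sum>t\<in>{t\<in>?T. g t = h}. g t \<bullet> \<nu> (\<sigma> -` {t} \<inter> space M) \<omega>)"
      unfolding elementary_def sT using elim by (intro sum.cong) auto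
    also have "\<dots> = (\<Sum>t\<in>?T. g t \<bullet> \<nu> (\<sigma> -` {t} \<inter> space M) \<omega>)"
      by (rule sum.image_gen[OF fin, symmetric])
    finally show ?case .
  qed
qed

lemma elementary_linear:
  assumes s: "simple_function M s" and t: "simple_function M t"
  shows "AE \<omega> in P. elementary (\<lambda>w. a *\<^sub>R s w + b *\<^sub>R t w) \<omega> = a * elementary s \<omega> + b * elementary t \<omega>"
proof -
  let ?\<sigma> = "\<lambda>w. (s w, t w)"
  have \<sigma>: "simple_function M ?\<sigma>" using s t by (rule simple_function_Pair)
  note partition = elementary_partition[OF \<sigma>]
  have "AE \<omega> in P. elementary s \<omega> = (\<Sum>p\<in>?\<sigma> ` space M. fst p \<bullet> \<nu> (?\<sigma> -` {p} \<inter> space M) \<omega>)"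
    by (rule partition) simp
  moreover have "AE \<omega> in P. elementary t \<omega> = (\<Sum>p\<in>?\<sigma> ` space M. snd p \<bullet> \<nu> (?\<sigma> -` {p} \<inter> space M) \<omega>)"
    by (rule partition) simp
  moreover have "AE \<omega> in P. elementary (\<lambda>w. a *\<^sub>R s w + b *\<^sub>R t w) \<omega>
    = (\<Sum>p\<in>?\<sigma> ` space M. (a *\<^sub>R fst p + b *\<^sub>R snd p) \<bullet> \<nu> (?\<sigma> -` {p} \<inter> space M) \<omega>)"
    by (rule partition) simp
  ultimately show ?thesis
  proof eventually_elim
    case (elim \<omega>)
    show ?case
      unfolding elim by (simp only: inner_add_left sum.distrib sum_distrib_left inner_scaleR_left)
  qed
qed

lemma integral_norm_sq_simple:
  fixes s :: "'w \<Rightarrow> 'h"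
  assumes s: "simple_function M s"
  shows "(\<integral>w. (norm (s w))\<^sup>2 \<partial>M) = (\<Sum>h\<in>s ` space M. measure M (s -` {h} \<inter> space M) * (norm h)\<^sup>2)"
proof -
  have fin: "finite (s ` space M)" using s by (rule simple_functionD)
  have [measurable]: "s -` {h} \<inter> space M \<in> sets M" for h using s by (rule simple_functionD)
  have "(norm (s w))\<^sup>2 = (\<Sum>h\<in>s ` space M. indicator (s -` {h} \<inter> space M) w * (norm h)\<^sup>2)"
    if "w \<in> space M" for w
    using that fin by (subst sum.remove[of _ "s w"]) (auto intro!: sum.neutral simp: indicator_def)
  then have "(\<integral>w. (norm (s w))\<^sup>2 \<partial>M)
    = (\<integral>w. (\<Sum>h\<in>s ` space M. indicator (s -` {h} \<inter> space M) w * (norm h)\<^sup>2) \<partial>M)"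
    by (intro Bochner_Integration.integral_cong) auto
  also have "\<dots> = (\<Sum>h\<in>s ` space M. measure M (s -` {h} \<inter> space M) * (norm h)\<^sup>2)"
    by (subst Bochner_Integration.integral_sum) (auto simp: emeasure_eq_measure)
  finally show ?thesis .
qed

text \<open>
  The level sets of \<open>s\<close> are disjoint, so the integral is a sum of independent Gaussian variables and the
  variances add. The variance carries the isometry property.
\<close>
lemma elementary_gaussian:
  assumes s: "simple_function M s"
  shows "centered_gaussian P (elementary s) (\<integral>w. (norm (s w))\<^sup>2 \<partial>M)"
proof -
  have fin: "finite (s ` space M)" using s by (rule simple_functionD)
  have S: "s -` {h} \<inter> space M \<in> sets M" for h using s by (rule simple_functionD)
  have "P.indep_vars (\<lambda>_. borel) (\<lambda>h. \<nu> (s -` {h} \<inter> space M)) (s ` space M)"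
    by (rule noise_indep[OF fin]) (auto simp: disjoint_family_on_def S)
  then have "P.indep_vars (\<lambda>_. borel) (\<lambda>h \<omega>. h \<bullet> \<nu> (s -` {h} \<inter> space M) \<omega>) (s ` space M)"
    by (rule P.indep_vars_compose2) auto
  then show ?thesis
    unfolding elementary_def[abs_def] integral_norm_sq_simple[OF s]
    by (rule P.centered_gaussian_sum) (rule inner_noise_gaussian[OF S])
qed

lemma elementary_isometry:
  assumes s: "simple_function M s" and t: "simple_function M t"
  shows "(\<integral>\<omega>. (elementary s \<omega> - elementary t \<omega>)\<^sup>2 \<partial>P) = (\<integral>w. (norm (s w - t w))\<^sup>2 \<partial>M)"
proof -
  have st: "simple_function M (\<lambda>w. s w - t w)" using s t by (rule simple_function_diff)
  note [measurable] = L2_space_measurable[OF elementary_L2]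
  have "AE \<omega> in P. elementary (\<lambda>w. s w - t w) \<omega> = elementary s \<omega> - elementary t \<omega>"
    using elementary_linear[OF s t, of 1 "-1"] by simp
  then have "(\<integral>\<omega>. (elementary s \<omega> - elementary t \<omega>)\<^sup>2 \<partial>P) = (\<integral>\<omega>. (elementary (\<lambda>w. s w - t w) \<omega>)\<^sup>2 \<partial>P)"
    using s t st by (intro integral_cong_AE) auto
  also have "\<dots> = (\<integral>w. (norm (s w - t w))\<^sup>2 \<partial>M)"
    by (rule P.centered_gaussian_second_moment[OF elementary_gaussian[OF st]])
  finally show ?thesis .
qed

text \<open>
  The Wiener integral \<open>\<integral> \<langle>\<psi>, d\<nu>\<rangle>\<close>. It is an almost sure equivalence class of which a member is chosen;
  \<open>pairing_limit\<close> shows that every approximating sequence leads to it.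
\<close>
definition pairing :: "('w \<Rightarrow> 'h) \<Rightarrow> 'o \<Rightarrow> real" where
  "pairing \<psi> = (SOME Y. \<exists>s. (\<forall>n. simple_function M (s n)) \<and> L2_tendsto M s \<psi> \<and>
     L2_tendsto P (\<lambda>n. elementary (s n)) Y)"

lemma elementary_limit_unique:
  assumes s: "\<And>n. simple_function M (s n)" "L2_tendsto M s \<psi>" "L2_tendsto P (\<lambda>n. elementary (s n)) Y"
    and t: "\<And>n. simple_function M (t n)" "L2_tendsto M t \<psi>"
  shows "L2_tendsto P (\<lambda>n. elementary (t n)) Y"
proof -
  have "L2_tendsto M (\<lambda>n w. t n w - s n w) (\<lambda>w. 0)"
    using L2_tendsto_diff[OF t(2) s(2)] by simp
  from L2_tendstoD(3)[OF this]
  have "(\<lambda>n. \<integral>\<omega>. (elementary (t n) \<omega> - elementary (s n) \<omega>)\<^sup>2 \<partial>P) \<longlonglongrightarrow> 0"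
    by (simp add: elementary_isometry s(1) t(1))
  then have "L2_tendsto P (\<lambda>n \<omega>. elementary (t n) \<omega> - elementary (s n) \<omega>) (\<lambda>_. 0)"
    by (auto simp: L2_tendsto_def intro!: L2_space_diff elementary_L2 s t L2_space_zero)
  from L2_tendsto_add[OF this s(3)] show ?thesis by simp
qed

lemma pairing_limit:
  assumes t: "\<And>n. simple_function M (t n)" "L2_tendsto M t \<psi>"
  shows "L2_tendsto P (\<lambda>n. elementary (t n)) (pairing \<psi>)"
proof -
  have "\<exists>Y. L2_tendsto P (\<lambda>n. elementary (t n)) Y"
  proof (rule L2_space_complete)
    show "elementary (t n) \<in> L2_space P" for n by (rule elementary_L2[OF t(1)])
    fix e :: real assume "0 < e"
    then have "0 < e / 4" by simp
    from LIMSEQ_D[OF L2_tendstoD(3)[OF t(2)] this]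
    obtain N where N: "\<And>n. n \<ge> N \<Longrightarrow> (\<integral>w. (norm (t n w - \<psi> w))\<^sup>2 \<partial>M) < e / 4"
      by auto
    have d: "(\<lambda>w. t n w - \<psi> w) \<in> L2_space M" for n
      by (intro L2_space_diff L2_tendstoD[OF t(2)])
    have "(\<integral>\<omega>. (norm (elementary (t m) \<omega> - elementary (t n) \<omega>))\<^sup>2 \<partial>P) < e" if "m \<ge> N" "n \<ge> N" for m n
    proof -
      have "(\<integral>\<omega>. (norm (elementary (t m) \<omega> - elementary (t n) \<omega>))\<^sup>2 \<partial>P) = (\<integral>w. (norm (t m w - t n w))\<^sup>2 \<partial>M)"
        by (simp add: elementary_isometry t(1))
      also have "\<dots> \<le> (\<integral>w. 2 * (norm (t m w - \<psi> w))\<^sup>2 + 2 * (norm (t n w - \<psi> w))\<^sup>2 \<partial>M)"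
      proof (rule integral_mono)
        show "integrable M (\<lambda>w. (norm (t m w - t n w))\<^sup>2)"
          by (intro L2_space_integrable L2_space_diff L2_tendstoD[OF t(2)])
        show "integrable M (\<lambda>w. 2 * (norm (t m w - \<psi> w))\<^sup>2 + 2 * (norm (t n w - \<psi> w))\<^sup>2)"
          using L2_space_integrable[OF d] by simp
        show "(norm (t m w - t n w))\<^sup>2 \<le> 2 * (norm (t m w - \<psi> w))\<^sup>2 + 2 * (norm (t n w - \<psi> w))\<^sup>2" for w
          using norm_add_sq_le[of "t m w - \<psi> w" "\<psi> w - t n w"] by (simp add: norm_minus_commute)
      qed
      also have "\<dots> < e"
        using N[OF that(1)] N[OF that(2)] L2_space_integrable[OF d] by simp
      finally show ?thesis .
    qed
    then show "\<exists>N. \<forall>m\<ge>N. \<forall>n\<ge>N. (\<integral>\<omega>. (norm (elementary (t m) \<omega> - elementary (t n) \<omega>))\<^sup>2 \<partial>P) < e"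
      by blast
  qed
  then have "\<exists>Y s. (\<forall>n. simple_function M (s n)) \<and> L2_tendsto M s \<psi> \<and>
     L2_tendsto P (\<lambda>n. elementary (s n)) Y"
    using t by blast
  from someI_ex[OF this] obtain s where
    "\<forall>n. simple_function M (s n)" "L2_tendsto M s \<psi>" "L2_tendsto P (\<lambda>n. elementary (s n)) (pairing \<psi>)"
    unfolding pairing_def[symmetric] by blast
  then show ?thesis by (intro elementary_limit_unique[OF _ _ _ t]) auto
qed

lemma pairing_L2: "\<psi> \<in> L2_space M \<Longrightarrow> pairing \<psi> \<in> L2_space P"
  by (metis L2_space_simple_approx L2_tendstoD(2) pairing_limit)

lemma pairing_measurable: "\<psi> \<in> L2_space M \<Longrightarrow> pairing \<psi> \<in> borel_measurable P"
  by (rule L2_space_measurable[OF pairing_L2])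

lemma pairing_gaussian:
  assumes "\<psi> \<in> L2_space M"
  shows "centered_gaussian P (pairing \<psi>) (\<integral>w. (norm (\<psi> w))\<^sup>2 \<partial>M)"
proof -
  obtain s where s: "\<And>n. simple_function M (s n)" "L2_tendsto M s \<psi>"
    using L2_space_simple_approx[OF assms] by blast
  show ?thesis
    by (rule P.centered_gaussian_L2_limit[OF pairing_limit[OF s]])
      (auto intro: elementary_gaussian s L2_tendsto_integral_norm_sq)
qed

lemma pairing_second_moment:
  "\<psi> \<in> L2_space M \<Longrightarrow> (\<integral>\<omega>. (pairing \<psi> \<omega>)\<^sup>2 \<partial>P) = (\<integral>w. (norm (\<psi> w))\<^sup>2 \<partial>M)"
  by (rule P.centered_gaussian_second_moment[OF pairing_gaussian])

lemma pairing_cong_AE: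
  assumes \<psi>: "\<psi> \<in> L2_space M" and \<psi>': "\<psi>' \<in> L2_space M" and eq: "AE w in M. \<psi> w = \<psi>' w"
  shows "AE \<omega> in P. pairing \<psi> \<omega> = pairing \<psi>' \<omega>"
proof -
  obtain s where s: "\<And>n. simple_function M (s n)" "L2_tendsto M s \<psi>"
    using L2_space_simple_approx[OF \<psi>] by blast
  have "L2_tendsto M s \<psi>'"
    by (rule L2_tendsto_cong_AE[OF s(2)])
      (use s(1) eq \<psi>' in \<open>auto intro: borel_measurable_simple_function L2_space_measurable\<close>)
  from L2_tendsto_unique[OF pairing_limit[OF s] pairing_limit[OF s(1) this]] show ?thesis .
qed

lemma pairing_linear:
  assumes \<phi>: "\<phi> \<in> L2_space M" and \<psi>: "\<psi> \<in> L2_space M"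
  shows "AE \<omega> in P. pairing (\<lambda>w. a *\<^sub>R \<phi> w + b *\<^sub>R \<psi> w) \<omega> = a * pairing \<phi> \<omega> + b * pairing \<psi> \<omega>"
proof -
  obtain s where s: "\<And>n. simple_function M (s n)" "L2_tendsto M s \<phi>"
    using L2_space_simple_approx[OF \<phi>] by blast
  obtain t where t: "\<And>n. simple_function M (t n)" "L2_tendsto M t \<psi>"
    using L2_space_simple_approx[OF \<psi>] by blast
  have simple: "simple_function M (\<lambda>w. a *\<^sub>R s n w + b *\<^sub>R t n w)" for n
    using simple_function_compose2[OF s(1) t(1), of "\<lambda>x y. a *\<^sub>R x + b *\<^sub>R y"] by simp
  have lim1: "L2_tendsto P (\<lambda>n \<omega>. a * elementary (s n) \<omega> + b * elementary (t n) \<omega>)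
    (\<lambda>\<omega>. a * pairing \<phi> \<omega> + b * pairing \<psi> \<omega>)"
    using L2_tendsto_add[OF L2_tendsto_scaleR[OF pairing_limit[OF s]] L2_tendsto_scaleR[OF pairing_limit[OF t]], of a b]
    by simp
  have lim2: "L2_tendsto P (\<lambda>n \<omega>. a * elementary (s n) \<omega> + b * elementary (t n) \<omega>)
    (pairing (\<lambda>w. a *\<^sub>R \<phi> w + b *\<^sub>R \<psi> w))"
  proof (rule L2_tendsto_cong_AE)
    have lim: "L2_tendsto M (\<lambda>n w. a *\<^sub>R s n w + b *\<^sub>R t n w) (\<lambda>w. a *\<^sub>R \<phi> w + b *\<^sub>R \<psi> w)"
      by (intro L2_tendsto_add L2_tendsto_scaleR s t)
    show "L2_tendsto P (\<lambda>n. elementary (\<lambda>w. a *\<^sub>R s n w + b *\<^sub>R t n w))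
      (pairing (\<lambda>w. a *\<^sub>R \<phi> w + b *\<^sub>R \<psi> w))"
      by (rule pairing_limit[OF simple lim])
    show "pairing (\<lambda>w. a *\<^sub>R \<phi> w + b *\<^sub>R \<psi> w) \<in> borel_measurable P"
      by (rule pairing_measurable[OF L2_tendstoD(2)[OF lim]])
    show "AE \<omega> in P. elementary (\<lambda>w. a *\<^sub>R s n w + b *\<^sub>R t n w) \<omega>
      = a * elementary (s n) \<omega> + b * elementary (t n) \<omega>" for n
      by (rule elementary_linear[OF s(1) t(1)])
    show "(\<lambda>\<omega>. a * elementary (s n) \<omega> + b * elementary (t n) \<omega>) \<in> borel_measurable P" for n
      using L2_space_measurable[OF elementary_L2[OF s(1)]] L2_space_measurable[OF elementary_L2[OF t(1)]]
      by (intro borel_measurable_add borel_measurable_times) auto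
  qed simp
  show ?thesis by (rule L2_tendsto_unique[OF lim2 lim1])
qed

lemma pairing_zero: "AE \<omega> in P. pairing (\<lambda>_. 0) \<omega> = 0"
  using pairing_linear[OF L2_space_zero L2_space_zero, of 0 0] by simp

lemma pairing_sum:
  assumes "\<And>i. i \<in> I \<Longrightarrow> \<psi> i \<in> L2_space M"
  shows "AE \<omega> in P. pairing (\<lambda>w. \<Sum>i\<in>I. \<psi> i w) \<omega> = (\<Sum>i\<in>I. pairing (\<psi> i) \<omega>)"
  using assms
proof (induction I rule: infinite_finite_induct)
  case (insert i I)
  have "(\<lambda>w. \<Sum>i\<in>I. \<psi> i w) \<in> L2_space M" using insert.prems by (intro L2_space_sum) auto
  with pairing_linear[of "\<psi> i" "\<lambda>w. \<Sum>i\<in>I. \<psi> i w" 1 1] insert.prems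
  have "AE \<omega> in P. pairing (\<lambda>w. \<psi> i w + (\<Sum>i\<in>I. \<psi> i w)) \<omega>
    = pairing (\<psi> i) \<omega> + pairing (\<lambda>w. \<Sum>i\<in>I. \<psi> i w) \<omega>" by simp
  moreover have "AE \<omega> in P. pairing (\<lambda>w. \<Sum>i\<in>I. \<psi> i w) \<omega> = (\<Sum>i\<in>I. pairing (\<psi> i) \<omega>)"
    using insert by auto
  ultimately show ?case by eventually_elim (use insert.hyps in simp)
qed (use pairing_zero in simp_all)

lemma pairing_tendsto:
  assumes "L2_tendsto M f g"
  shows "L2_tendsto P (\<lambda>n. pairing (f n)) (pairing g)"
proof -
  have fg: "f n \<in> L2_space M" "g \<in> L2_space M" for n using L2_tendstoD[OF assms] by auto
  have "(\<integral>\<omega>. (norm (pairing (f n) \<omega> - pairing g \<omega>))\<^sup>2 \<partial>P) = (\<integral>w. (norm (f n w - g w))\<^sup>2 \<partial>M)" for n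
  proof -
    have d: "(\<lambda>w. f n w - g w) \<in> L2_space M" by (intro L2_space_diff fg)
    note [measurable] = pairing_measurable[OF fg(1)[of n]] pairing_measurable[OF fg(2)] pairing_measurable[OF d]
    have "(\<integral>\<omega>. (norm (pairing (f n) \<omega> - pairing g \<omega>))\<^sup>2 \<partial>P) = (\<integral>\<omega>. (pairing (\<lambda>w. f n w - g w) \<omega>)\<^sup>2 \<partial>P)"
      using pairing_linear[OF fg(1)[of n] fg(2), of 1 "-1"] by (intro integral_cong_AE) auto
    then show ?thesis by (simp add: pairing_second_moment[OF d])
  qed
  then show ?thesis
    using L2_tendstoD(3)[OF assms] by (simp add: L2_tendsto_def pairing_L2 fg)
qed

text \<open>The isometry property for scalar products, by polarization.\<close>
lemma pairing_inner:
  assumes \<phi>: "\<phi> \<in> L2_space M" and \<psi>: "\<psi> \<in> L2_space M"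
  shows "(\<integral>\<omega>. pairing \<phi> \<omega> * pairing \<psi> \<omega> \<partial>P) = (\<integral>w. \<phi> w \<bullet> \<psi> w \<partial>M)"
proof -
  have s: "(\<lambda>w. \<phi> w + \<psi> w) \<in> L2_space M" by (rule L2_space_add[OF assms])
  note [measurable] = pairing_measurable[OF \<phi>] pairing_measurable[OF \<psi>] pairing_measurable[OF s]
  have sq: "(norm (x + y))\<^sup>2 = (norm x)\<^sup>2 + (norm y)\<^sup>2 + 2 * (x \<bullet> y)" for x y :: "'c::real_inner"
    by (simp add: power2_norm_eq_inner inner_add_left inner_add_right inner_commute)
  have iP: "integrable P (\<lambda>\<omega>. (pairing \<phi> \<omega>)\<^sup>2)" "integrable P (\<lambda>\<omega>. (pairing \<psi> \<omega>)\<^sup>2)"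
    "integrable P (\<lambda>\<omega>. pairing \<phi> \<omega> * pairing \<psi> \<omega>)"
    using L2_space_integrable[OF pairing_L2[OF \<phi>]] L2_space_integrable[OF pairing_L2[OF \<psi>]]
      L2_space_inner[OF pairing_L2[OF \<phi>] pairing_L2[OF \<psi>]] by simp_all
  have "(\<integral>\<omega>. (pairing (\<lambda>w. \<phi> w + \<psi> w) \<omega>)\<^sup>2 \<partial>P) = (\<integral>\<omega>. (pairing \<phi> \<omega> + pairing \<psi> \<omega>)\<^sup>2 \<partial>P)"
    using pairing_linear[OF \<phi> \<psi>, of 1 1] by (intro integral_cong_AE) auto
  also have "\<dots> = (\<integral>\<omega>. (pairing \<phi> \<omega>)\<^sup>2 + (pairing \<psi> \<omega>)\<^sup>2 + 2 * (pairing \<phi> \<omega> * pairing \<psi> \<omega>) \<partial>P)"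
    by (simp add: power2_sum mult.assoc)
  also have "\<dots> = (\<integral>w. (norm (\<phi> w))\<^sup>2 \<partial>M) + (\<integral>w. (norm (\<psi> w))\<^sup>2 \<partial>M) + 2 * (\<integral>\<omega>. pairing \<phi> \<omega> * pairing \<psi> \<omega> \<partial>P)"
    using iP by (simp add: pairing_second_moment \<phi> \<psi>)
  finally have "(\<integral>w. (norm (\<phi> w + \<psi> w))\<^sup>2 \<partial>M)
    = (\<integral>w. (norm (\<phi> w))\<^sup>2 \<partial>M) + (\<integral>w. (norm (\<psi> w))\<^sup>2 \<partial>M) + 2 * (\<integral>\<omega>. pairing \<phi> \<omega> * pairing \<psi> \<omega> \<partial>P)"
    by (simp add: pairing_second_moment s)
  moreover have "(\<integral>w. (norm (\<phi> w + \<psi> w))\<^sup>2 \<partial>M)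
    = (\<integral>w. (norm (\<phi> w))\<^sup>2 \<partial>M) + (\<integral>w. (norm (\<psi> w))\<^sup>2 \<partial>M) + 2 * (\<integral>w. \<phi> w \<bullet> \<psi> w \<partial>M)"
    unfolding sq
    using L2_space_integrable[OF \<phi>] L2_space_integrable[OF \<psi>] L2_space_inner[OF \<phi> \<psi>] by simp
  ultimately show ?thesis by simp
qed

lemma pairing_indicator:
  assumes A: "A \<in> sets M"
  shows "AE \<omega> in P. pairing (\<lambda>w. indicator A w *\<^sub>R h) \<omega> = h \<bullet> \<nu> A \<omega>"
proof -
  \<comment> \<open>The partition into \<open>A\<close> and its complement; one of the two cells may be empty.\<close>
  let ?s = "\<lambda>w. indicator A w *\<^sub>R h" and ?\<sigma> = "\<lambda>w. w \<in> A"
  have \<sigma>: "simple_function M ?\<sigma>"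
  proof -
    have "?\<sigma> -` {b} \<inter> space M = (if b then A else space M - A)" for b
      using sets.sets_into_space[OF A] by auto
    then show ?thesis using A by (simp add: simple_function_def)
  qed
  have s: "simple_function M ?s"
    using simple_function_compose1[OF \<sigma>, of "\<lambda>b. if b then h else 0"]
    by (rule simple_function_cong[THEN iffD1, rotated]) (auto simp: indicator_def)
  have "AE \<omega> in P. elementary ?s \<omega>
    = (\<Sum>b\<in>?\<sigma> ` space M. (if b then h else 0) \<bullet> \<nu> (?\<sigma> -` {b} \<inter> space M) \<omega>)"
    by (rule elementary_partition[OF \<sigma>]) (simp add: indicator_def)
  moreover have "AE \<omega> in P. pairing ?s \<omega> = elementary ?s \<omega>"
    using L2_tendsto_unique[OF pairing_limit[of "\<lambda>_. ?s"] L2_tendsto_const[OF elementary_L2[OF s]]]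
      L2_tendsto_const[OF simple_function_L2[OF s]] s by simp
  ultimately show ?thesis
    using inner_noise_empty[of h]
  proof eventually_elim
    case (elim \<omega>)
    have A': "?\<sigma> -` {True} \<inter> space M = A" using sets.sets_into_space[OF A] by auto
    have "(\<Sum>b\<in>?\<sigma> ` space M. (if b then h else 0) \<bullet> \<nu> (?\<sigma> -` {b} \<inter> space M) \<omega>) = h \<bullet> \<nu> A \<omega>"
    proof (cases "True \<in> ?\<sigma> ` space M")
      case True
      then show ?thesis
        using A' by (subst sum.remove[of _ True]) (auto intro!: sum.neutral finite_subset[OF subset_UNIV])
    next
      case False
      then have "A = {}" using sets.sets_into_space[OF A] by auto
      then show ?thesis using elim by (intro trans[OF sum.neutral]) auto
    qed
    then show ?case using elim by simp
  qed
qed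

text \<open>
  Integrals over disjoint sets are independent, jointly for finitely many integrands \<open>\<psi> j\<close>. For simple
  functions \<open>s j\<close>, the function \<open>w \<mapsto> (s j w)\<^sub>j\<close> takes finitely many values \<open>t\<close>, and the integrals over
  \<open>A i\<close> are functions of the variables \<open>\<nu> ({s = t} \<inter> A i)\<close>. These are independent for all pairs \<open>(i, t)\<close>,
  and blocks of independent variables are independent. The general case is a limit.
\<close>
lemma pairing_indep:
  fixes \<psi> :: "'d::finite \<Rightarrow> 'w \<Rightarrow> 'h"
  assumes fin: "finite I" and disj: "disjoint_family_on A I" and A: "\<And>i. i \<in> I \<Longrightarrow> A i \<in> sets M"
    and \<psi>: "\<And>j. \<psi> j \<in> L2_space M"
  shows "P.indep_vars (\<lambda>_. borel)
    (\<lambda>i \<omega>. (\<chi> j. pairing (\<lambda>w. indicator (A i) w *\<^sub>R \<psi> j w) \<omega>) :: real^'d) I"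
proof -
  have "\<forall>j. \<exists>s. (\<forall>n. simple_function M (s n)) \<and> L2_tendsto M s (\<psi> j)"
    using L2_space_simple_approx[OF \<psi>] by metis
  then obtain s where s: "\<And>j n. simple_function M (s j n)" "\<And>j. L2_tendsto M (s j) (\<psi> j)"
    by metis
  define \<sigma> where "\<sigma> n w = (\<lambda>j. s j n w)" for n w
  define T where "T n = \<sigma> n ` space M" for n
  define B where "B n p = \<sigma> n -` {snd p} \<inter> space M \<inter> A (fst p)" for n p
  have finT: "finite (T n)" for n
  proof (rule finite_subset)
    show "T n \<subseteq> (\<Pi>\<^sub>E j\<in>UNIV. s j n ` space M)" by (auto simp: T_def \<sigma>_def)
    show "finite (\<Pi>\<^sub>E j\<in>UNIV. s j n ` space M)"
      by (intro finite_PiE) (auto intro: simple_functionD s)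
  qed
  have B: "B n p \<in> sets M" if "fst p \<in> I" for n p
  proof -
    have "B n p = (\<Inter>j. s j n -` {snd p j} \<inter> space M) \<inter> A (fst p)"
      by (auto simp: B_def \<sigma>_def fun_eq_iff)
    moreover have "(\<Inter>j. s j n -` {snd p j} \<inter> space M) \<in> sets M"
      by (intro sets.finite_INT simple_functionD(2)[OF s(1)]) auto
    ultimately show ?thesis
      using A[OF that] by (simp only: sets.Int)
  qed
  define Z where "Z n i \<omega> = ((\<chi> j. \<Sum>t\<in>T n. t j \<bullet> \<nu> (B n (i, t)) \<omega>) :: real^'d)" for n i \<omega>
  show ?thesis
  proof (rule P.indep_vars_L2_limit[OF fin, where Z = Z])
    fix n
    have "P.indep_vars (\<lambda>_. borel) (\<lambda>p. \<nu> (B n p)) (I \<times> T n)"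
    proof (rule noise_indep)
      show "disjoint_family_on (B n) (I \<times> T n)"
        using disj by (auto simp: disjoint_family_on_def B_def)
    qed (auto intro: fin finT B)
    then have "P.indep_vars (\<lambda>i. PiM ({i} \<times> T n) (\<lambda>_. borel))
      (\<lambda>i \<omega>. restrict (\<lambda>p. \<nu> (B n p) \<omega>) ({i} \<times> T n)) I"
      by (rule P.indep_vars_restrict) (auto simp: disjoint_family_on_def)
    then have "P.indep_vars (\<lambda>_. borel)
      (\<lambda>i \<omega>. (\<lambda>f. (\<chi> j. \<Sum>t\<in>T n. t j \<bullet> f (i, t)) :: real^'d) (restrict (\<lambda>p. \<nu> (B n p) \<omega>) ({i} \<times> T n))) I"
    proof (rule P.indep_vars_compose2)
      fix i
      have [measurable]: "(\<lambda>f. f (i, t)) \<in> borel_measurable (PiM ({i} \<times> T n) (\<lambda>_. borel))" if "t \<in> T n" for t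
        using that by (intro measurable_component_singleton) auto
      show "(\<lambda>f. (\<chi> j. \<Sum>t\<in>T n. t j \<bullet> f (i, t)) :: real^'d) \<in> borel_measurable (PiM ({i} \<times> T n) (\<lambda>_. borel))"
        by (rule borel_measurable_vecI) simp
    qed
    then show "P.indep_vars (\<lambda>_. borel) (Z n) I"
      by (rule P.indep_vars_cong[THEN iffD1, rotated -1]) (auto simp: Z_def fun_eq_iff intro!: sum.cong)
  next
    fix i assume i: "i \<in> I"
    show "L2_tendsto P (\<lambda>n. Z n i) (\<lambda>\<omega>. \<chi> j. pairing (\<lambda>w. indicator (A i) w *\<^sub>R \<psi> j w) \<omega>)"
    proof (rule L2_tendsto_vec)
      fix j
      have ind: "(\<lambda>w. indicator (A i) w *\<^sub>R f w) \<in> L2_space M" if "f \<in> L2_space M" for f :: "'w \<Rightarrow> 'h"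
        using that A[OF i] by (rule L2_space_indicator)
      have "L2_tendsto M (\<lambda>n w. indicator (A i) w *\<^sub>R s j n w) (\<lambda>w. indicator (A i) w *\<^sub>R \<psi> j w)"
        by (rule L2_tendsto_indicator[OF s(2) A[OF i]])
      from pairing_tendsto[OF this]
      have "L2_tendsto P (\<lambda>n. pairing (\<lambda>w. indicator (A i) w *\<^sub>R s j n w))
        (pairing (\<lambda>w. indicator (A i) w *\<^sub>R \<psi> j w))" .
      then have "L2_tendsto P (\<lambda>n \<omega>. \<Sum>t\<in>T n. t j \<bullet> \<nu> (B n (i, t)) \<omega>)
        (pairing (\<lambda>w. indicator (A i) w *\<^sub>R \<psi> j w))"
      proof (rule L2_tendsto_cong_AE)
        fix n
        have L: "(\<lambda>w. indicator (B n (i, t)) w *\<^sub>R t j) \<in> L2_space M" for t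
          by (intro L2_space_indicator L2_space_const B) (simp add: i)
        have eq: "indicator (A i) w *\<^sub>R s j n w = (\<Sum>t\<in>T n. indicator (B n (i, t)) w *\<^sub>R t j)"
          if "w \<in> space M" for w
          using that finT[of n]
          by (subst sum.remove[of _ "\<sigma> n w"]) (auto intro!: sum.neutral simp: T_def B_def \<sigma>_def indicator_def)
        have "AE \<omega> in P. pairing (\<lambda>w. indicator (A i) w *\<^sub>R s j n w) \<omega>
          = pairing (\<lambda>w. \<Sum>t\<in>T n. indicator (B n (i, t)) w *\<^sub>R t j) \<omega>"
          by (intro pairing_cong_AE ind L2_tendstoD(1)[OF s(2)] L2_space_sum L) (auto simp: eq)
        moreover have "AE \<omega> in P. pairing (\<lambda>w. \<Sum>t\<in>T n. indicator (B n (i, t)) w *\<^sub>R t j) \<omega>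
          = (\<Sum>t\<in>T n. pairing (\<lambda>w. indicator (B n (i, t)) w *\<^sub>R t j) \<omega>)"
          by (rule pairing_sum[OF L])
        moreover have "AE \<omega> in P. \<forall>t\<in>T n. pairing (\<lambda>w. indicator (B n (i, t)) w *\<^sub>R t j) \<omega> = t j \<bullet> \<nu> (B n (i, t)) \<omega>"
          using i by (intro AE_finite_allI finT pairing_indicator B) auto
        ultimately show "AE \<omega> in P. pairing (\<lambda>w. indicator (A i) w *\<^sub>R s j n w) \<omega>
          = (\<Sum>t\<in>T n. t j \<bullet> \<nu> (B n (i, t)) \<omega>)"
          by eventually_elim (auto intro: sum.cong)
        show "(\<lambda>\<omega>. \<Sum>t\<in>T n. t j \<bullet> \<nu> (B n (i, t)) \<omega>) \<in> borel_measurable P"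
          using i by (intro borel_measurable_sum inner_noise_measurable B) auto
      qed (auto intro!: pairing_measurable ind \<psi>)
      then show "L2_tendsto P (\<lambda>n \<omega>. Z n i \<omega> $ j)
        (\<lambda>\<omega>. (\<chi> j. pairing (\<lambda>w. indicator (A i) w *\<^sub>R \<psi> j w) \<omega>) $ j)"
        by (simp add: Z_def)
    qed
  qed
qed

end

section \<open>Scalar and vector noises with a density, and their images\<close>

context hilbert_noise
begin

lemma pairing_scale: "\<phi> \<in> L2_space M \<Longrightarrow> AE \<omega> in P. pairing (\<lambda>w. a *\<^sub>R \<phi> w) \<omega> = a * pairing \<phi> \<omega>"
  using pairing_linear[of \<phi> \<phi> a 0] by simp

text \<open>
  The noise \<open>\<eta>\<close> on \<open>E\<close> is the image by \<open>Y\<close> of \<open>(\<psi>, \<nu>)\<close>. The integrability of \<open>\<eta> A\<close> is part of the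
  definition because the noises of interest arise from arbitrary choices of representatives.
\<close>
definition represents ::
    "'e measure \<Rightarrow> ('w \<Rightarrow> 'e) \<Rightarrow> ('w \<Rightarrow> 'h) \<Rightarrow> ('e set \<Rightarrow> 'o \<Rightarrow> real) \<Rightarrow> bool" where
  "represents E Y \<psi> \<eta> \<longleftrightarrow> (\<forall>A\<in>sets E. \<eta> A \<in> L2_space P \<and>
     (AE \<omega> in P. \<eta> A \<omega> = pairing (\<lambda>w. indicator (Y -` A \<inter> space M) w *\<^sub>R \<psi> w) \<omega>))"

text \<open>The measure associated with the noises represented by \<open>\<psi>\<close> and \<open>Y\<close>, see \<open>wn_measure_represents\<close>.\<close>
abbreviation image_density :: "'e measure \<Rightarrow> ('w \<Rightarrow> 'e) \<Rightarrow> ('w \<Rightarrow> 'h) \<Rightarrow> 'e measure" where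
  "image_density E Y \<psi> \<equiv> distr (density M (\<lambda>w. ennreal ((norm (\<psi> w))\<^sup>2))) E Y"

text \<open>
  The map \<open>g \<mapsto> g(Y) \<psi>\<close> is an isometry from the square integrable functions of \<open>image_density E Y \<psi>\<close>
  into \<open>L\<^sup>2(m; H)\<close>.
\<close>
lemma image_density_L2:
  fixes g :: "'e \<Rightarrow> real"
  assumes [measurable]: "Y \<in> measurable M E" and \<psi>[measurable]: "\<psi> \<in> L2_space M"
    and g[measurable]: "g \<in> L2_space (image_density E Y \<psi>)"
  shows "(\<lambda>w. g (Y w) *\<^sub>R \<psi> w) \<in> L2_space M"
    and "(\<integral>w. (norm (g (Y w) *\<^sub>R \<psi> w))\<^sup>2 \<partial>M) = (\<integral>x. (norm (g x))\<^sup>2 \<partial>image_density E Y \<psi>)"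
proof -
  have [measurable]: "g \<in> borel_measurable E" using L2_space_measurable[OF g] by simp
  have eq: "(norm (g (Y w) *\<^sub>R \<psi> w))\<^sup>2 = (norm (\<psi> w))\<^sup>2 *\<^sub>R (norm (g (Y w)))\<^sup>2" for w
    by (simp add: power_mult_distrib)
  have "integrable M (\<lambda>w. (norm (\<psi> w))\<^sup>2 *\<^sub>R (norm (g (Y w)))\<^sup>2)"
    using L2_space_integrable[OF g]
    by (subst (asm) integrable_distr_eq) (auto simp: integrable_density)
  then show "(\<lambda>w. g (Y w) *\<^sub>R \<psi> w) \<in> L2_space M"
    unfolding eq[symmetric] by (intro L2_spaceI) measurable
  show "(\<integral>w. (norm (g (Y w) *\<^sub>R \<psi> w))\<^sup>2 \<partial>M) = (\<integral>x. (norm (g x))\<^sup>2 \<partial>image_density E Y \<psi>)"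
    unfolding eq by (subst integral_distr) (auto simp: integral_density)
qed

lemma wn_simple_integral_eq_pairing:
  assumes Y[measurable]: "Y \<in> measurable M E" and \<psi>: "\<psi> \<in> L2_space M"
    and \<eta>: "represents E Y \<psi> \<eta>" and s: "simple_function (image_density E Y \<psi>) s"
  shows "wn_simple_integral (image_density E Y \<psi>) \<eta> s \<in> L2_space P"
    and "AE \<omega> in P. wn_simple_integral (image_density E Y \<psi>) \<eta> s \<omega> = pairing (\<lambda>w. s (Y w) *\<^sub>R \<psi> w) \<omega>"
proof -
  define B where "B y = s -` {y} \<inter> space E" for y
  define C where "C y = Y -` B y \<inter> space M" for y
  have fin: "finite (s ` space E)" using simple_functionD(1)[OF s] by simp
  have B: "B y \<in> sets E" for y using simple_functionD(2)[OF s, of "{y}"] by (simp add: B_def)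
  have C: "C y \<in> sets M" for y using measurable_sets[OF Y B] by (simp add: C_def)
  have I: "wn_simple_integral (image_density E Y \<psi>) \<eta> s = (\<lambda>\<omega>. \<Sum>y\<in>s ` space E. y * \<eta> (B y) \<omega>)"
    by (auto simp: wn_simple_integral_def B_def)
  have \<eta>L2: "\<eta> (B y) \<in> L2_space P" for y using \<eta> B by (simp add: represents_def)
  show L2: "wn_simple_integral (image_density E Y \<psi>) \<eta> s \<in> L2_space P"
    unfolding I using L2_space_scaleR[OF \<eta>L2] by (intro L2_space_sum) simp
  have ind: "(\<lambda>w. indicator (C y) w *\<^sub>R \<psi> w) \<in> L2_space M" for y
    by (rule L2_space_indicator[OF \<psi> C])
  have eq: "s (Y w) *\<^sub>R \<psi> w = (\<Sum>y\<in>s ` space E. y *\<^sub>R (indicator (C y) w *\<^sub>R \<psi> w))" if w: "w \<in> space M" for w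
    using measurable_space[OF Y w] w fin
    by (subst sum.remove[of _ "s (Y w)"]) (auto intro!: sum.neutral simp: B_def C_def indicator_def)
  have L: "(\<lambda>w. \<Sum>y\<in>s ` space E. y *\<^sub>R (indicator (C y) w *\<^sub>R \<psi> w)) \<in> L2_space M"
    by (intro L2_space_sum L2_space_scaleR ind)
  have sY: "(\<lambda>w. s (Y w) *\<^sub>R \<psi> w) \<in> borel_measurable M"
    using L2_space_measurable[OF L] by (rule measurable_cong[THEN iffD1, rotated]) (simp add: eq)
  have "AE \<omega> in P. pairing (\<lambda>w. s (Y w) *\<^sub>R \<psi> w) \<omega>
    = pairing (\<lambda>w. \<Sum>y\<in>s ` space E. y *\<^sub>R (indicator (C y) w *\<^sub>R \<psi> w)) \<omega>"
    by (intro pairing_cong_AE L L2_space_cong_AE[OF L sY]) (auto simp: eq)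
  moreover have "AE \<omega> in P. pairing (\<lambda>w. \<Sum>y\<in>s ` space E. y *\<^sub>R (indicator (C y) w *\<^sub>R \<psi> w)) \<omega>
    = (\<Sum>y\<in>s ` space E. pairing (\<lambda>w. y *\<^sub>R (indicator (C y) w *\<^sub>R \<psi> w)) \<omega>)"
    by (intro pairing_sum L2_space_scaleR ind)
  moreover have "AE \<omega> in P. \<forall>y\<in>s ` space E. pairing (\<lambda>w. y *\<^sub>R (indicator (C y) w *\<^sub>R \<psi> w)) \<omega>
    = y * pairing (\<lambda>w. indicator (C y) w *\<^sub>R \<psi> w) \<omega>"
    by (intro AE_finite_allI fin pairing_scale ind)
  moreover have "AE \<omega> in P. \<forall>y\<in>s ` space E. \<eta> (B y) \<omega> = pairing (\<lambda>w. indicator (C y) w *\<^sub>R \<psi> w) \<omega>"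
    using \<eta> B by (intro AE_finite_allI fin) (auto simp: represents_def C_def)
  ultimately show "AE \<omega> in P. wn_simple_integral (image_density E Y \<psi>) \<eta> s \<omega> = pairing (\<lambda>w. s (Y w) *\<^sub>R \<psi> w) \<omega>"
    unfolding I by eventually_elim (auto intro!: sum.cong)
qed

text \<open>
  Both sides agree on simple functions by linearity of \<open>pairing\<close>, and both are isometric. As the integral
  is defined by a choice among limits, the proof shows that the right side is the limit along every
  approximating sequence.
\<close>
lemma wn_integral_eq_pairing:
  assumes Y: "Y \<in> measurable M E" and \<psi>: "\<psi> \<in> L2_space M"
    and \<eta>: "represents E Y \<psi> \<eta>" and f: "f \<in> L2_space (image_density E Y \<psi>)"
  shows "wn_integral (image_density E Y \<psi>) P \<eta> f \<in> L2_space P"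
    and "AE \<omega> in P. wn_integral (image_density E Y \<psi>) P \<eta> f \<omega> = pairing (\<lambda>w. f (Y w) *\<^sub>R \<psi> w) \<omega>"
proof -
  let ?\<mu> = "image_density E Y \<psi>"
  have fY: "(\<lambda>w. f (Y w) *\<^sub>R \<psi> w) \<in> L2_space M" by (rule image_density_L2(1)[OF Y \<psi> f])
  have lim: "L2_tendsto P (\<lambda>n. wn_simple_integral ?\<mu> \<eta> (s n)) (pairing (\<lambda>w. f (Y w) *\<^sub>R \<psi> w))"
    if s: "\<And>n. simple_function ?\<mu> (s n)" "L2_tendsto ?\<mu> s f" for s
  proof (rule L2_tendsto_cong_AE)
    have d: "(\<lambda>x. s n x - f x) \<in> L2_space ?\<mu>" for n
      by (intro L2_space_diff L2_tendstoD[OF s(2)])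
    have sY: "(\<lambda>w. s n (Y w) *\<^sub>R \<psi> w) \<in> L2_space M" for n
      by (rule image_density_L2(1)[OF Y \<psi> L2_tendstoD(1)[OF s(2)]])
    have "(\<integral>w. (norm (s n (Y w) *\<^sub>R \<psi> w - f (Y w) *\<^sub>R \<psi> w))\<^sup>2 \<partial>M) = (\<integral>x. (norm (s n x - f x))\<^sup>2 \<partial>?\<mu>)" for n
      unfolding image_density_L2(2)[OF Y \<psi> d, symmetric] scaleR_diff_left ..
    then have "L2_tendsto M (\<lambda>n w. s n (Y w) *\<^sub>R \<psi> w) (\<lambda>w. f (Y w) *\<^sub>R \<psi> w)"
      using L2_tendstoD(3)[OF s(2)] sY fY by (simp add: L2_tendsto_def)
    then show "L2_tendsto P (\<lambda>n. pairing (\<lambda>w. s n (Y w) *\<^sub>R \<psi> w)) (pairing (\<lambda>w. f (Y w) *\<^sub>R \<psi> w))"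
      by (rule pairing_tendsto)
    show "AE \<omega> in P. pairing (\<lambda>w. s n (Y w) *\<^sub>R \<psi> w) \<omega> = wn_simple_integral ?\<mu> \<eta> (s n) \<omega>" for n
      using wn_simple_integral_eq_pairing(2)[OF Y \<psi> \<eta> s(1)[of n]] by eventually_elim simp
    show "wn_simple_integral ?\<mu> \<eta> (s n) \<in> borel_measurable P" for n
      by (rule L2_space_measurable[OF wn_simple_integral_eq_pairing(1)[OF Y \<psi> \<eta> s(1)]])
  qed (auto intro: pairing_measurable fY)
  obtain s where s: "\<And>n. simple_function ?\<mu> (s n)" "L2_tendsto ?\<mu> s f"
    using L2_space_simple_approx[OF f] by blast
  then have "\<exists>Z s. (\<forall>n. simple_function ?\<mu> (s n)) \<and> L2_tendsto ?\<mu> s f \<and>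
    L2_tendsto P (\<lambda>n. wn_simple_integral ?\<mu> \<eta> (s n)) Z"
    using lim by blast
  from someI_ex[OF this] obtain s where s: "\<And>n. simple_function ?\<mu> (s n)" "L2_tendsto ?\<mu> s f"
    and Z: "L2_tendsto P (\<lambda>n. wn_simple_integral ?\<mu> \<eta> (s n)) (wn_integral ?\<mu> P \<eta> f)"
    unfolding wn_integral_def[symmetric] by blast
  show "wn_integral ?\<mu> P \<eta> f \<in> L2_space P" by (rule L2_tendstoD(2)[OF Z])
  show "AE \<omega> in P. wn_integral ?\<mu> P \<eta> f \<omega> = pairing (\<lambda>w. f (Y w) *\<^sub>R \<psi> w) \<omega>"
    by (rule L2_tendsto_unique[OF Z lim[OF s]])
qed

text \<open>
  For a constant \<open>\<psi> = h\<close> and \<open>Y\<close> the identity, \<open>wn_integral_eq_pairing\<close> computes the integral of a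
  scalar function against \<open>(h, \<nu>)\<close>.
\<close>
lemma wn_pair_decomp_eq_pairing:
  assumes \<phi>: "\<And>i. i < k \<Longrightarrow> \<phi> i \<in> L2_space M" and A[measurable]: "A \<in> sets M"
  shows "wn_pair_decomp M P \<nu> k \<phi> h A \<in> L2_space P"
    and "AE \<omega> in P. wn_pair_decomp M P \<nu> k \<phi> h A \<omega>
      = pairing (\<lambda>w. indicator A w *\<^sub>R (\<Sum>i<k. \<phi> i w *\<^sub>R h i)) \<omega>"
proof -
  let ?\<mu> = "\<lambda>i. density M (\<lambda>_. ennreal ((norm (h i))\<^sup>2))"
  let ?\<eta> = "\<lambda>i. wn_inner (h i) \<nu>"
  let ?f = "\<lambda>i w. indicator A w * \<phi> i w"
  have \<mu>: "image_density M (\<lambda>w. w) (\<lambda>_. h i) = ?\<mu> i" for i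
    by (rule distr_id2) simp
  have rep: "represents M (\<lambda>w. w) (\<lambda>_. h i) (?\<eta> i)" for i
    unfolding represents_def
  proof (intro ballI conjI)
    fix B assume B: "B \<in> sets M"
    show "?\<eta> i B \<in> L2_space P" using inner_noise_L2[OF B] by (simp add: wn_inner_def[abs_def])
    have eq: "(\<lambda>w. w) -` B \<inter> space M = B" using sets.sets_into_space[OF B] by auto
    show "AE \<omega> in P. ?\<eta> i B \<omega> = pairing (\<lambda>w. indicator ((\<lambda>w. w) -` B \<inter> space M) w *\<^sub>R h i) \<omega>"
      using pairing_indicator[OF B, of "h i"] unfolding eq by eventually_elim (simp add: wn_inner_def)
  qed
  have f: "?f i \<in> L2_space M" if "i < k" for i
    using L2_space_indicator[OF \<phi>[OF that] A] by simp
  have f\<mu>: "?f i \<in> L2_space (?\<mu> i)" if "i < k" for i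
    using L2_space_measurable[OF f[OF that]] L2_space_integrable[OF f[OF that]]
    by (intro L2_spaceI) (auto simp: integrable_density)
  have times: "wn_times (?\<mu> i) P (\<phi> i) (?\<eta> i) A = wn_integral (?\<mu> i) P (?\<eta> i) (?f i)" for i
    by (simp add: wn_times_def)
  have L2: "wn_times (?\<mu> i) P (\<phi> i) (?\<eta> i) A \<in> L2_space P"
    and eq: "AE \<omega> in P. wn_times (?\<mu> i) P (\<phi> i) (?\<eta> i) A \<omega> = pairing (\<lambda>w. ?f i w *\<^sub>R h i) \<omega>"
    if "i < k" for i
    unfolding times using wn_integral_eq_pairing[OF measurable_ident_sets[OF refl] L2_space_const rep, of "?f i" i] f\<mu>[OF that]
    by (simp_all add: \<mu>)
  have D: "wn_pair_decomp M P \<nu> k \<phi> h A = (\<lambda>\<omega>. \<Sum>i<k. wn_times (?\<mu> i) P (\<phi> i) (?\<eta> i) A \<omega>)"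
    by (simp add: wn_pair_decomp_def fun_eq_iff)
  show "wn_pair_decomp M P \<nu> k \<phi> h A \<in> L2_space P"
    unfolding D by (intro L2_space_sum L2) simp
  have fh: "(\<lambda>w. ?f i w *\<^sub>R h i) \<in> L2_space M" if "i < k" for i
    by (rule L2_space_bound[OF L2_space_scaleR[OF f[OF that], of "norm (h i)"]])
      (use L2_space_measurable[OF f[OF that]] in \<open>auto simp: abs_mult\<close>)
  have "AE \<omega> in P. \<forall>i\<in>{..<k}. wn_times (?\<mu> i) P (\<phi> i) (?\<eta> i) A \<omega> = pairing (\<lambda>w. ?f i w *\<^sub>R h i) \<omega>"
    by (intro AE_finite_allI eq) auto
  moreover have "AE \<omega> in P. pairing (\<lambda>w. \<Sum>i<k. ?f i w *\<^sub>R h i) \<omega> = (\<Sum>i<k. pairing (\<lambda>w. ?f i w *\<^sub>R h i) \<omega>)"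
    by (intro pairing_sum fh) simp
  ultimately show "AE \<omega> in P. wn_pair_decomp M P \<nu> k \<phi> h A \<omega>
      = pairing (\<lambda>w. indicator A w *\<^sub>R (\<Sum>i<k. \<phi> i w *\<^sub>R h i)) \<omega>"
    unfolding D by eventually_elim (simp add: scaleR_sum_right)
qed

text \<open>
  The limit that defines \<open>(\<psi>, \<nu>)(A)\<close> is \<open>pairing (1\<^sub>A \<psi>)\<close> for every approximation of \<open>\<psi>\<close> by decomposable
  functions, by continuity of \<open>pairing\<close>. Simple functions provide such an approximation.
\<close>
lemma wn_pair_eq_pairing:
  assumes \<psi>: "\<psi> \<in> L2_space M" and A: "A \<in> sets M"
  shows "wn_pair M P \<psi> \<nu> A \<in> L2_space P"
    and "AE \<omega> in P. wn_pair M P \<psi> \<nu> A \<omega> = pairing (\<lambda>w. indicator A w *\<^sub>R \<psi> w) \<omega>"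
proof -
  have lim: "L2_tendsto P (\<lambda>n. wn_pair_decomp M P \<nu> (k n) (\<phi> n) (h n) A) (pairing (\<lambda>w. indicator A w *\<^sub>R \<psi> w))"
    if \<phi>: "\<And>n i. i < k n \<Longrightarrow> \<phi> n i \<in> L2_space M"
      and conv: "L2_tendsto M (\<lambda>n x. \<Sum>i<k n. \<phi> n i x *\<^sub>R h n i) \<psi>" for k \<phi> h
  proof (rule L2_tendsto_cong_AE)
    show "L2_tendsto P (\<lambda>n. pairing (\<lambda>w. indicator A w *\<^sub>R (\<Sum>i<k n. \<phi> n i w *\<^sub>R h n i)))
      (pairing (\<lambda>w. indicator A w *\<^sub>R \<psi> w))"
      by (intro pairing_tendsto L2_tendsto_indicator conv A)
    show "wn_pair_decomp M P \<nu> (k n) (\<phi> n) (h n) A \<in> borel_measurable P" for n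
      by (intro L2_space_measurable wn_pair_decomp_eq_pairing(1) \<phi> A)
    show "AE \<omega> in P. pairing (\<lambda>w. indicator A w *\<^sub>R (\<Sum>i<k n. \<phi> n i w *\<^sub>R h n i)) \<omega>
      = wn_pair_decomp M P \<nu> (k n) (\<phi> n) (h n) A \<omega>" for n
    proof -
      have "AE \<omega> in P. wn_pair_decomp M P \<nu> (k n) (\<phi> n) (h n) A \<omega>
        = pairing (\<lambda>w. indicator A w *\<^sub>R (\<Sum>i<k n. \<phi> n i w *\<^sub>R h n i)) \<omega>"
        by (rule wn_pair_decomp_eq_pairing(2)[OF \<phi> A])
      then show ?thesis by eventually_elim simp
    qed
  qed (auto intro!: pairing_measurable L2_space_indicator \<psi> A)
  obtain s where s: "\<And>n. simple_function M (s n)" "L2_tendsto M s \<psi>"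
    using L2_space_simple_approx[OF \<psi>] by blast
  define k where "k n = card (s n ` space M)" for n
  have "\<exists>h. bij_betw h {..<k n} (s n ` space M)" for n
    using ex_bij_betw_nat_finite[OF simple_functionD(1)[OF s(1)]] by (auto simp: k_def atLeast0LessThan)
  then obtain h where h: "\<And>n. bij_betw (h n) {..<k n} (s n ` space M)" by metis
  \<comment> \<open>The decomposable form of \<open>s n\<close>: the values \<open>h n i\<close> are enumerated without repetition.\<close>
  define \<phi> where "\<phi> n i = indicat_real (s n -` {h n i} \<inter> space M)" for n i
  have \<phi>: "\<phi> n i \<in> L2_space M" for n i
    using L2_space_indicator[OF L2_space_const[of "1 :: real"] simple_functionD(2)[OF s(1)]]
    by (simp add: \<phi>_def)
  have \<phi>s: "(\<Sum>i<k n. \<phi> n i w *\<^sub>R h n i) = s n w" if w: "w \<in> space M" for n w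
  proof -
    have "(\<Sum>i<k n. \<phi> n i w *\<^sub>R h n i) = (\<Sum>y\<in>s n ` space M. indicat_real (s n -` {y} \<inter> space M) w *\<^sub>R y)"
      unfolding \<phi>_def by (rule sum.reindex_bij_betw[OF h])
    also have "\<dots> = s n w"
      using w simple_functionD(1)[OF s(1)]
      by (subst sum.remove[of _ "s n w"]) (auto intro!: sum.neutral simp: indicator_def)
    finally show ?thesis .
  qed
  have sum: "(\<lambda>x. \<Sum>i<k n. \<phi> n i x *\<^sub>R h n i) \<in> borel_measurable M" for n
    using borel_measurable_simple_function[OF s(1)[of n]]
    by (rule measurable_cong[THEN iffD1, rotated]) (simp add: \<phi>s)
  have "L2_tendsto M (\<lambda>n x. \<Sum>i<k n. \<phi> n i x *\<^sub>R h n i) \<psi>"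
    by (rule L2_tendsto_cong_AE[OF s(2) sum]) (auto simp: \<phi>s intro: L2_space_measurable \<psi>)
  with lim \<phi> have "\<exists>Y k \<phi> h. (\<forall>n. \<forall>i<k n. \<phi> n i \<in> L2_space M) \<and>
     L2_tendsto M (\<lambda>n x. \<Sum>i<k n. \<phi> n i x *\<^sub>R h n i) \<psi> \<and>
     L2_tendsto P (\<lambda>n. wn_pair_decomp M P \<nu> (k n) (\<phi> n) (h n) A) Y"
    by blast
  from someI_ex[OF this] obtain k \<phi> h where \<phi>: "\<And>n i. i < k n \<Longrightarrow> \<phi> n i \<in> L2_space M"
    and conv: "L2_tendsto M (\<lambda>n x. \<Sum>i<k n. \<phi> n i x *\<^sub>R h n i) \<psi>"
    and Z: "L2_tendsto P (\<lambda>n. wn_pair_decomp M P \<nu> (k n) (\<phi> n) (h n) A) (wn_pair M P \<psi> \<nu> A)"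
    unfolding wn_pair_def[symmetric] by blast
  show "wn_pair M P \<psi> \<nu> A \<in> L2_space P" by (rule L2_tendstoD(2)[OF Z])
  show "AE \<omega> in P. wn_pair M P \<psi> \<nu> A \<omega> = pairing (\<lambda>w. indicator A w *\<^sub>R \<psi> w) \<omega>"
    by (rule L2_tendsto_unique[OF Z lim[OF \<phi> conv]])
qed

lemma represents_wn_image:
  assumes Y: "Y \<in> measurable M E" and \<psi>: "\<psi> \<in> L2_space M"
  shows "represents E Y \<psi> (wn_image M Y (wn_pair M P \<psi> \<nu>))"
  unfolding represents_def wn_image_def
  using wn_pair_eq_pairing[OF \<psi> measurable_sets[OF Y]] by auto

text \<open>
  Finite unions are handled by linearity; the passage to the countable union is dominated convergence in
  \<open>L\<^sup>2(m; H)\<close>, transported by the isometry.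
\<close>
lemma represents_sigma_additive:
  assumes Y: "Y \<in> measurable M E" and \<psi>[measurable]: "\<psi> \<in> L2_space M" and \<eta>: "represents E Y \<psi> \<eta>"
  shows "sigma_additive_L2 P E \<eta>"
  unfolding sigma_additive_L2_def
proof (intro allI impI)
  fix A :: "nat \<Rightarrow> _" assume A: "range A \<subseteq> sets E" and disj: "disjoint_family A"
  define B where "B i = Y -` A i \<inter> space M" for i
  have B[measurable]: "B i \<in> sets M" for i using measurable_sets[OF Y] A by (auto simp: B_def)
  have dB: "disjoint_family_on B S" for S
    using disj by (fastforce simp: disjoint_family_on_def B_def)
  have ind: "(\<lambda>w. indicator (B i) w *\<^sub>R \<psi> w) \<in> L2_space M" for i
    by (rule L2_space_indicator[OF \<psi> B])
  have "L2_tendsto M (\<lambda>n w. indicator (\<Union>i<n. B i) w *\<^sub>R \<psi> w) (\<lambda>w. indicator (\<Union>i. B i) w *\<^sub>R \<psi> w)"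
  proof (rule L2_tendsto_dominated[OF _ _ \<psi>, where C = 1])
    show "(\<lambda>n. indicator (\<Union>i<n. B i) w *\<^sub>R \<psi> w) \<longlonglongrightarrow> indicator (\<Union>i. B i) w *\<^sub>R \<psi> w" for w
      by (intro tendsto_scaleR LIMSEQ_indicator_UN tendsto_const)
  qed (auto simp: indicator_def)
  then have "L2_tendsto P (\<lambda>n. pairing (\<lambda>w. indicator (\<Union>i<n. B i) w *\<^sub>R \<psi> w))
    (pairing (\<lambda>w. indicator (\<Union>i. B i) w *\<^sub>R \<psi> w))"
    by (rule pairing_tendsto)
  then show "L2_tendsto P (\<lambda>n \<omega>. \<Sum>i<n. \<eta> (A i) \<omega>) (\<eta> (\<Union>i. A i))"
  proof (rule L2_tendsto_cong_AE)
    show "(\<lambda>\<omega>. \<Sum>i<n. \<eta> (A i) \<omega>) \<in> borel_measurable P" for n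
      using \<eta> A by (intro borel_measurable_sum L2_space_measurable) (auto simp: represents_def)
    have U: "(\<Union>i. A i) \<in> sets E" using A by auto
    show "\<eta> (\<Union>i. A i) \<in> borel_measurable P"
      using \<eta> U by (intro L2_space_measurable) (auto simp: represents_def)
    have "Y -` (\<Union>i. A i) \<inter> space M = (\<Union>i. B i)" by (auto simp: B_def)
    with \<eta> U have "AE \<omega> in P. \<eta> (\<Union>i. A i) \<omega> = pairing (\<lambda>w. indicator (\<Union>i. B i) w *\<^sub>R \<psi> w) \<omega>"
      unfolding represents_def by metis
    then show "AE \<omega> in P. pairing (\<lambda>w. indicator (\<Union>i. B i) w *\<^sub>R \<psi> w) \<omega> = \<eta> (\<Union>i. A i) \<omega>"
      by eventually_elim simp
    fix n
    have "AE \<omega> in P. \<forall>i\<in>{..<n}. \<eta> (A i) \<omega> = pairing (\<lambda>w. indicator (B i) w *\<^sub>R \<psi> w) \<omega>"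
      using \<eta> A by (intro AE_finite_allI) (auto simp: represents_def B_def)
    moreover have "AE \<omega> in P. pairing (\<lambda>w. \<Sum>i<n. indicator (B i) w *\<^sub>R \<psi> w) \<omega>
      = (\<Sum>i<n. pairing (\<lambda>w. indicator (B i) w *\<^sub>R \<psi> w) \<omega>)"
      by (rule pairing_sum[OF ind])
    ultimately show "AE \<omega> in P. pairing (\<lambda>w. indicator (\<Union>i<n. B i) w *\<^sub>R \<psi> w) \<omega> = (\<Sum>i<n. \<eta> (A i) \<omega>)"
      by eventually_elim (simp add: indicator_UN_disjoint[OF _ dB] scaleR_sum_left)
  qed
qed

lemma represents_gaussian:
  assumes Y: "Y \<in> measurable M E" and \<psi>: "\<psi> \<in> L2_space M" and \<eta>: "represents E Y \<psi> \<eta>" and A: "A \<in> sets E"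
  shows "centered_gaussian P (\<eta> A) (\<integral>w. (norm (indicator (Y -` A \<inter> space M) w *\<^sub>R \<psi> w))\<^sup>2 \<partial>M)"
proof (rule P.centered_gaussian_cong_AE)
  show "centered_gaussian P (pairing (\<lambda>w. indicator (Y -` A \<inter> space M) w *\<^sub>R \<psi> w))
    (\<integral>w. (norm (indicator (Y -` A \<inter> space M) w *\<^sub>R \<psi> w))\<^sup>2 \<partial>M)"
    by (rule pairing_gaussian[OF L2_space_indicator[OF \<psi> measurable_sets[OF Y A]]])
  show "AE \<omega> in P. pairing (\<lambda>w. indicator (Y -` A \<inter> space M) w *\<^sub>R \<psi> w) \<omega> = \<eta> A \<omega>"
    using \<eta> A by (auto simp: represents_def)
  show "\<eta> A \<in> borel_measurable P" using \<eta> A by (auto simp: represents_def L2_space_measurable)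
qed

lemma emeasure_image_density:
  assumes Y[measurable]: "Y \<in> measurable M E" and \<psi>: "\<psi> \<in> L2_space M" and A[measurable]: "A \<in> sets E"
  shows "emeasure (image_density E Y \<psi>) A
    = ennreal (\<integral>w. (norm (indicator (Y -` A \<inter> space M) w *\<^sub>R \<psi> w))\<^sup>2 \<partial>M)"
proof -
  note [measurable] = L2_space_measurable[OF \<psi>]
  have B[measurable]: "Y -` A \<inter> space M \<in> sets M" by (rule measurable_sets[OF Y A])
  have "emeasure (image_density E Y \<psi>) A
    = (\<integral>\<^sup>+w. ennreal ((norm (\<psi> w))\<^sup>2) * indicator (Y -` A \<inter> space M) w \<partial>M)"
    by (subst emeasure_distr) (auto simp: emeasure_density)
  also have "\<dots> = (\<integral>\<^sup>+w. ennreal ((norm (indicator (Y -` A \<inter> space M) w *\<^sub>R \<psi> w))\<^sup>2) \<partial>M)"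
    by (intro nn_integral_cong) (auto simp: indicator_def)
  also have "\<dots> = ennreal (\<integral>w. (norm (indicator (Y -` A \<inter> space M) w *\<^sub>R \<psi> w))\<^sup>2 \<partial>M)"
    by (intro nn_integral_eq_integral L2_space_integrable[OF L2_space_indicator[OF \<psi> B]]) auto
  finally show ?thesis .
qed

lemma wn_measure_represents:
  assumes Y: "Y \<in> measurable M E" and \<psi>: "\<psi> \<in> L2_space M" and \<eta>: "represents E Y \<psi> \<eta>"
  shows "wn_measure P E \<eta> = image_density E Y \<psi>"
proof -
  have "wn_measure P E \<eta> = measure_of (space E) (sets E) (emeasure (image_density E Y \<psi>))"
    unfolding wn_measure_def
  proof (rule measure_of_eq[OF sets.space_closed])
    fix A assume "A \<in> sigma_sets (space E) (sets E)"
    then have A: "A \<in> sets E" by (simp add: sets.sigma_sets_eq)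
    show "ennreal (\<integral>\<omega>. (\<eta> A \<omega>)\<^sup>2 \<partial>P) = emeasure (image_density E Y \<psi>) A"
      unfolding emeasure_image_density[OF Y \<psi> A]
      by (simp only: P.centered_gaussian_second_moment[OF represents_gaussian[OF Y \<psi> \<eta> A]])
  qed
  also have "\<dots> = image_density E Y \<psi>"
    using measure_of_of_measure[of "image_density E Y \<psi>"] by simp
  finally show ?thesis .
qed

lemma finite_measure_image_density:
  assumes Y: "Y \<in> measurable M E" and \<psi>: "\<psi> \<in> L2_space M"
  shows "finite_measure (image_density E Y \<psi>)"
  using emeasure_image_density[OF Y \<psi> sets.top] by (intro finite_measureI) simp

lemma vector_represents_indep:
  fixes \<psi> :: "'d::finite \<Rightarrow> 'w \<Rightarrow> 'h" and \<Lambda> :: "'e set \<Rightarrow> 'o \<Rightarrow> real^'d"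
  assumes Y: "Y \<in> measurable M E" and \<psi>: "\<And>j. \<psi> j \<in> L2_space M"
    and \<Lambda>: "\<And>j. represents E Y (\<psi> j) (\<lambda>A \<omega>. \<Lambda> A \<omega> $ j)"
  shows "indep_on_disjoint P E \<Lambda>"
  unfolding indep_on_disjoint_def
proof (intro allI impI)
  fix k :: nat and A :: "nat \<Rightarrow> 'e set"
  assume A: "A ` {..<k} \<subseteq> sets E" and disj: "disjoint_family_on A {..<k}"
  have L2: "\<Lambda> (A i) \<in> L2_space P" if "i < k" for i
    using \<Lambda> A that by (intro L2_space_vec) (auto simp: represents_def)
  have "P.indep_vars (\<lambda>_. borel)
    (\<lambda>i \<omega>. (\<chi> j. pairing (\<lambda>w. indicator (Y -` A i \<inter> space M) w *\<^sub>R \<psi> j w) \<omega>) :: real^'d) {..<k}"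
  proof (rule pairing_indep[OF _ _ _ \<psi>])
    show "disjoint_family_on (\<lambda>i. Y -` A i \<inter> space M) {..<k}"
      using disj by (fastforce simp: disjoint_family_on_def)
  qed (use A measurable_sets[OF Y] in auto)
  then show "P.indep_vars (\<lambda>_. borel) (\<lambda>i. \<Lambda> (A i)) {..<k}"
  proof (rule P.indep_vars_cong_AE[rotated])
    fix i assume i: "i \<in> {..<k}"
    show "\<Lambda> (A i) \<in> borel_measurable P" using L2 i by (auto intro: L2_space_measurable)
    have "AE \<omega> in P. \<forall>j\<in>UNIV. \<Lambda> (A i) \<omega> $ j = pairing (\<lambda>w. indicator (Y -` A i \<inter> space M) w *\<^sub>R \<psi> j w) \<omega>"
      using \<Lambda> A i by (intro AE_finite_allI) (auto simp: represents_def)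
    then show "AE \<omega> in P. (\<chi> j. pairing (\<lambda>w. indicator (Y -` A i \<inter> space M) w *\<^sub>R \<psi> j w) \<omega>) = \<Lambda> (A i) \<omega>"
      by eventually_elim (simp add: vec_eq_iff)
  qed simp
qed

lemma white_noise_represents:
  assumes Y: "Y \<in> measurable M E" and \<psi>: "\<psi> \<in> L2_space M" and \<eta>: "represents E Y \<psi> \<eta>"
  shows "white_noise P (wn_measure P E \<eta>) \<eta>"
proof -
  interpret \<mu>: finite_measure "image_density E Y \<psi>" by (rule finite_measure_image_density[OF Y \<psi>])
  have "centered_gaussian P (\<eta> A) (measure (image_density E Y \<psi>) A)" if "A \<in> sets E" for A
    using represents_gaussian[OF Y \<psi> \<eta> that] emeasure_image_density[OF Y \<psi> that]
    by (simp add: measure_def)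
  moreover have "indep_on_disjoint P E \<eta>"
  proof -
    \<comment> \<open>The scalar case is the vector case in dimension one.\<close>
    have "indep_on_disjoint P E (\<lambda>A \<omega>. (\<chi> j. \<eta> A \<omega>) :: real^1)"
      by (rule vector_represents_indep[OF Y, where \<psi> = "\<lambda>_. \<psi>"]) (use \<psi> \<eta> in simp_all)
    note vec = this
    show ?thesis
      unfolding indep_on_disjoint_def
    proof (intro allI impI)
      fix k :: nat and A :: "nat \<Rightarrow> _"
      assume "A ` {..<k} \<subseteq> sets E" "disjoint_family_on A {..<k}"
      with vec have "P.indep_vars (\<lambda>_. borel) (\<lambda>i \<omega>. (\<chi> j. \<eta> (A i) \<omega>) :: real^1) {..<k}"
        unfolding indep_on_disjoint_def by blast
      from P.indep_vars_compose2[OF this, of "\<lambda>_ x. x $ 1" "\<lambda>_. borel"]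
      show "P.indep_vars (\<lambda>_. borel) (\<lambda>i. \<eta> (A i)) {..<k}" by simp
    qed
  qed
  moreover have "sigma_additive_L2 P E \<eta>" by (rule represents_sigma_additive[OF Y \<psi> \<eta>])
  ultimately show ?thesis
    unfolding white_noise_def wn_measure_represents[OF Y \<psi> \<eta>]
    using \<eta> P.prob_space_axioms \<mu>.finite_measure_axioms
    by (auto simp: represents_def sigma_additive_L2_def indep_on_disjoint_def)
qed

lemma wn_matrix_represents:
  fixes \<psi> :: "'d::finite \<Rightarrow> 'w \<Rightarrow> 'h" and \<Lambda> :: "'e set \<Rightarrow> 'o \<Rightarrow> real^'d"
  assumes Y: "Y \<in> measurable M E" and \<psi>: "\<And>j. \<psi> j \<in> L2_space M"
    and \<Lambda>: "\<And>j. represents E Y (\<psi> j) (\<lambda>A \<omega>. \<Lambda> A \<omega> $ j)" and A: "A \<in> sets E"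
  shows "wn_matrix P \<Lambda> A $ i $ j = (\<integral>w\<in>Y -` A \<inter> space M. \<psi> i w \<bullet> \<psi> j w \<partial>M)"
proof -
  let ?\<psi> = "\<lambda>j w. indicator (Y -` A \<inter> space M) w *\<^sub>R \<psi> j w"
  have L: "?\<psi> j \<in> L2_space M" for j by (rule L2_space_indicator[OF \<psi> measurable_sets[OF Y A]])
  have eq: "AE \<omega> in P. \<Lambda> A \<omega> $ j = pairing (?\<psi> j) \<omega>" and L2: "(\<lambda>\<omega>. \<Lambda> A \<omega> $ j) \<in> L2_space P" for j
    using \<Lambda> A by (auto simp: represents_def)
  note [measurable] = L2_space_measurable[OF L2] pairing_measurable[OF L]
  have "wn_matrix P \<Lambda> A $ i $ j = (\<integral>\<omega>. \<Lambda> A \<omega> $ i * \<Lambda> A \<omega> $ j \<partial>P)" by (simp add: wn_matrix_def)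
  also have "\<dots> = (\<integral>\<omega>. pairing (?\<psi> i) \<omega> * pairing (?\<psi> j) \<omega> \<partial>P)"
    using eq[of i] eq[of j] by (intro integral_cong_AE) auto
  also have "\<dots> = (\<integral>w. ?\<psi> i w \<bullet> ?\<psi> j w \<partial>M)" by (rule pairing_inner[OF L L])
  also have "\<dots> = (\<integral>w\<in>Y -` A \<inter> space M. \<psi> i w \<bullet> \<psi> j w \<partial>M)"
    unfolding set_lebesgue_integral_def
    by (intro Bochner_Integration.integral_cong) (auto simp: indicator_def)
  finally show ?thesis .
qed

text \<open>
  A linear combination of the components is represented by the same linear combination of the \<open>\<psi> j\<close>,
  hence Gaussian. Its variance is its second moment, which expands into the quadratic form of the matrix.
\<close>
lemma vector_white_noise_represents:
  fixes \<psi> :: "'d::finite \<Rightarrow> 'w \<Rightarrow> 'h" and \<Lambda> :: "'e set \<Rightarrow> 'o \<Rightarrow> real^'d"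
  assumes Y: "Y \<in> measurable M E" and \<psi>: "\<And>j. \<psi> j \<in> L2_space M"
    and \<Lambda>: "\<And>j. represents E Y (\<psi> j) (\<lambda>A \<omega>. \<Lambda> A \<omega> $ j)"
  shows "vector_white_noise P E (wn_matrix P \<Lambda>) \<Lambda>"
  unfolding vector_white_noise_def
proof (intro conjI ballI allI)
  show "prob_space P" by (rule P.prob_space_axioms)
  show "indep_on_disjoint P E \<Lambda>" by (rule vector_represents_indep[OF Y \<psi> \<Lambda>])
  show "sigma_additive_L2 P E \<Lambda>"
    using represents_sigma_additive[OF Y \<psi> \<Lambda>] unfolding sigma_additive_L2_def
    by (auto intro!: L2_tendsto_vec)
next
  fix A assume A: "A \<in> sets E"
  have L2: "(\<lambda>\<omega>. \<Lambda> A \<omega> $ j) \<in> L2_space P" for j using \<Lambda> A by (auto simp: represents_def)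
  show \<Lambda>L2: "\<Lambda> A \<in> L2_space P" by (rule L2_space_vec[OF L2])
  fix c :: "real^'d"
  let ?\<psi> = "\<lambda>j w. indicator (Y -` A \<inter> space M) w *\<^sub>R \<psi> j w"
  have L: "?\<psi> j \<in> L2_space M" for j by (rule L2_space_indicator[OF \<psi> measurable_sets[OF Y A]])
  have Lc: "(\<lambda>w. c $ j *\<^sub>R ?\<psi> j w) \<in> L2_space M" for j by (rule L2_space_scaleR[OF L])
  let ?S = "\<lambda>w. \<Sum>j\<in>UNIV. c $ j *\<^sub>R ?\<psi> j w"
  have "AE \<omega> in P. pairing ?S \<omega> = (\<Sum>j\<in>UNIV. pairing (\<lambda>w. c $ j *\<^sub>R ?\<psi> j w) \<omega>)"
    by (rule pairing_sum[OF Lc])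
  moreover have "AE \<omega> in P. \<forall>j\<in>UNIV. pairing (\<lambda>w. c $ j *\<^sub>R ?\<psi> j w) \<omega> = c $ j * pairing (?\<psi> j) \<omega>"
    by (intro AE_finite_allI pairing_scale L) simp
  moreover have "AE \<omega> in P. \<forall>j\<in>UNIV. \<Lambda> A \<omega> $ j = pairing (?\<psi> j) \<omega>"
    using \<Lambda> A by (intro AE_finite_allI) (auto simp: represents_def)
  ultimately have "AE \<omega> in P. pairing ?S \<omega> = \<Lambda> A \<omega> \<bullet> c"
    by eventually_elim (simp add: inner_vec_def mult.commute)
  moreover have "centered_gaussian P (pairing ?S) (\<integral>w. (norm (?S w))\<^sup>2 \<partial>M)"
    by (rule pairing_gaussian[OF L2_space_sum[OF Lc]])
  moreover have "(\<lambda>\<omega>. \<Lambda> A \<omega> \<bullet> c) \<in> borel_measurable P"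
    using L2_space_measurable[OF \<Lambda>L2] by simp
  ultimately have G: "centered_gaussian P (\<lambda>\<omega>. \<Lambda> A \<omega> \<bullet> c) (\<integral>w. (norm (?S w))\<^sup>2 \<partial>M)"
    using P.centered_gaussian_cong_AE by blast
  have "(\<integral>w. (norm (?S w))\<^sup>2 \<partial>M) = (\<integral>\<omega>. (\<Lambda> A \<omega> \<bullet> c)\<^sup>2 \<partial>P)"
    by (rule P.centered_gaussian_second_moment[OF G, symmetric])
  also have "\<dots> = (\<integral>\<omega>. (\<Sum>i\<in>UNIV. \<Sum>j\<in>UNIV. c $ i * (c $ j * (\<Lambda> A \<omega> $ i * \<Lambda> A \<omega> $ j))) \<partial>P)"
    by (simp add: inner_vec_def power2_eq_square sum_product ac_simps)
  also have "\<dots> = (\<Sum>i\<in>UNIV. \<Sum>j\<in>UNIV. c $ i * (c $ j * (\<integral>\<omega>. \<Lambda> A \<omega> $ i * \<Lambda> A \<omega> $ j \<partial>P)))"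
    using L2_space_inner[OF L2 L2] by simp
  also have "\<dots> = c \<bullet> (wn_matrix P \<Lambda> A *v c)"
    by (simp add: inner_vec_def matrix_vector_mult_def wn_matrix_def sum_distrib_left ac_simps)
  finally show "centered_gaussian P (\<lambda>\<omega>. \<Lambda> A \<omega> \<bullet> c) (c \<bullet> (wn_matrix P \<Lambda> A *v c))"
    using G by simp
qed

end

section \<open>The chain rule for the gradient\<close>

lemma C1_LipschitzD:
  assumes "C1_Lipschitz F"
  shows "F differentiable at x" "continuous_on UNIV (gradient F)" "continuous_on UNIV F"
  using assms by (auto simp: C1_Lipschitz_def lipschitz_on_continuous_on)

lemma C1_Lipschitz_line_derivative:
  assumes F: "C1_Lipschitz F"
  shows "((\<lambda>t. F (x + (t - t0) *\<^sub>R axis i 1)) has_real_derivative gradient F x $ i) (at t0)"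
proof -
  have line: "((\<lambda>t. x + (t - t0) *\<^sub>R axis i (1::real)) has_derivative (\<lambda>h. h *\<^sub>R axis i 1)) (at t0)"
    by (auto intro!: derivative_eq_intros)
  have "(F has_derivative frechet_derivative F (at x)) (at x)"
    using C1_LipschitzD(1)[OF F] by (simp add: frechet_derivative_works)
  then have D: "(F has_derivative frechet_derivative F (at x)) (at (x + (t0 - t0) *\<^sub>R axis i 1))" by simp
  have lin: "linear (frechet_derivative F (at x))"
    using C1_LipschitzD(1)[OF F] by (rule linear_frechet_derivative)
  from has_derivative_compose[OF line D] show ?thesis
    by (simp add: has_field_derivative_def linear_scale[OF lin] gradient_def mult.commute[of _ "frechet_derivative F (at x) (axis i 1)"])
qed

text \<open>The difference quotients along the axes are bounded by the Lipschitz constant.\<close>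
lemma C1_Lipschitz_gradient_bounded:
  assumes F: "C1_Lipschitz F"
  obtains C where "\<And>x i. \<bar>gradient F x $ i\<bar> \<le> C"
proof -
  from F obtain C where C: "C-lipschitz_on UNIV F" by (auto simp: C1_Lipschitz_def)
  have "\<bar>gradient F x $ i\<bar> \<le> C" for x i
  proof (rule tendsto_upperbound)
    show "((\<lambda>h. \<bar>(F (x + h *\<^sub>R axis i 1) - F x) / h\<bar>) \<longlongrightarrow> \<bar>gradient F x $ i\<bar>) (at 0)"
      using C1_Lipschitz_line_derivative[OF F, of x 0 i]
      by (intro tendsto_rabs) (simp add: DERIV_def)
    have "\<bar>(F (x + h *\<^sub>R axis i 1) - F x) / h\<bar> \<le> C" if "h \<noteq> 0" for h
      using lipschitz_onD[OF C, of "x + h *\<^sub>R axis i 1" x] that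
      by (simp add: dist_norm divide_le_eq norm_axis_1)
    then show "\<forall>\<^sub>F h in at 0. \<bar>(F (x + h *\<^sub>R axis i 1) - F x) / h\<bar> \<le> C"
      by (simp add: eventually_at_filter)
  qed simp
  then show thesis by (rule that)
qed

lemma
  shows C1_Lipschitz_coordinate: "C1_Lipschitz (\<lambda>x :: real^'d. x $ i)"
    and gradient_coordinate: "gradient (\<lambda>x :: real^'d. x $ i) x = axis i 1"
proof -
  have D: "((\<lambda>x :: real^'d. x $ i) has_derivative (\<lambda>x. x $ i)) (at x)" for x
    by (rule bounded_linear_imp_has_derivative[OF bounded_linear_vec_nth])
  have grad: "gradient (\<lambda>x :: real^'d. x $ i) x = axis i 1" for x
    unfolding gradient_def frechet_derivative_at[OF D, symmetric]
    by (auto simp: vec_eq_iff axis_def)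
  then show "gradient (\<lambda>x :: real^'d. x $ i) x = axis i 1" .
  have "1-lipschitz_on UNIV (\<lambda>x :: real^'d. x $ i)"
    by (rule lipschitz_onI) (auto simp: dist_vec_nth_le)
  moreover have "gradient (\<lambda>x :: real^'d. x $ i) = (\<lambda>_. axis i 1)" using grad by auto
  ultimately show "C1_Lipschitz (\<lambda>x :: real^'d. x $ i)"
    using D by (auto simp: C1_Lipschitz_def differentiable_def)
qed

text \<open>
  The functional calculus speaks of functions on sequences that depend on the first \<open>k\<close> coordinates.
  An enumeration \<open>e\<close> of the index type turns a function on \<open>real^'d\<close> into one of this kind, with the
  corresponding partial derivatives.
\<close>
lemma C1_Lipschitz_coords_vec:
  fixes F :: "real^'d \<Rightarrow> real"
  assumes F: "C1_Lipschitz F" and e: "bij_betw e {..<CARD('d)} (UNIV :: 'd set)"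
  defines "e' \<equiv> the_inv_into {..<CARD('d)} e"
  shows "C1_Lipschitz_coords CARD('d) (\<lambda>x. F (\<chi> j. x (e' j)))"
    and "i < CARD('d) \<Longrightarrow> partial_deriv (\<lambda>x. F (\<chi> j. x (e' j))) i x = gradient F (\<chi> j. x (e' j)) $ e i"
proof -
  have inj: "inj_on e {..<CARD('d)}" using e by (rule bij_betw_imp_inj_on)
  have e'e: "e' (e i) = i" if "i < CARD('d)" for i
    using that inj by (simp add: e'_def the_inv_into_f_f)
  have ee': "e (e' j) = j" for j
    using e by (simp add: e'_def f_the_inv_into_f_bij_betw)
  have line: "(\<chi> j. (x(i := t)) (e' j)) = (\<chi> j. x (e' j)) + (t - x i) *\<^sub>R axis (e i) (1::real)"
    if "i < CARD('d)" for x i t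
    using e'e[OF that] ee' by (auto simp: vec_eq_iff axis_def)
  have D: "((\<lambda>t. F (\<chi> j. (x(i := t)) (e' j))) has_real_derivative gradient F (\<chi> j. x (e' j)) $ e i) (at (x i))"
    if "i < CARD('d)" for x i
    unfolding line[OF that] by (rule C1_Lipschitz_line_derivative[OF F])
  show pd: "partial_deriv (\<lambda>x. F (\<chi> j. x (e' j))) i x = gradient F (\<chi> j. x (e' j)) $ e i"
    if "i < CARD('d)" for i x
    unfolding partial_deriv_def by (rule DERIV_imp_deriv[OF D[OF that]])
  obtain C where C: "C-lipschitz_on UNIV F" using F by (auto simp: C1_Lipschitz_def)
  have "\<bar>F (\<chi> j. x (e' j)) - F (\<chi> j. y (e' j))\<bar> \<le> C * L2_set (\<lambda>i. x i - y i) {..<CARD('d)}" for x y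
  proof -
    have "dist ((\<chi> j. x (e' j)) :: real^'d) (\<chi> j. y (e' j)) = sqrt (\<Sum>j\<in>UNIV. (x (e' j) - y (e' j))\<^sup>2)"
      by (simp add: dist_norm norm_vec_def L2_set_def)
    also have "(\<Sum>j\<in>UNIV. (x (e' j) - y (e' j))\<^sup>2) = (\<Sum>i<CARD('d). (x (e' (e i)) - y (e' (e i)))\<^sup>2)"
      by (rule sum.reindex_bij_betw[OF e, symmetric])
    also have "sqrt \<dots> = L2_set (\<lambda>i. x i - y i) {..<CARD('d)}"
      by (simp add: L2_set_def e'e)
    finally show ?thesis
      using lipschitz_onD[OF C, of "\<chi> j. x (e' j)" "\<chi> j. y (e' j)"] by (simp add: dist_real_def)
  qed
  moreover have "continuous_on UNIV (partial_deriv (\<lambda>x. F (\<chi> j. x (e' j))) i)" if "i < CARD('d)" for i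
  proof -
    have c: "continuous_on UNIV (\<lambda>x :: nat \<Rightarrow> real. (\<chi> j. x (e' j)) :: real^'d)"
      by (intro continuous_on_vec_lambda continuous_on_product_coordinates)
    have "continuous_on UNIV (\<lambda>x :: nat \<Rightarrow> real. gradient F (\<chi> j. x (e' j)) $ e i)"
      by (intro bounded_linear.continuous_on[OF bounded_linear_vec_nth] continuous_on_compose2[OF C1_LipschitzD(2)[OF F] c]) auto
    then show ?thesis using pd[OF that] by (simp cong: continuous_on_cong)
  qed
  moreover have "(\<lambda>t. F (\<chi> j. (x(i := t)) (e' j))) differentiable at (x i)" if "i < CARD('d)" for x i
    using D[OF that] by (auto simp: differentiable_def has_field_derivative_def)
  ultimately show "C1_Lipschitz_coords CARD('d) (\<lambda>x. F (\<chi> j. x (e' j)))"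
    unfolding C1_Lipschitz_coords_def by blast
qed

context error_structure
begin

lemma
  fixes X :: "'w \<Rightarrow> real^'d"
  assumes X: "\<And>i. (\<lambda>w. X w $ i) \<in> \<D>" and F: "C1_Lipschitz F"
  shows C1_Lipschitz_comp_dom: "F \<circ> X \<in> \<D>"
    and gamma_chain_rule: "C1_Lipschitz G \<Longrightarrow> AE w in M. \<Gamma> (F \<circ> X) (G \<circ> X) w =
      (\<Sum>i\<in>UNIV. \<Sum>j\<in>UNIV. gradient F (X w) $ i * gradient G (X w) $ j * \<Gamma> (\<lambda>w. X w $ i) (\<lambda>w. X w $ j) w)"
proof -
  obtain e where e: "bij_betw e {..<CARD('d)} (UNIV :: 'd set)"
    using ex_bij_betw_nat_finite[of "UNIV :: 'd set"] by (auto simp: atLeast0LessThan)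
  define e' where "e' = the_inv_into {..<CARD('d)} e"
  have ee': "e (e' j) = j" for j
    using e by (simp add: e'_def f_the_inv_into_f_bij_betw)
  define U where "U i w = X w $ e i" for i w
  have U: "U i \<in> \<D>" for i using X by (simp add: U_def[abs_def])
  have UX: "(\<chi> j. U (e' j) w) = X w" for w by (simp add: U_def ee' vec_eq_iff)
  have H: "(\<lambda>w. H (\<chi> j. U (e' j) w)) = H \<circ> X" for H :: "real^'d \<Rightarrow> real"
    by (simp add: UX fun_eq_iff)
  note coords = C1_Lipschitz_coords_vec[OF _ e, folded e'_def]
  from calculus_dom[where U = U, OF U coords(1)[OF F]] show "F \<circ> X \<in> \<D>" by (simp only: H)
  assume G: "C1_Lipschitz G"
  from calculus_gamma[where U = U and V = U, OF U U coords(1)[OF F] coords(1)[OF G]]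
  have "AE w in M. \<Gamma> (F \<circ> X) (G \<circ> X) w = (\<Sum>i<CARD('d). \<Sum>j<CARD('d).
      gradient F (X w) $ e i * gradient G (X w) $ e j * \<Gamma> (\<lambda>w. X w $ e i) (\<lambda>w. X w $ e j) w)"
    by (simp add: H coords(2)[OF F] coords(2)[OF G] UX o_def) (simp add: U_def[abs_def])
  then show "AE w in M. \<Gamma> (F \<circ> X) (G \<circ> X) w =
      (\<Sum>i\<in>UNIV. \<Sum>j\<in>UNIV. gradient F (X w) $ i * gradient G (X w) $ j * \<Gamma> (\<lambda>w. X w $ i) (\<lambda>w. X w $ j) w)"
    by (simp add: sum.reindex_bij_betw[OF e, symmetric])
qed

text \<open>
  Bilinearity holds almost everywhere for each choice of arguments separately. This lemma and
  \<open>gamma_polarization\<close> collect the instances that polarization requires.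
\<close>
lemma gamma_diagonal_add:
  assumes u: "u \<in> \<D>" and v: "v \<in> \<D>"
  shows "AE w in M. \<Gamma> (\<lambda>w. u w + v w) (\<lambda>w. u w + v w) w = \<Gamma> u u w + 2 * \<Gamma> u v w + \<Gamma> v v w"
proof -
  have s: "(\<lambda>w. u w + v w) \<in> \<D>" by (rule dom_add[OF u v])
  from gamma_add[OF u v s] gamma_sym[OF u s] gamma_sym[OF v s] gamma_add[OF u v u] gamma_add[OF u v v]
    gamma_sym[OF u v]
  show ?thesis by eventually_elim simp
qed

lemma dom_diff:
  assumes "u \<in> \<D>" "v \<in> \<D>"
  shows "(\<lambda>w. u w - v w) \<in> \<D>"
  using dom_add[OF assms(1) dom_scale[OF assms(2), of "-1"]] by simp

lemma gamma_polarization: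
  assumes u: "u \<in> \<D>" and v: "v \<in> \<D>"
  shows "AE w in M. \<Gamma> (\<lambda>w. u w + v w) (\<lambda>w. u w + v w) w - \<Gamma> (\<lambda>w. u w - v w) (\<lambda>w. u w - v w) w
    = 4 * \<Gamma> u v w"
proof -
  have n: "(\<lambda>w. - v w) \<in> \<D>" using dom_scale[OF v, of "-1"] by simp
  have "AE w in M. \<Gamma> (\<lambda>w. - v w) x w = - \<Gamma> v x w" if "x \<in> \<D>" for x
    using gamma_scale[OF v that, of "-1"] by simp
  from this[OF u] this[OF n] this[OF v] gamma_sym[OF u n] gamma_sym[OF v n] gamma_sym[OF u v]
    gamma_diagonal_add[OF u v] gamma_diagonal_add[OF u n]
  show ?thesis by eventually_elim simp
qed

lemma D_gradientD:
  assumes "D_gradient M \<D> \<Gamma> D" and "u \<in> \<D>"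
  shows "D u \<in> L2_space M" "AE w in M. (norm (D u w))\<^sup>2 = \<Gamma> u u w"
    and "v \<in> \<D> \<Longrightarrow> AE w in M. D (\<lambda>w. u w + v w) w = D u w + D v w"
  using assms by (auto simp: D_gradient_def)

text \<open>The identity \<open>\<parallel>Du\<parallel>\<^sup>2 = \<Gamma>[u]\<close> polarizes, since both sides are quadratic in \<open>u\<close>.\<close>
lemma D_gradient_inner:
  assumes D: "D_gradient M \<D> \<Gamma> D" and u: "u \<in> \<D>" and v: "v \<in> \<D>"
  shows "AE w in M. D u w \<bullet> D v w = \<Gamma> u v w"
  using D_gradientD(2)[OF D u] D_gradientD(2)[OF D v] D_gradientD(2)[OF D dom_add[OF u v]]
    D_gradientD(3)[OF D u v] gamma_diagonal_add[OF u v]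
proof eventually_elim
  case (elim w)
  have "(norm (D u w + D v w))\<^sup>2 = (norm (D u w))\<^sup>2 + 2 * (D u w \<bullet> D v w) + (norm (D v w))\<^sup>2"
    by (simp add: power2_norm_eq_inner inner_add_left inner_add_right inner_commute)
  then show ?case using elim by simp
qed

text \<open>
  A gradient is only assumed to be linear with the right norms, so the chain rule has to come from \<open>\<Gamma>\<close>.
  With \<open>S = \<Sum>\<^sub>i \<partial>\<^sub>iF(X) DX\<^sub>i\<close>, the functional calculus evaluates \<open>\<langle>D(F \<circ> X), D(F \<circ> X)\<rangle>\<close>,
  \<open>\<langle>D(F \<circ> X), S\<rangle>\<close> and \<open>\<langle>S, S\<rangle>\<close> to the same quadratic form \<open>Q\<close>, so \<open>\<parallel>D(F \<circ> X) - S\<parallel>\<^sup>2 = Q - 2Q + Q = 0\<close>.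
  The mixed product uses the calculus with a coordinate function in the second argument.
\<close>
lemma D_gradient_chain_rule:
  fixes X :: "'w \<Rightarrow> real^'d"
  assumes D: "D_gradient M \<D> \<Gamma> D" and X: "\<And>i. (\<lambda>w. X w $ i) \<in> \<D>" and F: "C1_Lipschitz F"
  shows "AE w in M. D (F \<circ> X) w = (\<Sum>i\<in>UNIV. gradient F (X w) $ i *\<^sub>R D (\<lambda>w. X w $ i) w)"
proof -
  have FX: "F \<circ> X \<in> \<D>" by (rule C1_Lipschitz_comp_dom[OF X F])
  have coord: "AE w in M. \<Gamma> (F \<circ> X) (\<lambda>w. X w $ j) w
    = (\<Sum>i\<in>UNIV. gradient F (X w) $ i * \<Gamma> (\<lambda>w. X w $ i) (\<lambda>w. X w $ j) w)" for j
  proof -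
    have "(\<Sum>k\<in>UNIV. gradient F (X w) $ i * axis j 1 $ k * \<Gamma> (\<lambda>w. X w $ i) (\<lambda>w. X w $ k) w)
      = gradient F (X w) $ i * \<Gamma> (\<lambda>w. X w $ i) (\<lambda>w. X w $ j) w" for i w
      by (subst sum.remove[of _ j]) (auto simp: axis_def intro!: sum.neutral)
    then show ?thesis
      using gamma_chain_rule[OF X F C1_Lipschitz_coordinate[of j]]
      by (simp add: gradient_coordinate o_def)
  qed
  have "AE w in M. \<forall>i\<in>UNIV. D (F \<circ> X) w \<bullet> D (\<lambda>w. X w $ i) w = \<Gamma> (F \<circ> X) (\<lambda>w. X w $ i) w"
    by (intro AE_finite_allI D_gradient_inner[OF D FX X]) simp
  moreover have "AE w in M. \<forall>j\<in>UNIV. \<Gamma> (F \<circ> X) (\<lambda>w. X w $ j) w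
    = (\<Sum>i\<in>UNIV. gradient F (X w) $ i * \<Gamma> (\<lambda>w. X w $ i) (\<lambda>w. X w $ j) w)"
    by (intro AE_finite_allI coord) simp
  moreover have "AE w in M. \<forall>i\<in>UNIV. \<forall>j\<in>UNIV.
    D (\<lambda>w. X w $ i) w \<bullet> D (\<lambda>w. X w $ j) w = \<Gamma> (\<lambda>w. X w $ i) (\<lambda>w. X w $ j) w"
    by (intro AE_finite_allI D_gradient_inner[OF D X X]) simp_all
  moreover note D_gradientD(2)[OF D FX] gamma_chain_rule[OF X F F]
  ultimately show ?thesis
  proof eventually_elim
    case (elim w)
    let ?g = "\<lambda>i. gradient F (X w) $ i" and ?D = "\<lambda>i. D (\<lambda>w. X w $ i) w"
    let ?\<Gamma> = "\<lambda>i j. \<Gamma> (\<lambda>w. X w $ i) (\<lambda>w. X w $ j) w"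
    let ?S = "\<Sum>i\<in>UNIV. ?g i *\<^sub>R ?D i"
    let ?Q = "\<Sum>i\<in>UNIV. \<Sum>j\<in>UNIV. ?g i * ?g j * ?\<Gamma> i j"
    have "?S \<bullet> ?S = ?Q"
      using elim by (subst inner_sum_left) (simp add: inner_sum_right sum_distrib_left ac_simps)
    moreover have "D (F \<circ> X) w \<bullet> ?S = ?Q"
    proof -
      have "D (F \<circ> X) w \<bullet> ?S = (\<Sum>j\<in>UNIV. ?g j * (\<Sum>i\<in>UNIV. ?g i * ?\<Gamma> i j))"
        using elim by (simp add: inner_sum_right)
      also have "\<dots> = (\<Sum>j\<in>UNIV. \<Sum>i\<in>UNIV. ?g i * ?g j * ?\<Gamma> i j)"
        by (simp add: sum_distrib_left ac_simps)
      also have "\<dots> = ?Q" by (rule sum.swap)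
      finally show ?thesis .
    qed
    moreover have "D (F \<circ> X) w \<bullet> D (F \<circ> X) w = ?Q"
      using elim by (simp add: power2_norm_eq_inner)
    ultimately have "(D (F \<circ> X) w - ?S) \<bullet> (D (F \<circ> X) w - ?S) = 0"
      by (simp add: inner_diff_left inner_diff_right inner_commute)
    then show ?case by simp
  qed
qed

lemma energy_norm_zero: "energy_norm M \<Gamma> (\<lambda>_. 0) = 0"
proof -
  have "AE w in M. \<Gamma> (\<lambda>_. 0) (\<lambda>_. 0) w = 0"
    using gamma_scale[OF dom_zero dom_zero, of 0] by simp
  then have "(\<integral>w. \<Gamma> (\<lambda>_. 0) (\<lambda>_. 0) w \<partial>M) = 0"
    by (rule integral_eq_zero_AE)
  then show ?thesis by (simp add: energy_norm_def energy_form_def)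
qed

lemma C1_Lipschitz_image_domain:
  fixes X :: "'w \<Rightarrow> real^'d"
  assumes X: "\<And>i. (\<lambda>w. X w $ i) \<in> \<D>" and F: "C1_Lipschitz F"
  shows "F \<in> image_domain M \<D> \<Gamma> X"
  using C1_Lipschitz_comp_dom[OF X F] borel_measurable_continuous_onI[OF C1_LipschitzD(3)[OF F]] F energy_norm_zero
  by (auto simp: image_domain_def intro!: exI[of _ F])

end


section \<open>Conditional expectations given a random vector\<close>

context prob_space
begin

text \<open>
  The conditional expectation given \<open>\<sigma>(X)\<close> has to be factored through \<open>X\<close>. For \<open>Y \<ge> 0\<close> the factor is the
  Radon-Nikodym derivative of the image by \<open>X\<close> of \<open>Y m\<close> with respect to the law of \<open>X\<close>. Any other factor
  agrees with the conditional expectation almost surely, and so inherits its properties.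
\<close>
lemma
  fixes X :: "'a \<Rightarrow> real^'d" and Y :: "'a \<Rightarrow> real"
  assumes X[measurable]: "X \<in> borel_measurable M" and Y: "integrable M Y" and pos: "AE w in M. 0 \<le> Y w"
  shows cond_exp_given_measurable: "cond_exp_given M X Y \<in> borel_measurable borel"
    and cond_exp_given_nonneg: "AE x in distr M borel X. 0 \<le> cond_exp_given M X Y x"
    and cond_exp_given_integrable: "integrable (distr M borel X) (cond_exp_given M X Y)"
    and cond_exp_given_integral: "B \<in> sets borel \<Longrightarrow>
      (\<integral>x\<in>B. cond_exp_given M X Y x \<partial>distr M borel X) = (\<integral>w\<in>X -` B \<inter> space M. Y w \<partial>M)"
proof -
  let ?m = "distr M borel X" and ?F = "vimage_algebra (space M) X borel"
  have [measurable]: "Y \<in> borel_measurable M" using Y by auto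
  have XF: "X \<in> measurable ?F borel" by (rule measurable_vimage_algebra1) simp
  have sub: "subalgebra M ?F"
    using measurable_sets[OF X] by (auto simp: subalgebra_def sets_vimage_algebra2)
  interpret F: finite_measure_subalgebra M ?F
    by unfold_locales (rule sub)
  interpret m: prob_space ?m by (rule prob_space_distr[OF X])
  have sets_F: "A \<in> sets ?F \<Longrightarrow> \<exists>B\<in>sets borel. A = X -` B \<inter> space M" for A
    by (auto simp: sets_vimage_algebra2)
  define N where "N = distr (density M (\<lambda>w. ennreal (Y w))) borel X"
  have N: "emeasure N B = ennreal (\<integral>w\<in>X -` B \<inter> space M. Y w \<partial>M)" if [measurable]: "B \<in> sets borel" for B
  proof -
    have [measurable]: "X -` B \<inter> space M \<in> sets M" by (rule measurable_sets[OF X that])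
    have i: "integrable M (\<lambda>w. indicator (X -` B \<inter> space M) w *\<^sub>R Y w)"
      by (rule integrable_mult_indicator[OF _ Y]) measurable
    have "emeasure N B = (\<integral>\<^sup>+w. ennreal (Y w) * indicator (X -` B \<inter> space M) w \<partial>M)"
      unfolding N_def by (subst emeasure_distr) (auto simp: emeasure_density)
    also have "\<dots> = (\<integral>\<^sup>+w. ennreal (indicator (X -` B \<inter> space M) w *\<^sub>R Y w) \<partial>M)"
      by (intro nn_integral_cong) (auto simp: indicator_def)
    also have "\<dots> = ennreal (\<integral>w\<in>X -` B \<inter> space M. Y w \<partial>M)"
      unfolding set_lebesgue_integral_def
      using pos by (intro nn_integral_eq_integral[OF i]) (auto simp: indicator_def)
    finally show ?thesis .
  qed
  have ac: "absolutely_continuous ?m N"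
    unfolding absolutely_continuous_def
  proof
    fix B assume "B \<in> null_sets ?m"
    then have B[measurable]: "B \<in> sets borel" and "X -` B \<inter> space M \<in> null_sets M"
      by (auto simp: null_sets_distr_iff)
    then have "(\<integral>w\<in>X -` B \<inter> space M. Y w \<partial>M) = 0"
      unfolding set_lebesgue_integral_def
      by (intro integral_eq_zero_AE) (auto dest: AE_not_in)
    with N[OF B] show "B \<in> null_sets N" by (simp add: null_sets_def N_def)
  qed
  define f where "f = RN_deriv ?m N"
  have [measurable]: "f \<in> borel_measurable borel" unfolding f_def by measurable
  have fN: "density ?m f = N"
    unfolding f_def by (rule m.density_RN_deriv[OF ac]) (simp add: N_def)
  have f_int: "(\<integral>\<^sup>+w\<in>X -` B \<inter> space M. f (X w) \<partial>M) = ennreal (\<integral>w\<in>X -` B \<inter> space M. Y w \<partial>M)"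
    if [measurable]: "B \<in> sets borel" for B
  proof -
    have "ennreal (\<integral>w\<in>X -` B \<inter> space M. Y w \<partial>M) = emeasure (density ?m f) B" by (simp add: N fN)
    also have "\<dots> = (\<integral>\<^sup>+x. f x * indicator B x \<partial>?m)" by (simp add: emeasure_density)
    also have "\<dots> = (\<integral>\<^sup>+w. f (X w) * indicator B (X w) \<partial>M)" by (subst nn_integral_distr) auto
    also have "\<dots> = (\<integral>\<^sup>+w\<in>X -` B \<inter> space M. f (X w) \<partial>M)"
      by (intro nn_integral_cong) (auto simp: indicator_def)
    finally show ?thesis by simp
  qed
  have "(\<integral>\<^sup>+w. f (X w) \<partial>M) = (\<integral>\<^sup>+w\<in>X -` UNIV \<inter> space M. f (X w) \<partial>M)"
    by (intro nn_integral_cong) auto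
  also have "\<dots> < \<infinity>" by (subst f_int) auto
  finally have ftot: "(\<integral>\<^sup>+w. f (X w) \<partial>M) < \<infinity>" .
  then have ffin: "AE w in M. f (X w) \<noteq> \<infinity>" by (intro nn_integral_PInf_AE) auto
  define g where "g x = enn2real (f x)" for x
  have [measurable]: "g \<in> borel_measurable borel" unfolding g_def by measurable
  have gf: "AE w in M. ennreal (g (X w)) = f (X w)"
    using ffin by eventually_elim (simp add: g_def less_top)
  have gi: "integrable M (\<lambda>w. g (X w))"
  proof (rule integrableI_nonneg)
    show "(\<integral>\<^sup>+w. ennreal (g (X w)) \<partial>M) < \<infinity>"
      using ftot nn_integral_cong_AE[OF gf] by simp
  qed (auto simp: g_def)
  have "AE w in M. real_cond_exp M ?F Y w = g (X w)"
  proof (rule F.real_cond_exp_charact[OF _ Y gi])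
    show "(\<lambda>w. g (X w)) \<in> borel_measurable ?F" using XF by measurable
    fix A assume "A \<in> sets ?F"
    then obtain B where B[measurable]: "B \<in> sets borel" and A: "A = X -` B \<inter> space M"
      using sets_F by blast
    have [measurable]: "X -` B \<inter> space M \<in> sets M" by (rule measurable_sets[OF X B])
    have i: "integrable M (\<lambda>w. indicator (X -` B \<inter> space M) w *\<^sub>R g (X w))"
      by (rule integrable_mult_indicator[OF _ gi]) measurable
    have "ennreal (\<integral>w\<in>A. g (X w) \<partial>M) = (\<integral>\<^sup>+w. ennreal (indicator A w *\<^sub>R g (X w)) \<partial>M)"
      unfolding set_lebesgue_integral_def A
      by (intro nn_integral_eq_integral[symmetric] i) (auto simp: indicator_def g_def)
    also have "\<dots> = (\<integral>\<^sup>+w\<in>X -` B \<inter> space M. f (X w) \<partial>M)"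
      unfolding A using gf by (intro nn_integral_cong_AE) (auto simp: indicator_def)
    also have "\<dots> = ennreal (\<integral>w\<in>A. Y w \<partial>M)" unfolding A by (rule f_int[OF B])
    finally have "ennreal (\<integral>w\<in>A. g (X w) \<partial>M) = ennreal (\<integral>w\<in>A. Y w \<partial>M)" .
    moreover have "0 \<le> (\<integral>w\<in>A. g (X w) \<partial>M)"
      unfolding set_lebesgue_integral_def by (intro integral_nonneg_AE) (auto simp: g_def)
    moreover have "0 \<le> (\<integral>w\<in>A. Y w \<partial>M)"
      unfolding set_lebesgue_integral_def using pos by (intro integral_nonneg_AE) auto
    ultimately show "(\<integral>w\<in>A. Y w \<partial>M) = (\<integral>w\<in>A. g (X w) \<partial>M)" by simp
  qed
  then have "\<exists>g. g \<in> borel_measurable borel \<and> (AE w in M. g (X w) = real_cond_exp M ?F Y w)"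
    by (intro exI[of _ g] conjI) auto
  note version = someI_ex[OF this, folded cond_exp_given_def]
  then show [measurable]: "cond_exp_given M X Y \<in> borel_measurable borel" by blast
  have eq: "AE w in M. cond_exp_given M X Y (X w) = real_cond_exp M ?F Y w"
    using version by blast
  have ci: "integrable M (real_cond_exp M ?F Y)" by (rule F.real_cond_exp_int(1)[OF Y])
  have "AE w in M. 0 \<le> real_cond_exp M ?F Y w"
    using F.real_cond_exp_pos[OF pos] by simp
  with eq show "AE x in ?m. 0 \<le> cond_exp_given M X Y x"
    by (subst AE_distr_iff) auto
  have "integrable M (\<lambda>w. cond_exp_given M X Y (X w))"
    using eq ci by (subst integrable_cong_AE) auto
  then show "integrable ?m (cond_exp_given M X Y)"
    by (subst integrable_distr_eq) auto
  assume B[measurable]: "B \<in> sets borel"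
  have A: "X -` B \<inter> space M \<in> sets ?F" using B by (auto simp: sets_vimage_algebra2)
  have [measurable]: "X -` B \<inter> space M \<in> sets M" by (rule measurable_sets[OF X B])
  have "(\<integral>x\<in>B. cond_exp_given M X Y x \<partial>?m) = (\<integral>w. indicator B (X w) *\<^sub>R cond_exp_given M X Y (X w) \<partial>M)"
    unfolding set_lebesgue_integral_def by (subst integral_distr) auto
  also have "\<dots> = (\<integral>w\<in>X -` B \<inter> space M. real_cond_exp M ?F Y w \<partial>M)"
    unfolding set_lebesgue_integral_def using eq by (intro integral_cong_AE) (auto simp: indicator_def)
  also have "\<dots> = (\<integral>w\<in>X -` B \<inter> space M. Y w \<partial>M)"
    by (rule F.real_cond_exp_intA[OF Y A, symmetric])
  finally show "(\<integral>x\<in>B. cond_exp_given M X Y x \<partial>?m) = (\<integral>w\<in>X -` B \<inter> space M. Y w \<partial>M)" .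
qed

end

section \<open>The measure-valued gradient on the image structure\<close>

text \<open>
  The noise lives over the space of the error structure and takes values in the space of the gradient, so
  that \<open>pairing\<close> can be applied to gradients.
\<close>
locale image_gradient_structure = error_structure M \<D> \<Gamma> + hilbert_noise P M \<nu>
  for M :: "'w measure" and \<D> \<Gamma> and P :: "'o measure"
    and \<nu> :: "'w set \<Rightarrow> 'o \<Rightarrow> 'h::{real_inner, banach, second_countable_topology}" +
  fixes D :: "('w \<Rightarrow> real) \<Rightarrow> 'w \<Rightarrow> 'h" and X :: "'w \<Rightarrow> real^'d"
  assumes D: "D_gradient M \<D> \<Gamma> D" and X_dom: "\<And>i. (\<lambda>w. X w $ i) \<in> \<D>"
begin

lemma X_measurable[measurable]: "X \<in> borel_measurable M"
  using X_dom dom_L2 by (intro borel_measurable_vecI L2_space_measurable) auto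

lemma represents_image_gradient:
  "F \<circ> X \<in> \<D> \<Longrightarrow> represents borel X (D (F \<circ> X)) (image_gradient M P D \<nu> X F)"
  unfolding image_gradient_def mv_gradient_def
  by (intro represents_wn_image X_measurable D_gradientD(1)[OF D])

lemma image_gamma_facts:
  assumes F: "F \<circ> X \<in> \<D>"
  shows "image_gamma M \<Gamma> X F \<in> borel_measurable borel"
    and "AE x in distr M borel X. 0 \<le> image_gamma M \<Gamma> X F x"
    and "integrable (distr M borel X) (image_gamma M \<Gamma> X F)"
    and "B \<in> sets borel \<Longrightarrow> (\<integral>x\<in>B. image_gamma M \<Gamma> X F x \<partial>distr M borel X)
      = (\<integral>w\<in>X -` B \<inter> space M. \<Gamma> (F \<circ> X) (F \<circ> X) w \<partial>M)"
  unfolding image_gamma_def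
  using gamma_integrable[OF F F] gamma_pos[OF F]
  by (auto intro!: cond_exp_given_measurable cond_exp_given_nonneg cond_exp_given_integrable
      cond_exp_given_integral)

text \<open>
  Both measures give \<open>B\<close> the mass \<open>\<integral> 1\<^sub>B(X) \<Gamma>[F \<circ> X] dm\<close>: the left one because \<open>\<parallel>D(F \<circ> X)\<parallel>\<^sup>2 = \<Gamma>[F \<circ> X]\<close>,
  the right one by the defining property of the conditional expectation.
\<close>
lemma wn_measure_image_gradient:
  assumes F: "F \<circ> X \<in> \<D>"
  shows "wn_measure P borel (image_gradient M P D \<nu> X F)
    = density (distr M borel X) (\<lambda>x. ennreal (image_gamma M \<Gamma> X F x))"
proof -
  let ?g = "image_gamma M \<Gamma> X F" and ?m = "distr M borel X"
  note DF = D_gradientD(1,2)[OF D F]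
  note [measurable] = image_gamma_facts(1)[OF F] L2_space_measurable[OF DF(1)]
  have "wn_measure P borel (image_gradient M P D \<nu> X F) = image_density borel X (D (F \<circ> X))"
    by (rule wn_measure_represents[OF X_measurable DF(1) represents_image_gradient[OF F]])
  also have "\<dots> = density ?m (\<lambda>x. ennreal (?g x))"
  proof (rule measure_eqI)
    fix B assume "B \<in> sets (image_density borel X (D (F \<circ> X)))"
    then have B[measurable]: "B \<in> sets borel" by simp
    have A[measurable]: "X -` B \<inter> space M \<in> sets M" by (rule measurable_sets[OF X_measurable B])
    have i: "integrable ?m (\<lambda>x. indicator B x *\<^sub>R ?g x)"
      by (rule integrable_mult_indicator[OF _ image_gamma_facts(3)[OF F]]) simp
    have [measurable]: "\<Gamma> (F \<circ> X) (F \<circ> X) \<in> borel_measurable M" using gamma_integrable[OF F F] by auto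
    have "emeasure (image_density borel X (D (F \<circ> X))) B
      = ennreal (\<integral>w. (norm (indicator (X -` B \<inter> space M) w *\<^sub>R D (F \<circ> X) w))\<^sup>2 \<partial>M)"
      by (rule emeasure_image_density[OF X_measurable DF(1) B])
    also have "(\<integral>w. (norm (indicator (X -` B \<inter> space M) w *\<^sub>R D (F \<circ> X) w))\<^sup>2 \<partial>M)
      = (\<integral>w\<in>X -` B \<inter> space M. \<Gamma> (F \<circ> X) (F \<circ> X) w \<partial>M)"
      unfolding set_lebesgue_integral_def using DF(2)
      by (intro integral_cong_AE) (auto simp: indicator_def)
    also have "\<dots> = (\<integral>x\<in>B. ?g x \<partial>?m)" by (rule image_gamma_facts(4)[OF F B, symmetric])
    also have "ennreal \<dots> = (\<integral>\<^sup>+x. ennreal (indicator B x *\<^sub>R ?g x) \<partial>?m)"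
      unfolding set_lebesgue_integral_def using image_gamma_facts(2)[OF F]
      by (intro nn_integral_eq_integral[symmetric] i) (auto simp: indicator_def)
    also have "\<dots> = (\<integral>\<^sup>+x. ennreal (?g x) * indicator B x \<partial>?m)"
      by (intro nn_integral_cong) (auto simp: indicator_def)
    also have "\<dots> = emeasure (density ?m (\<lambda>x. ennreal (?g x))) B"
      by (simp add: emeasure_density)
    finally show "emeasure (image_density borel X (D (F \<circ> X))) B = emeasure (density ?m (\<lambda>x. ennreal (?g x))) B" .
  qed simp
  finally show ?thesis .
qed

lemma RN_deriv_image_gradient:
  assumes F: "F \<circ> X \<in> \<D>"
  shows "absolutely_continuous (distr M borel X) (wn_measure P borel (image_gradient M P D \<nu> X F))"
    and "AE x in distr M borel X. RN_deriv (distr M borel X) (wn_measure P borel (image_gradient M P D \<nu> X F)) x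
      = ennreal (image_gamma M \<Gamma> X F x)"
proof -
  interpret m: prob_space "distr M borel X" by (rule prob_space_distr) simp
  note [measurable] = image_gamma_facts(1)[OF F]
  have meas: "(\<lambda>x. ennreal (image_gamma M \<Gamma> X F x)) \<in> borel_measurable (distr M borel X)" by simp
  show "absolutely_continuous (distr M borel X) (wn_measure P borel (image_gradient M P D \<nu> X F))"
    unfolding wn_measure_image_gradient[OF F] by (rule absolutely_continuousI_density[OF meas])
  have "AE x in distr M borel X. ennreal (image_gamma M \<Gamma> X F x)
    = RN_deriv (distr M borel X) (wn_measure P borel (image_gradient M P D \<nu> X F)) x"
    by (rule m.RN_deriv_unique[OF meas wn_measure_image_gradient[OF F, symmetric]])
  then show "AE x in distr M borel X.
    RN_deriv (distr M borel X) (wn_measure P borel (image_gradient M P D \<nu> X F)) x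
      = ennreal (image_gamma M \<Gamma> X F x)"
    by eventually_elim simp
qed

abbreviation DX :: "'d \<Rightarrow> 'w \<Rightarrow> 'h" where
  "DX i \<equiv> D (\<lambda>w. X w $ i)"

lemma DX_L2: "DX i \<in> L2_space M"
  by (rule D_gradientD(1)[OF D X_dom])

lemma represents_image_gradient_identity:
  "represents borel X (DX i) (\<lambda>A \<omega>. image_gradient_vec M P D \<nu> X (\<lambda>x. x) A \<omega> $ i)"
  using represents_image_gradient[of "\<lambda>x. x $ i"] X_dom[of i]
  by (simp add: image_gradient_vec_def o_def)

text \<open>
  The image under \<open>pairing\<close> of the chain rule for \<open>D\<close>, multiplied by \<open>1\<^sub>A(X)\<close>. Boundedness of the gradient
  of \<open>F\<close> makes the integrals against the components of \<open>d\<^sub>GI\<close> meaningful.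
\<close>
lemma image_gradient_chain_rule:
  assumes F: "C1_Lipschitz F" and A[measurable]: "A \<in> sets borel"
  shows "AE \<omega> in P. image_gradient M P D \<nu> X F A \<omega>
    = wn_dot borel P (gradient F) (image_gradient_vec M P D \<nu> X (\<lambda>x. x)) A \<omega>"
proof -
  let ?\<Lambda> = "image_gradient_vec M P D \<nu> X (\<lambda>x. x)"
  let ?\<mu> = "\<lambda>i. image_density borel X (DX i)"
  let ?f = "\<lambda>i x. indicator A x * gradient F x $ i"
  let ?\<psi> = "\<lambda>i w. ?f i (X w) *\<^sub>R DX i w"
  note rep = represents_image_gradient_identity
  have FX: "F \<circ> X \<in> \<D>" by (rule C1_Lipschitz_comp_dom[OF X_dom F])
  have B[measurable]: "X -` A \<inter> space M \<in> sets M" by (rule measurable_sets[OF X_measurable A])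
  have [measurable]: "(\<lambda>x. gradient F x $ i) \<in> borel_measurable borel" for i
    by (intro borel_measurable_continuous_onI bounded_linear.continuous_on[OF bounded_linear_vec_nth]
        C1_LipschitzD(2)[OF F])
  have f: "?f i \<in> L2_space (?\<mu> i)" for i
  proof -
    interpret \<mu>: finite_measure "?\<mu> i" by (rule finite_measure_image_density[OF X_measurable DX_L2])
    obtain C where C: "\<And>x i. \<bar>gradient F x $ i\<bar> \<le> C" using C1_Lipschitz_gradient_bounded[OF F] by blast
    have "\<bar>?f i x\<bar> \<le> \<bar>C\<bar>" for x using C[of x i] by (auto simp: indicator_def)
    then show ?thesis by (intro L2_space_bound[OF \<mu>.L2_space_const[of C]]) auto
  qed
  have \<psi>: "?\<psi> i \<in> L2_space M" for i
    by (rule image_density_L2(1)[OF X_measurable DX_L2 f])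
  have "AE \<omega> in P. \<forall>i\<in>UNIV. wn_times (wn_measure P borel (\<lambda>B \<omega>. ?\<Lambda> B \<omega> $ i)) P (\<lambda>x. gradient F x $ i)
    (\<lambda>B \<omega>. ?\<Lambda> B \<omega> $ i) A \<omega> = pairing (?\<psi> i) \<omega>"
    unfolding wn_times_def wn_measure_represents[OF X_measurable DX_L2 rep]
    by (intro AE_finite_allI wn_integral_eq_pairing(2)[OF X_measurable DX_L2 rep f]) simp
  moreover have "AE \<omega> in P. pairing (\<lambda>w. \<Sum>i\<in>UNIV. ?\<psi> i w) \<omega> = (\<Sum>i\<in>UNIV. pairing (?\<psi> i) \<omega>)"
    by (rule pairing_sum[OF \<psi>])
  moreover have "AE \<omega> in P. pairing (\<lambda>w. indicator (X -` A \<inter> space M) w *\<^sub>R D (F \<circ> X) w) \<omega>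
    = pairing (\<lambda>w. \<Sum>i\<in>UNIV. ?\<psi> i w) \<omega>"
  proof (rule pairing_cong_AE)
    show "AE w in M. indicator (X -` A \<inter> space M) w *\<^sub>R D (F \<circ> X) w = (\<Sum>i\<in>UNIV. ?\<psi> i w)"
      using D_gradient_chain_rule[OF D X_dom F] AE_space
      by eventually_elim (auto simp: indicator_def)
  qed (intro L2_space_sum \<psi> L2_space_indicator[OF D_gradientD(1)[OF D FX] B])+
  moreover have "AE \<omega> in P. image_gradient M P D \<nu> X F A \<omega>
    = pairing (\<lambda>w. indicator (X -` A \<inter> space M) w *\<^sub>R D (F \<circ> X) w) \<omega>"
    using represents_image_gradient[OF FX] A by (auto simp: represents_def)
  ultimately show ?thesis
    by eventually_elim (simp add: wn_dot_def)
qed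

text \<open>
  On the image, \<open>\<Gamma>\<^sub>X[I\<^sub>i, I\<^sub>j]\<close> is defined by polarization of conditional expectations; on \<open>W\<close> the
  polarization of \<open>\<Gamma>\<close> yields \<open>\<langle>DX\<^sub>i, DX\<^sub>j\<rangle>\<close>.
\<close>
lemma
  shows integrable_image_gamma_bilin:
      "integrable (distr M borel X) (image_gamma_bilin M \<Gamma> X (\<lambda>x. x $ i) (\<lambda>x. x $ j))"
    and wn_matrix_image_gradient: "A \<in> sets borel \<Longrightarrow>
      wn_matrix P (image_gradient_vec M P D \<nu> X (\<lambda>x. x)) A $ i $ j
        = (\<integral>x\<in>A. image_gamma_bilin M \<Gamma> X (\<lambda>x. x $ i) (\<lambda>x. x $ j) x \<partial>distr M borel X)"
proof -
  let ?m = "distr M borel X"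
  let ?u = "\<lambda>w. X w $ i" and ?v = "\<lambda>w. X w $ j"
  let ?p = "\<lambda>w. X w $ i + X w $ j" and ?d = "\<lambda>w. X w $ i - X w $ j"
  let ?gp = "image_gamma M \<Gamma> X (\<lambda>x. x $ i + x $ j)" and ?gd = "image_gamma M \<Gamma> X (\<lambda>x. x $ i - x $ j)"
  have p: "?p \<in> \<D>" and d: "?d \<in> \<D>" by (intro dom_add dom_diff X_dom)+
  note gp = image_gamma_facts[of "\<lambda>x. x $ i + x $ j", unfolded o_def, OF p]
  note gd = image_gamma_facts[of "\<lambda>x. x $ i - x $ j", unfolded o_def, OF d]
  have bilin: "image_gamma_bilin M \<Gamma> X (\<lambda>x. x $ i) (\<lambda>x. x $ j) = (\<lambda>x. (?gp x - ?gd x) / 4)"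
    by (simp add: image_gamma_bilin_def fun_eq_iff)
  show "integrable ?m (image_gamma_bilin M \<Gamma> X (\<lambda>x. x $ i) (\<lambda>x. x $ j))"
    unfolding bilin using gp(3) gd(3) by simp
  assume A[measurable]: "A \<in> sets borel"
  have B[measurable]: "X -` A \<inter> space M \<in> sets M" by (rule measurable_sets[OF X_measurable A])
  have set_int: "set_integrable N S f" if "integrable N f" "S \<in> sets N" for N S and f :: "_ \<Rightarrow> real"
    using that unfolding set_integrable_def by (intro integrable_mult_indicator)
  have \<Gamma>int: "integrable M (\<Gamma> ?p ?p)" "integrable M (\<Gamma> ?d ?d)" "integrable M (\<Gamma> ?u ?v)"
    by (intro gamma_integrable p d X_dom)+
  then have [measurable]: "\<Gamma> ?p ?p \<in> borel_measurable M" "\<Gamma> ?d ?d \<in> borel_measurable M" by auto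
  have [measurable]: "DX i \<in> borel_measurable M" for i by (rule L2_space_measurable[OF DX_L2])
  have "(\<integral>x\<in>A. image_gamma_bilin M \<Gamma> X (\<lambda>x. x $ i) (\<lambda>x. x $ j) x \<partial>?m)
    = ((\<integral>x\<in>A. ?gp x \<partial>?m) - (\<integral>x\<in>A. ?gd x \<partial>?m)) / 4"
    unfolding bilin set_lebesgue_integral_def
    using set_int[OF gp(3), of A] set_int[OF gd(3), of A]
    by (simp add: set_integrable_def right_diff_distrib diff_divide_distrib)
  also have "\<dots> = ((\<integral>w\<in>X -` A \<inter> space M. \<Gamma> ?p ?p w \<partial>M) - (\<integral>w\<in>X -` A \<inter> space M. \<Gamma> ?d ?d w \<partial>M)) / 4"
    by (simp only: gp(4)[OF A] gd(4)[OF A])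
  also have "\<dots> = (\<integral>w\<in>X -` A \<inter> space M. (\<Gamma> ?p ?p w - \<Gamma> ?d ?d w) / 4 \<partial>M)"
    unfolding set_lebesgue_integral_def
    using set_int[OF \<Gamma>int(1) B] set_int[OF \<Gamma>int(2) B]
    by (simp add: set_integrable_def right_diff_distrib diff_divide_distrib)
  also have "\<dots> = (\<integral>w\<in>X -` A \<inter> space M. DX i w \<bullet> DX j w \<partial>M)"
    unfolding set_lebesgue_integral_def
  proof (rule integral_cong_AE)
    show "AE w in M. indicator (X -` A \<inter> space M) w *\<^sub>R ((\<Gamma> ?p ?p w - \<Gamma> ?d ?d w) / 4)
      = indicator (X -` A \<inter> space M) w *\<^sub>R (DX i w \<bullet> DX j w)"
      using gamma_polarization[OF X_dom X_dom, of i j] D_gradient_inner[OF D X_dom X_dom, of i j]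
      by eventually_elim simp
  qed measurable
  also have "\<dots> = wn_matrix P (image_gradient_vec M P D \<nu> X (\<lambda>x. x)) A $ i $ j"
    by (rule wn_matrix_represents[OF X_measurable DX_L2 represents_image_gradient_identity A, symmetric])
  finally show "wn_matrix P (image_gradient_vec M P D \<nu> X (\<lambda>x. x)) A $ i $ j
    = (\<integral>x\<in>A. image_gamma_bilin M \<Gamma> X (\<lambda>x. x $ i) (\<lambda>x. x $ j) x \<partial>?m)" by simp
qed

end

theorem proposition3:
  fixes M :: "'w measure" and P :: "'o measure"
    and \<D> :: "('w \<Rightarrow> real) set"
    and \<Gamma> :: "('w \<Rightarrow> real) \<Rightarrow> ('w \<Rightarrow> real) \<Rightarrow> 'w \<Rightarrow> real"
    and D :: "('w \<Rightarrow> real) \<Rightarrow> 'w \<Rightarrow> 'h::{real_inner, banach, second_countable_topology}"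
    and \<nu> :: "'w set \<Rightarrow> 'o \<Rightarrow> 'h"
    and X :: "'w \<Rightarrow> real^'d"
  assumes "error_structure M \<D> \<Gamma>"
    and "D_gradient M \<D> \<Gamma> D"
    and "hilbert_white_noise P M \<nu>"
    and "\<And>i. (\<lambda>w. X w $ i) \<in> \<D>"
  defines "m\<^sub>X \<equiv> distr M borel X"
    and "\<D>\<^sub>X \<equiv> image_domain M \<D> \<Gamma> X"
    and "d\<^sub>G \<equiv> image_gradient M P D \<nu> X"
    and "d\<^sub>GI \<equiv> image_gradient_vec M P D \<nu> X (\<lambda>x. x)"
  shows
    "(\<forall>F\<in>\<D>\<^sub>X.
        white_noise P (wn_measure P borel (d\<^sub>G F)) (d\<^sub>G F) \<and>
        absolutely_continuous m\<^sub>X (wn_measure P borel (d\<^sub>G F)) \<and>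
        (AE x in m\<^sub>X. 0 \<le> image_gamma M \<Gamma> X F x \<and>
           RN_deriv m\<^sub>X (wn_measure P borel (d\<^sub>G F)) x = ennreal (image_gamma M \<Gamma> X F x))) \<and>
     (\<forall>F. C1_Lipschitz F \<longrightarrow>
        (\<forall>A\<in>sets borel. AE \<omega> in P. d\<^sub>G F A \<omega> = wn_dot borel P (gradient F) d\<^sub>GI A \<omega>)) \<and>
     (\<forall>i. (\<lambda>x. x $ i) \<in> \<D>\<^sub>X) \<and>
     (\<forall>A\<in>sets borel. AE \<omega> in P. d\<^sub>GI A \<omega> = wn_image M X (mv_gradient_vec M P D \<nu> X) A \<omega>) \<and>
     vector_white_noise P borel (wn_matrix P d\<^sub>GI) d\<^sub>GI \<and>
     (\<forall>i j. integrable m\<^sub>X (image_gamma_bilin M \<Gamma> X (\<lambda>x. x $ i) (\<lambda>x. x $ j)) \<and>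
        (\<forall>A\<in>sets borel. wn_matrix P d\<^sub>GI A $ i $ j =
           (\<integral>x\<in>A. image_gamma_bilin M \<Gamma> X (\<lambda>x. x $ i) (\<lambda>x. x $ j) x \<partial>m\<^sub>X)))"
proof -
  interpret image_gradient_structure M \<D> \<Gamma> P \<nu> D X
  proof (intro image_gradient_structure.intro hilbert_noise.intro hilbert_noise_axioms.intro
      image_gradient_structure_axioms.intro assms(1-4))
    show "prob_space P" "finite_measure M" using assms(3) by (auto simp: hilbert_white_noise_def)
  qed
  note defs = m\<^sub>X_def \<D>\<^sub>X_def d\<^sub>G_def d\<^sub>GI_def
  show ?thesis
  proof (intro conjI ballI allI impI)
    fix F assume "F \<in> \<D>\<^sub>X"
    then have F: "F \<circ> X \<in> \<D>" by (simp add: \<D>\<^sub>X_def image_domain_def)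
    show "white_noise P (wn_measure P borel (d\<^sub>G F)) (d\<^sub>G F)"
      unfolding defs
      by (rule white_noise_represents[OF X_measurable D_gradientD(1)[OF D F] represents_image_gradient[OF F]])
    show "absolutely_continuous m\<^sub>X (wn_measure P borel (d\<^sub>G F))"
      unfolding defs by (rule RN_deriv_image_gradient(1)[OF F])
    show "AE x in m\<^sub>X. 0 \<le> image_gamma M \<Gamma> X F x \<and>
      RN_deriv m\<^sub>X (wn_measure P borel (d\<^sub>G F)) x = ennreal (image_gamma M \<Gamma> X F x)"
      unfolding defs using image_gamma_facts(2)[OF F] RN_deriv_image_gradient(2)[OF F] by eventually_elim simp
  next
    fix F :: "real^'d \<Rightarrow> real" and A :: "(real^'d) set"
    assume "C1_Lipschitz F" "A \<in> sets borel"
    then show "AE \<omega> in P. d\<^sub>G F A \<omega> = wn_dot borel P (gradient F) d\<^sub>GI A \<omega>"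
      unfolding defs by (rule image_gradient_chain_rule)
  next
    show "(\<lambda>x. x $ i) \<in> \<D>\<^sub>X" for i
      unfolding defs by (rule C1_Lipschitz_image_domain[OF X_dom C1_Lipschitz_coordinate])
  next
    fix A :: "(real^'d) set"
    show "AE \<omega> in P. d\<^sub>GI A \<omega> = wn_image M X (mv_gradient_vec M P D \<nu> X) A \<omega>"
      unfolding defs
      by (simp add: image_gradient_vec_def image_gradient_def wn_image_def mv_gradient_vec_def o_def)
  next
    show "vector_white_noise P borel (wn_matrix P d\<^sub>GI) d\<^sub>GI"
      unfolding defs
      by (rule vector_white_noise_represents[OF X_measurable DX_L2 represents_image_gradient_identity])
  next
    show "integrable m\<^sub>X (image_gamma_bilin M \<Gamma> X (\<lambda>x. x $ i) (\<lambda>x. x $ j))" for i j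
      unfolding defs by (rule integrable_image_gamma_bilin)
    show "wn_matrix P d\<^sub>GI A $ i $ j = (\<integral>x\<in>A. image_gamma_bilin M \<Gamma> X (\<lambda>x. x $ i) (\<lambda>x. x $ j) x \<partial>m\<^sub>X)"
      if "A \<in> sets borel" for A i j
      unfolding defs by (rule wn_matrix_image_gradient[OF that])
  qed
qed

end
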